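(* Let $\varepsilon>0$, $c_q>0$, and let $u,v\in(-1,\infty)$ be constants not depending on $N$ with $\max(u,v)<1$ (the maximal current phase). For each $N$ let $q=q(N)=\exp(-c_qN^{-\varepsilon})$, and let $\alpha=\alpha(N)=\frac{1-q}{1+u}$ and $\beta=\beta(N)=\frac{1-q}{1+v}$. Let $I=\{a,\dots,b\}\subseteq\{1,\dots,N\}$ with $a=a(N)$, $b=b(N)$ be intervals such that one of the following holds: (a) $u+v\le0$, $\varepsilon<\frac12$ and $\min(a,N-b)\gg\max\big(N^{2\varepsilon}\log^2(N),|I|\big)$; (b) $u+v>0$, $\varepsilon<\frac13$ and $\min(a,N-b)\gg\max\big(N^{3\varepsilon}\log(N),|I|\big)$. Then $$\lim_{N\to\infty}\left\|\mu_I-\mathrm{Ber}_I\left(\tfrac12\right)\right\|_{\mathrm{TV}}=0 .$$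
   Context: The open (weakly) asymmetric simple exclusion process with parameters $(q,\alpha,\beta)$ on $\{1,\dots,N\}$ is the continuous-time Markov chain on $\Omega_N=\{0,1\}^N$ with generator $$\mathcal{L}f(\eta)=\sum_{x=1}^{N-1}\big(\eta(x)(1-\eta(x+1))+q\,\eta(x+1)(1-\eta(x))\big)[f(\eta^{x,x+1})-f(\eta)]+\alpha(1-\eta(1))[f(\eta^1)-f(\eta)]+\beta\eta(N)[f(\eta^N)-f(\eta)],$$ where $\eta^{x,y}$ is $\eta$ with the values at $x$ and $y$ swapped and $\eta^{w}$ is $\eta$ with the value at $w$ flipped. It has a unique stationary distribution $\mu=\mu^{N,q,\alpha,\beta}$. For an interval $I$, $\mu_I$ denotes the projection (marginal) of $\mu$ onto the coordinates in $I$, viewed as a probability measure on $\{0,1\}^{|I|}$, and $\mathrm{Ber}_I(\rho)$ denotes the Bernoulli-$\rho$ product measure on $\{0,1\}^{|I|}$. $\|\nu-\nu'\|_{\mathrm{TV}}=\frac12\sum_x|\nu(x)-\nu'(x)|$. For functions $f,g$ of $N$, $f\gg g$ means $\liminf_{N\to\infty}f(N)/g(N)=\infty$. Note that $u=\frac{1-q}{\alpha}-1$ and $v=\frac{1-q}{\beta}-1$. *)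

theory Defs
  imports "HOL-Probability.Probability" "HOL-Probability.Product_PMF"
begin

text \<open>
  A configuration in \<open>{0,1}\<^sup>I\<close> is a function \<open>nat \<Rightarrow> bool\<close> (True = occupied) that is
  False at all sites outside \<open>I\<close>.
\<close>

definition configs :: "nat set \<Rightarrow> (nat \<Rightarrow> bool) set" where
  "configs I = PiE_dflt I False (\<lambda>_. UNIV)"

definition swap_sites :: "(nat \<Rightarrow> bool) \<Rightarrow> nat \<Rightarrow> nat \<Rightarrow> (nat \<Rightarrow> bool)" where
  "swap_sites \<eta> x y = \<eta>(x := \<eta> y, y := \<eta> x)"

definition flip_site :: "(nat \<Rightarrow> bool) \<Rightarrow> nat \<Rightarrow> (nat \<Rightarrow> bool)" where
  "flip_site \<eta> w = \<eta>(w := \<not> \<eta> w)"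

definition open_asep_generator ::
    "nat \<Rightarrow> real \<Rightarrow> real \<Rightarrow> real \<Rightarrow> ((nat \<Rightarrow> bool) \<Rightarrow> real) \<Rightarrow> (nat \<Rightarrow> bool) \<Rightarrow> real" where
  "open_asep_generator N q \<alpha> \<beta> f \<eta> =
     (\<Sum>x=1..N-1. (of_bool (\<eta> x) * (1 - of_bool (\<eta> (x+1)))
                   + q * of_bool (\<eta> (x+1)) * (1 - of_bool (\<eta> x)))
                 * (f (swap_sites \<eta> x (x+1)) - f \<eta>))
     + \<alpha> * (1 - of_bool (\<eta> 1)) * (f (flip_site \<eta> 1) - f \<eta>)
     + \<beta> * of_bool (\<eta> N) * (f (flip_site \<eta> N) - f \<eta>)"

text \<open>
  Stationarity of a probability distribution for a chain on a finite state space with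
  generator \<open>L\<close>: \<open>\<mu> L = 0\<close>, tested against all observables. The generator maps
  observables on \<open>configs {1..N}\<close> to observables on \<open>configs {1..N}\<close> when \<open>N \<ge> 1\<close>, so the
  values of \<open>f\<close> elsewhere play no role.
\<close>

definition open_asep_stationary ::
    "nat \<Rightarrow> real \<Rightarrow> real \<Rightarrow> real \<Rightarrow> (nat \<Rightarrow> bool) pmf \<Rightarrow> bool" where
  "open_asep_stationary N q \<alpha> \<beta> \<mu> \<longleftrightarrow>
     set_pmf \<mu> \<subseteq> configs {1..N} \<and>
     (\<forall>f. measure_pmf.expectation \<mu> (open_asep_generator N q \<alpha> \<beta> f) = 0)"

text \<open>Marginals stay indexed by the sites of \<open>I\<close>, without relabelling to \<open>{1..|I|}\<close>.\<close>

definition marginal :: "nat set \<Rightarrow> (nat \<Rightarrow> bool) pmf \<Rightarrow> (nat \<Rightarrow> bool) pmf" where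
  "marginal I \<mu> = map_pmf (\<lambda>\<eta> x. if x \<in> I then \<eta> x else False) \<mu>"

definition Ber :: "nat set \<Rightarrow> real \<Rightarrow> (nat \<Rightarrow> bool) pmf" where
  "Ber I \<rho> = Pi_pmf I False (\<lambda>_. bernoulli_pmf \<rho>)"

definition tv_dist :: "'a set \<Rightarrow> 'a pmf \<Rightarrow> 'a pmf \<Rightarrow> real" where
  "tv_dist S \<nu> \<nu>' = 1 / 2 * (\<Sum>x\<in>S. \<bar>pmf \<nu> x - pmf \<nu>' x\<bar>)"

definition much_greater :: "(nat \<Rightarrow> real) \<Rightarrow> (nat \<Rightarrow> real) \<Rightarrow> bool" where
  "much_greater f g \<longleftrightarrow> liminf (\<lambda>N. ereal (f N / g N)) = \<infinity>"

end

theory Submission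
  imports Defs "HOL-Real_Asymp.Real_Asymp"
begin

text \<open>
  The stationary measure is a matrix product, and in a suitable basis its matrices are bidiagonal
  and nonnegative. With \<open>c n = (1 - q^n) (1 - u v q^(n-1))\<close> put
  \<open>D = diag (1 + v q^n) + \<close> (superdiagonal \<open>sqrt (c (n+1))\<close>) and
  \<open>E = diag (1 + u q^n) + \<close> (subdiagonal \<open>sqrt (c n)\<close>). Then
  \<open>D E - q E D = (1 - q) (D + E)\<close>, the first basis vector is a left eigenvector of \<open>E\<close> and a right
  eigenvector of \<open>D\<close>, and the weight of a configuration is the corner entry of the product of its
  letters. Summing over the letters outside \<open>I\<close> replaces them by \<open>T = (D + E) / 4\<close>, so the
  marginal of a word \<open>x\<close> of length \<open>m\<close> is proportional to the corner entry of \<open>T^i X T^r\<close>, where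
  \<open>X\<close> is the product of the letters of \<open>x\<close> and \<open>i\<close>, \<open>r\<close> are the distances from \<open>I\<close> to the ends.

  In the maximal current phase \<open>T\<close> has row sums at most 1: it is one step of a symmetric walk on the
  naturals, killed at level \<open>n\<close> with probability of order \<open>q^n\<close> and otherwise close to the lazy walk
  with probabilities 1/4, 1/2, 1/4. The killing is a soft wall of width \<open>L\<close> of order
  \<open>N^\<epsilon> log N\<close>. Beyond the wall \<open>D / 2\<close> and \<open>E / 2\<close> are nearly \<open>(1 + shift) / 2\<close>, so a word
  influences the corner entry only through a displacement of order \<open>sqrt m\<close>. The walk is at height
  of order \<open>sqrt i\<close> when it enters \<open>I\<close>, and everything varies on that scale. Hence all words of
  length \<open>m\<close> have nearly the same weight as soon as \<open>m\<close> and \<open>L^2\<close> are both small compared with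
  \<open>i\<close> and \<open>r\<close>. This covers both regimes of the theorem, because \<open>N^(3\<epsilon>) log N\<close> eventually exceeds
  \<open>N^(2\<epsilon>) log^2 N\<close>.

  The quantitative part needs the behaviour of \<open>z k\<close>, the corner entry of \<open>T^k\<close>, up to constants. Let
  \<open>h\<close> be the positive solution of \<open>T h = h\<close>, let \<open>P = h^-1 T h\<close> be the conditioned walk, reversible
  with respect to \<open>\<pi> = h^2\<close>, and let \<open>F k = P^k 1_{0}\<close>. Total positivity of tridiagonal matrices
  shows that \<open>F k n\<close> decreases in \<open>n\<close> and that \<open>F (k+1) n / F k n\<close> increases in \<open>n\<close>. The second
  fact makes \<open>z\<close> log-convex and bounds the flux of \<open>F\<close> through any edge by the decay rate
  \<open>\<kappa> k = 1 - z (k+1) / z k\<close>; so if \<open>\<kappa> k\<close> is small then \<open>F k\<close> is flat near the origin, and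
  conservation of mass makes \<open>z k\<close> small. Balancing the two gives the upper bound
  \<open>z k \<le> 2 / \<pi>{0..n}\<close> for \<open>n \<ge> L\<close> and \<open>k\<close> at least a suitable multiple of \<open>n^2\<close>
  (\<open>z_upper\<close>, \<open>z_upper_free\<close>). A second moment bound for \<open>P\<close> gives the matching lower bound (\<open>z_lower\<close>), and volume doubling of \<open>\<pi>\<close> beyond the wall then yields
  \<open>\<kappa> r = O(1/r)\<close> (\<open>z_comparable\<close>).

  The comparison of words is \<open>word_sum_le_loss\<close> and \<open>word_sum_bound\<close>; the conditions on the walk are
  verified in \<open>asep_killed_walk\<close>; stationarity and uniqueness of the matrix product are
  \<open>matrix_product_stationary\<close> and \<open>stationary_eq_matrix_product\<close>.
\<close>

section \<open>Symmetric walks on the half-line with a wall at the origin\<close>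

lemma power_one_minus_le: "(1 - x) ^ m * (1 + real m * x) \<le> 1" if "0 \<le> x" "x < 1" for x :: real
proof -
  have "(1 - x) ^ m * (1 + real m * x) \<le> (1 - x) ^ m * (1 + x) ^ m"
    using that by (intro mult_left_mono Bernoulli_inequality) auto
  also have "\<dots> = (1 - x\<^sup>2) ^ m" by (simp add: power_mult_distrib[symmetric] power2_eq_square algebra_simps)
  also have "\<dots> \<le> 1" using that by (intro power_le_one) (auto simp: power2_eq_square mult_le_one)
  finally show ?thesis .
qed

text \<open>
  A symmetric walk on the naturals: \<open>e n\<close> is the probability of crossing the edge between \<open>n - 1\<close> and \<open>n\<close>
  in either direction, \<open>d n\<close> that of staying at \<open>n\<close>; the deficit of the row sum is the killing
  probability. Since \<open>e 0 = 0\<close>, truncated subtraction in \<open>n - 1\<close> is harmless throughout.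

  The hypotheses \<open>minor\<close> (total positivity), \<open>growth_mono\<close> and \<open>e_logconcave\<close> (log-concavity of the harmonic
  function) are structural. The parameter \<open>L\<close> is the width of the wall: \<open>free_e\<close> and \<open>free_d\<close> compare the
  walk beyond \<open>L\<close> with the lazy simple walk, with an error that decays like the inverse square of the
  distance to the wall, and \<open>wall\<close> limits how slow the edges inside the wall can be. By \<open>up_ge\<close> the
  conditioned walk moves up with probability at least \<open>\<rho>\<close> at every level.
\<close>

locale killed_walk =
  fixes e d :: "nat \<Rightarrow> real" and \<rho> C\<^sub>0 :: real and L :: nat
  assumes e_0: "e 0 = 0"
    and e_pos: "\<And>n. 0 < e (Suc n)"
    and e_le: "\<And>n. e n \<le> 1 / 4"
    and d_pos: "\<And>n. 0 < d n"
    and minor: "\<And>n. (e (Suc n))\<^sup>2 \<le> d n * d (Suc n)"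
    and row: "\<And>n. e n + d n + e (Suc n) \<le> 1"
    and growth_mono: "\<And>n. (1 - d (Suc n)) * e (Suc n) \<le> (1 - d n) * e (Suc (Suc n))"
    and e_logconcave: "\<And>n. e n * e (Suc (Suc n)) \<le> (e (Suc n))\<^sup>2"
    and \<rho>_pos: "0 < \<rho>"
    and up_ge: "\<And>n. e n + d n \<le> 1 - \<rho>"
    and C\<^sub>0_ge: "1 \<le> C\<^sub>0"
    and wall: "\<And>k. 1 \<le> k \<Longrightarrow> real k \<le> C\<^sub>0 * real (k + L) * (e k)\<^sup>2"
    and L_pos: "1 \<le> L"
    and free_e: "\<And>j. 1 / 4 - 1 / (16 * real (j + 1) * real (j + 2)) \<le> e (L + j)"
    and free_d: "\<And>j. 1 / 2 - 1 / (16 * real (j + 1) * real (j + 2)) \<le> d (L + j)"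
begin

lemma e_nonneg: "0 \<le> e n"
  by (cases n) (auto simp: e_0 less_imp_le[OF e_pos])

definition T :: "(nat \<Rightarrow> real) \<Rightarrow> nat \<Rightarrow> real" where
  "T \<phi> n = e n * \<phi> (n - 1) + d n * \<phi> n + e (Suc n) * \<phi> (Suc n)"

text \<open>
  The harmonic function of the walk, obtained by solving \<open>T h = h\<close> from left to right.
\<close>

fun h :: "nat \<Rightarrow> real" where
  "h 0 = 1"
| "h (Suc n) = ((1 - d n) * h n - e n * h (n - 1)) / e (Suc n)"

declare h.simps(2)[simp del]

lemma h_rec: "e (Suc n) * h (Suc n) = (1 - d n) * h n - e n * h (n - 1)"
  using e_pos[of n] by (simp add: h.simps(2))

lemma T_h: "T h n = h n"
  unfolding T_def h_rec by (simp add: algebra_simps)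

text \<open>
  Killing makes constants superharmonic, so the recurrence for \<open>h\<close> propagates positive increments.
\<close>

lemma h_pos_mono: "0 < h n \<and> h n \<le> h (Suc n)"
proof (induction n)
  case 0
  have "e (Suc 0) * h (Suc 0) = 1 - d 0" by (simp add: h_rec e_0)
  moreover have "e (Suc 0) * 1 \<le> 1 - d 0" using row[of 0] e_0 by simp
  ultimately have "e (Suc 0) * 1 \<le> e (Suc 0) * h (Suc 0)" by linarith
  then show ?case using e_pos[of 0] by simp
next
  case (Suc n)
  have "e (Suc (Suc n)) * (h (Suc (Suc n)) - h (Suc n)) =
      (1 - d (Suc n) - e (Suc (Suc n))) * h (Suc n) - e (Suc n) * h n"
    using h_rec[of "Suc n"] by (simp add: algebra_simps)
  also have "\<dots> \<ge> e (Suc n) * h (Suc n) - e (Suc n) * h n"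
    using row[of "Suc n"] Suc by (intro diff_right_mono mult_right_mono) auto
  also have "e (Suc n) * h (Suc n) - e (Suc n) * h n = e (Suc n) * (h (Suc n) - h n)"
    by (simp add: algebra_simps)
  finally have "e (Suc n) * (h (Suc n) - h n) \<le> e (Suc (Suc n)) * (h (Suc (Suc n)) - h (Suc n))"
    by simp
  moreover have "0 \<le> e (Suc n) * (h (Suc n) - h n)" using Suc e_pos[of n] by simp
  ultimately have "0 \<le> e (Suc (Suc n)) * (h (Suc (Suc n)) - h (Suc n))" by linarith
  then have "0 \<le> h (Suc (Suc n)) - h (Suc n)" using e_pos[of "Suc n"]
    by (simp add: zero_le_mult_iff)
  then show ?case using Suc by linarith
qed

lemma h_pos: "0 < h n" and h_le_Suc: "h n \<le> h (Suc n)"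
  using h_pos_mono by auto

lemma h_nz [simp]: "h n \<noteq> 0"
  using h_pos[of n] by simp

lemma h_mono: "m \<le> n \<Longrightarrow> h m \<le> h n"
  using h_le_Suc by (rule lift_Suc_mono_le)

text \<open>
  Reading the recurrence as one for the ratio \<open>h (n+1) / h n\<close>, the map from one ratio to the next is
  increasing in the ratio and, by \<open>growth_mono\<close> and \<open>e_logconcave\<close>, decreasing in \<open>n\<close>; so the ratios decrease.
\<close>

lemma h_logconcave: "h (Suc (Suc n)) * h n \<le> (h (Suc n))\<^sup>2"
proof (induction n)
  case 0
  have "(1 - d (Suc 0)) * e (Suc 0) \<le> (e (Suc 0) * h (Suc 0)) * e (Suc (Suc 0))"
    using growth_mono[of 0] h_rec[of 0] e_0 by simp
  then have *: "1 - d (Suc 0) \<le> h (Suc 0) * e (Suc (Suc 0))"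
    using e_pos[of 0] by (simp add: mult_ac)
  have "e (Suc (Suc 0)) * h (Suc (Suc 0)) \<le> (1 - d (Suc 0)) * h (Suc 0)"
    using h_rec[of "Suc 0"] e_nonneg[of "Suc 0"] by simp
  also have "\<dots> \<le> (h (Suc 0) * e (Suc (Suc 0))) * h (Suc 0)"
    using * h_pos[of "Suc 0"] by (intro mult_right_mono) auto
  finally have "e (Suc (Suc 0)) * h (Suc (Suc 0)) \<le> e (Suc (Suc 0)) * (h (Suc 0))\<^sup>2"
    by (simp add: power2_eq_square mult_ac)
  then show ?case using e_pos[of "Suc 0"] by simp
next
  case (Suc n)
  define a b c D where "a = h n" and "b = h (Suc n)" and "c = h (Suc (Suc n))"
    and "D = h (Suc (Suc (Suc n)))"
  define \<alpha> \<beta> \<gamma> where "\<alpha> = e (Suc n)" and "\<beta> = e (Suc (Suc n))" and "\<gamma> = e (Suc (Suc (Suc n)))"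
  define p r where "p = 1 - d (Suc n)" and "r = 1 - d (Suc (Suc n))"
  have pos: "0 < a" "0 < b" "0 < c" "0 < \<alpha>" "0 < \<beta>" "0 < \<gamma>"
    by (simp_all add: a_def b_def c_def \<alpha>_def \<beta>_def \<gamma>_def h_pos e_pos)
  have r1: "\<beta> * c = p * b - \<alpha> * a" and r2: "\<gamma> * D = r * c - \<beta> * b"
    using h_rec[of "Suc n"] h_rec[of "Suc (Suc n)"]
    by (simp_all add: a_def b_def c_def D_def \<alpha>_def \<beta>_def \<gamma>_def p_def r_def)
  have g: "r * \<beta> \<le> p * \<gamma>" and l: "\<alpha> * \<gamma> \<le> \<beta>\<^sup>2"
    using growth_mono[of "Suc n"] e_logconcave[of "Suc n"]
    by (simp_all add: \<alpha>_def \<beta>_def \<gamma>_def p_def r_def)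
  have IH: "c * a \<le> b\<^sup>2" using Suc by (simp add: a_def b_def c_def)
  have "\<beta> * \<gamma> * (D * b) = \<beta> * b * (\<gamma> * D)" by (simp add: mult_ac)
  also have "\<dots> = (r * \<beta>) * (b * c) - \<beta>\<^sup>2 * b\<^sup>2" unfolding r2
    by (simp add: algebra_simps power2_eq_square)
  also have "\<dots> \<le> (p * \<gamma>) * (b * c) - \<beta>\<^sup>2 * b\<^sup>2"
    using g pos by (intro diff_right_mono mult_right_mono) auto
  also have "(p * \<gamma>) * (b * c) = \<gamma> * c * (p * b)" by (simp add: mult_ac)
  also have "p * b = \<beta> * c + \<alpha> * a" using r1 by simp
  also have "\<gamma> * c * (\<beta> * c + \<alpha> * a) = \<beta> * \<gamma> * c\<^sup>2 + (\<alpha> * \<gamma>) * (c * a)"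
    by (simp add: algebra_simps power2_eq_square)
  also have "(\<alpha> * \<gamma>) * (c * a) \<le> \<beta>\<^sup>2 * b\<^sup>2"
    using l IH pos by (intro mult_mono) auto
  finally have "\<beta> * \<gamma> * (D * b) \<le> \<beta> * \<gamma> * c\<^sup>2" by linarith
  then show ?case using pos by (simp add: b_def c_def D_def)
qed

definition s :: "nat \<Rightarrow> real" where "s n = h (Suc n) / h n"

lemma s_ge_1: "1 \<le> s n"
  using h_le_Suc[of n] h_pos[of n] by (simp add: s_def)

lemma s_antimono: "m \<le> n \<Longrightarrow> s n \<le> s m"
proof (rule lift_Suc_antimono_le[of s])
  show "s (Suc n) \<le> s n" for n
    using h_logconcave[of n] h_pos[of n] h_pos[of "Suc n"]
    by (simp add: s_def field_simps power2_eq_square)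
qed

lemma h_Suc: "h (Suc n) = s n * h n"
  by (simp add: s_def)

lemma s_rec: "e (Suc (Suc n)) * s (Suc n) = 1 - d (Suc n) - e (Suc n) / s n"
  using h_rec[of "Suc n"] h_pos[of n] h_pos[of "Suc n"]
  by (simp add: s_def field_simps)

lemma up_lower: "\<rho> \<le> e (Suc n) * s n"
proof -
  have "e n * h (n - 1) \<le> e n * h n"
    by (intro mult_left_mono h_mono e_nonneg) auto
  then have "e (Suc n) * h (Suc n) \<ge> (1 - d n - e n) * h n"
    unfolding h_rec by (simp add: algebra_simps)
  moreover have "(1 - d n - e n) * h n \<ge> \<rho> * h n"
    using up_ge[of n] h_pos[of n] by (intro mult_right_mono) auto
  ultimately have "\<rho> * h n \<le> e (Suc n) * h (Suc n)" by linarith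
  then show ?thesis using h_pos[of n] by (simp add: h_Suc)
qed

lemma s_upper: "e (Suc n) * s n \<le> 1"
proof -
  have "e (Suc n) * h (Suc n) \<le> 1 * h n"
    unfolding h_rec using d_pos[of n] e_nonneg[of n] h_pos[of "n - 1"] h_pos[of n]
    by (simp add: algebra_simps add_increasing)
  then show ?thesis using h_pos[of n] by (simp add: h_Suc)
qed

lemma s_sq_bound: "real (Suc n) * (s n)\<^sup>2 \<le> C\<^sub>0 * real (Suc n + L)"
proof -
  have "real (Suc n) * (s n)\<^sup>2 \<le> (C\<^sub>0 * real (Suc n + L) * (e (Suc n))\<^sup>2) * (s n)\<^sup>2"
    using wall[of "Suc n"] by (intro mult_right_mono) auto
  also have "\<dots> = C\<^sub>0 * real (Suc n + L) * (e (Suc n) * s n)\<^sup>2"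
    by (simp add: power_mult_distrib)
  also have "(e (Suc n) * s n)\<^sup>2 \<le> 1"
    using s_upper[of n] e_nonneg[of "Suc n"] s_ge_1[of n] by (intro power_le_one) auto
  then have "C\<^sub>0 * real (Suc n + L) * (e (Suc n) * s n)\<^sup>2 \<le> C\<^sub>0 * real (Suc n + L) * 1"
    using C\<^sub>0_ge by (intro mult_left_mono) auto
  finally show ?thesis by simp
qed

text \<open>
  For the simple walk \<open>t = s - 1\<close> obeys \<open>t' = t / (1 + t)\<close>, whose solutions are below \<open>1 / j\<close>. The bound
  \<open>2 / j\<close> is stable under the perturbation allowed by \<open>free_e\<close> and \<open>free_d\<close>: the step from \<open>2 / j\<close> to
  \<open>2 / (j + 2)\<close> leaves room for an error of order \<open>1 / j^2\<close>.
\<close>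

lemma s_free: "s (L + j) \<le> 1 + 2 / real j" if "1 \<le> j"
  using that
proof (induction j rule: nat_induct_at_least)
  case base
  show ?case
  proof -
    have 1: "e (Suc (Suc L)) \<ge> 1/4 - 1/192" using free_e[of 2] by simp
    have 2: "d (Suc L) \<ge> 1/2 - 1/96" using free_d[of 1] by simp
    have "e (Suc (Suc L)) * s (Suc L) \<le> 1/2 + 1/96"
    proof -
      have "0 \<le> e (Suc L) / s L" using e_nonneg[of "Suc L"] s_ge_1[of L] by simp
      then show ?thesis using s_rec[of L] 2 by linarith
    qed
    moreover have "(1/4 - 1/192) * s (Suc L) \<le> e (Suc (Suc L)) * s (Suc L)"
      using 1 s_ge_1[of "Suc L"] by (intro mult_right_mono) auto
    ultimately show ?thesis by simp
  qed
next
  case (Suc j)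
  define \<xi> where "\<xi> = 1 / (16 * real (j + 2) * real (j + 3))"
  have \<xi>: "0 < \<xi>" "\<xi> \<le> 1 / 8" 
  proof -
    define y where "y = 16 * real (j + 2) * real (j + 3)"
    have "8 \<le> y" by (simp add: y_def algebra_simps add_increasing)
    then show "0 < \<xi>" "\<xi> \<le> 1 / 8" unfolding \<xi>_def y_def[symmetric] by (auto simp: field_simps)
  qed
  have e1: "1/4 - \<xi> \<le> e (Suc (L + j))" using free_e[of "Suc j"] by (simp add: \<xi>_def algebra_simps)
  have d1: "1/2 - \<xi> \<le> d (Suc (L + j))" using free_d[of "Suc j"] by (simp add: \<xi>_def algebra_simps)
  have "1 / (16 * real (j + 3) * real (j + 4)) \<le> \<xi>"
    unfolding \<xi>_def by (intro divide_left_mono mult_mono mult_pos_pos) auto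
  then have e2: "1/4 - \<xi> \<le> e (Suc (Suc (L + j)))" using free_e[of "Suc (Suc j)"]
    by (simp add: algebra_simps)
  define \<sigma> where "\<sigma> = s (L + j)"
  have \<sigma>1: "1 \<le> \<sigma>" by (simp add: \<sigma>_def s_ge_1)
  have \<sigma>2: "\<sigma> \<le> 1 + 2 / real j" using Suc by (simp add: \<sigma>_def)
  have j: "real j > 0" using Suc by simp
  have inv: "1 / \<sigma> \<ge> real j / (real j + 2)" 
    using \<sigma>1 \<sigma>2 j by (simp add: field_simps)
  have inv1: "1 / \<sigma> \<le> 1" using \<sigma>1 by simp
  have "(1/4 - \<xi>) * s (Suc (L + j)) \<le> e (Suc (Suc (L + j))) * s (Suc (L + j))"
    using e2 s_ge_1[of "Suc (L + j)"] by (intro mult_right_mono) auto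
  also have "\<dots> = 1 - d (Suc (L + j)) - e (Suc (L + j)) * (1 / \<sigma>)"
    by (simp add: s_rec \<sigma>_def)
  also have "\<dots> \<le> 1/2 + \<xi> - (1/4 - \<xi>) * (1 / \<sigma>)"
  proof -
    have "(1/4 - \<xi>) * (1 / \<sigma>) \<le> e (Suc (L + j)) * (1 / \<sigma>)"
      using e1 \<sigma>1 by (intro mult_right_mono) auto
    then show ?thesis using d1 by linarith
  qed
  also have "\<dots> \<le> 1/2 + \<xi> - (1/4 - \<xi>) * (real j / (real j + 2))"
    using inv \<xi> by (intro diff_left_mono mult_left_mono) auto
  finally have A: "(1/4 - \<xi>) * s (Suc (L + j)) \<le> 1/2 + \<xi> - (1/4 - \<xi>) * (real j / (real j + 2))" .
  have B: "1/2 + \<xi> - (1/4 - \<xi>) * (real j / (real j + 2)) \<le> (1/4 - \<xi>) * (1 + 2 / real (Suc j))"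
  proof -
    have \<xi>': "\<xi> * (16 * (real j + 2) * (real j + 3)) = 1"
    proof -
      have "16 * (real j + 2) * (real j + 3) \<noteq> 0" using j by simp
      moreover have "\<xi> = 1 / (16 * (real j + 2) * (real j + 3))" by (simp add: \<xi>_def)
      ultimately show ?thesis by simp
    qed
    define x where "x = real j"
    have x: "x > 0" using j by (simp add: x_def)
    have x': "x \<ge> 1" using Suc by (simp add: x_def)
    have c1: "1 + 2 / real (Suc j) + real j / (real j + 2) = 2 + 2 / ((x+1)*(x+2))"
    proof -
      have "x / (x + 2) = 1 - 2 / (x + 2)" using x by (simp add: field_simps)
      moreover have "2 / ((x+1)*(x+2)) = 2 / (x + 1) - 2 / (x + 2)"
        using x by (simp add: diff_frac_eq)
      ultimately show ?thesis by (simp add: x_def add.commute)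
    qed
    have c2: "2 / ((x+1)*(x+2)) \<le> 1/3" 
    proof -
      have "6 \<le> (x+1)*(x+2)" using mult_mono[of 2 "x+1" 3 "x+2"] x' by simp
      then show ?thesis by (simp add: field_simps)
    qed
    have "\<xi> * (3 + 2 / ((x+1)*(x+2))) \<le> \<xi> * 8" using c2 \<xi> by (intro mult_left_mono) auto
    also have "\<xi> * 8 = 1 / (2 * ((x+2)*(x+3)))"
    proof -
      have "\<xi> * 8 * (2 * ((x+2)*(x+3))) = 1" using \<xi>' by (simp add: x_def algebra_simps)
      moreover have "2 * ((x+2)*(x+3)) \<noteq> 0" using x by simp
      ultimately show ?thesis by (simp only: eq_divide_eq if_True if_False simp_thms)
    qed
    also have "\<dots> \<le> 1 / (2 * ((x+1)*(x+2)))" using x by (intro divide_left_mono mult_mono mult_pos_pos) auto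
    also have "\<dots> = (1/4) * (2 / ((x+1)*(x+2)))" using x by (simp add: field_simps)
    finally have c3: "\<xi> * (3 + 2 / ((x+1)*(x+2))) \<le> (1/4) * (2 / ((x+1)*(x+2)))" .
    have "(1/4 - \<xi>) * (1 + 2 / real (Suc j)) + (1/4 - \<xi>) * (real j / (real j + 2)) 
        = (1/4 - \<xi>) * (2 + 2 / ((x+1)*(x+2)))" unfolding c1[symmetric] by (simp add: algebra_simps)
    also have "\<dots> \<ge> 1/2 + \<xi>"
    proof -
      have "1/2 + \<xi> \<le> (1/4 - \<xi>) * (2 + y)" if "\<xi> * (3 + y) \<le> (1/4) * y" for y
        using that by (simp add: algebra_simps)
      then show ?thesis using c3 by blast
    qed
    finally show ?thesis by linarith
  qed
  have "(1/4 - \<xi>) * s (Suc (L + j)) \<le> (1/4 - \<xi>) * (1 + 2 / real (Suc j))" using A B by linarith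
  then show ?case using \<xi> by simp
qed

text \<open>
  Reversible measure of the conditioned walk, its volume function, and the volume in units of the last
  point. Log-concavity of \<open>h\<close> enters the later estimates through monotonicity of \<open>w\<close>.
\<close>

definition \<pi> :: "nat \<Rightarrow> real" where "\<pi> n = (h n)\<^sup>2"
definition V :: "nat \<Rightarrow> real" where "V n = (\<Sum>i\<le>n. \<pi> i)"
definition w :: "nat \<Rightarrow> real" where "w n = V n / \<pi> n"

lemma \<pi>_pos: "0 < \<pi> n" by (simp add: \<pi>_def h_pos)
lemma \<pi>_mono: "m \<le> n \<Longrightarrow> \<pi> m \<le> \<pi> n"
  unfolding \<pi>_def using h_mono[of m n] h_pos[of m] by (intro power_mono) auto
lemma V_0: "V 0 = 1" by (simp add: V_def \<pi>_def)
lemma V_Suc: "V (Suc n) = V n + \<pi> (Suc n)" by (simp add: V_def)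
lemma V_pos: "0 < V n" unfolding V_def using \<pi>_pos by (intro sum_pos) auto
lemma w_pos: "0 < w n" by (simp add: w_def V_pos \<pi>_pos)

lemma w_Suc: "w (Suc n) = 1 + w n / (s n)\<^sup>2"
  using \<pi>_pos[of n] \<pi>_pos[of "Suc n"] s_ge_1[of n]
  by (simp add: w_def V_Suc add_divide_distrib) (simp add: \<pi>_def s_def power_divide)

lemma w_le_Suc: "w n \<le> w (Suc n)"
proof (induction n)
  case 0
  have "0 \<le> w 0 / (s 0)\<^sup>2" using w_pos[of 0] by simp
  then show ?case by (simp add: w_Suc) (simp add: w_def V_0 \<pi>_def)
next
  case (Suc n)
  have "(s (Suc n))\<^sup>2 \<le> (s n)\<^sup>2" using s_antimono[of n "Suc n"] s_ge_1[of "Suc n"]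
    by (intro power_mono) auto
  then have "w n / (s n)\<^sup>2 \<le> w (Suc n) / (s (Suc n))\<^sup>2"
    using Suc w_pos[of n] s_ge_1[of "Suc n"] w_pos[of "Suc n"] by (intro frac_le) auto
  then show ?case by (simp add: w_Suc[of n] w_Suc[of "Suc n"])
qed

lemma w_mono: "m \<le> n \<Longrightarrow> w m \<le> w n"
  using w_le_Suc by (rule lift_Suc_mono_le)

lemma w_le: "w n \<le> real n + 1"
proof -
  have "V n \<le> (\<Sum>i\<le>n. \<pi> n)" unfolding V_def by (intro sum_mono \<pi>_mono) auto
  then have "V n \<le> (real n + 1) * \<pi> n" by (simp add: algebra_simps)
  then show ?thesis using \<pi>_pos[of n] by (simp add: w_def field_simps)
qed

text \<open>
  The measure \<open>\<pi>\<close> is increasing, so its averages over initial segments are increasing too.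
\<close>

lemma V_over_Suc_mono: "V m * (real n + 1) \<le> V n * (real m + 1)" if "m \<le> n"
  using that
proof (induction n rule: dec_induct)
  case base
  show ?case by simp
next
  case (step n)
  have "V n \<le> (real n + 1) * \<pi> (Suc n)" 
  proof -
    have "V n \<le> (\<Sum>i\<le>n. \<pi> (Suc n))" unfolding V_def by (intro sum_mono \<pi>_mono) auto
    then show ?thesis by (simp add: algebra_simps)
  qed
  then have "V n * (real m + 1) \<le> (real n + 1) * \<pi> (Suc n) * (real m + 1)"
    by (intro mult_right_mono) auto
  moreover have "V m * (real n + 1) * (real n + 2) \<le> V n * (real m + 1) * (real n + 2)"
    using step by (intro mult_right_mono) auto
  ultimately have "V m * (real n + 1) * (real n + 2) \<le> (real n + 1) * (V (Suc n) * (real m + 1))"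
    by (simp add: V_Suc algebra_simps)
  then have "(real n + 1) * (V m * (real n + 2)) \<le> (real n + 1) * (V (Suc n) * (real m + 1))"
    by (simp add: mult_ac)
  then have "V m * (real n + 2) \<le> V (Suc n) * (real m + 1)"
    by (rule mult_left_le_imp_le) simp
  then show ?case by (simp add: algebra_simps)
qed

section \<open>Heat kernel: total positivity, flux and return probabilities\<close>

text \<open>
  The ratio \<open>A / B\<close> is increasing, in the cross-multiplied form that tolerates zeros.
\<close>

definition tp2 :: "(nat \<Rightarrow> real) \<Rightarrow> (nat \<Rightarrow> real) \<Rightarrow> bool" where
  "tp2 A B \<longleftrightarrow> (\<forall>i j. i \<le> j \<longrightarrow> A i * B j \<le> A j * B i)"

text \<open>
  All 2x2 minors of a tridiagonal matrix are products of entries, except the principal ones on neighbouring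
  indices, which are nonnegative by \<open>minor\<close>. Expanding by the Cauchy-Binet formula, \<open>T\<close> preserves the
  monotone ratio order.
\<close>

lemma tp2_T:
  assumes "tp2 A B"
  shows "tp2 (T A) (T B)"
  unfolding tp2_def
proof (intro allI impI)
  fix n n' :: nat
  assume "n \<le> n'"
  have W: "0 \<le> A j * B i - A i * B j" if "i \<le> j" for i j
    using assms that by (simp add: tp2_def)
  consider "n' = n" | "n' = Suc n" | "Suc (Suc n) \<le> n'" using \<open>n \<le> n'\<close> by linarith
  then show "T A n * T B n' \<le> T A n' * T B n"
  proof cases
    case 1
    then show ?thesis by simp
  next
    case 2
    define a b c g u where "a = e n" and "b = d n" and "c = e (Suc n)" and "g = d (Suc n)"
      and "u = e (Suc (Suc n))"
    have nn: "0 \<le> a" "0 \<le> b" "0 \<le> c" "0 \<le> g" "0 \<le> u" "0 \<le> b * g - c * c"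
      using e_nonneg d_pos[of n] d_pos[of "Suc n"] minor[of n]
      by (simp_all add: a_def b_def c_def g_def u_def power2_eq_square)
    have "T A (Suc n) * T B n - T A n * T B (Suc n) =
        a * c * (A n * B (n-1) - A (n-1) * B n)
      + a * g * (A (Suc n) * B (n-1) - A (n-1) * B (Suc n))
      + a * u * (A (Suc (Suc n)) * B (n-1) - A (n-1) * B (Suc (Suc n)))
      + (b * g - c * c) * (A (Suc n) * B n - A n * B (Suc n))
      + b * u * (A (Suc (Suc n)) * B n - A n * B (Suc (Suc n)))
      + c * u * (A (Suc (Suc n)) * B (Suc n) - A (Suc n) * B (Suc (Suc n)))"
      unfolding T_def a_def b_def c_def g_def u_def by (simp add: algebra_simps)
    also have "\<dots> \<ge> 0"
      by (intro add_nonneg_nonneg mult_nonneg_nonneg W nn) auto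
    finally show ?thesis using 2 by simp
  next
    case 3
    define a b c where "a = e n" and "b = d n" and "c = e (Suc n)"
    define a' b' c' where "a' = e n'" and "b' = d n'" and "c' = e (Suc n')"
    have nn: "0 \<le> a" "0 \<le> b" "0 \<le> c" "0 \<le> a'" "0 \<le> b'" "0 \<le> c'"
      using e_nonneg d_pos[of n] d_pos[of n']
      by (simp_all add: a_def b_def c_def a'_def b'_def c'_def)
    have "T A n' * T B n - T A n * T B n' =
        a * a' * (A (n'-1) * B (n-1) - A (n-1) * B (n'-1))
      + a * b' * (A n' * B (n-1) - A (n-1) * B n')
      + a * c' * (A (Suc n') * B (n-1) - A (n-1) * B (Suc n'))
      + b * a' * (A (n'-1) * B n - A n * B (n'-1))
      + b * b' * (A n' * B n - A n * B n')
      + b * c' * (A (Suc n') * B n - A n * B (Suc n'))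
      + c * a' * (A (n'-1) * B (Suc n) - A (Suc n) * B (n'-1))
      + c * b' * (A n' * B (Suc n) - A (Suc n) * B n')
      + c * c' * (A (Suc n') * B (Suc n) - A (Suc n) * B (Suc n'))"
      unfolding T_def a_def b_def c_def a'_def b'_def c'_def by (simp add: algebra_simps)
    also have "\<dots> \<ge> 0"
      using 3 by (intro add_nonneg_nonneg mult_nonneg_nonneg W nn) auto
    finally show ?thesis by simp
  qed
qed

text \<open>
  The heat kernel from the origin: \<open>f k n\<close> is the entry \<open>(n, 0)\<close> of \<open>T^k\<close>, \<open>F\<close> the same for the
  conditioned walk relative to its reversible measure, \<open>z\<close> the return probability, \<open>\<kappa>\<close> its relative decay in
  one step.
\<close>

primrec f :: "nat \<Rightarrow> nat \<Rightarrow> real" where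
  "f 0 = (\<lambda>n. if n = 0 then 1 else 0)"
| "f (Suc k) = T (f k)"

definition F :: "nat \<Rightarrow> nat \<Rightarrow> real" where "F k n = f k n / h n"
definition z :: "nat \<Rightarrow> real" where "z k = f k 0"
definition \<kappa> :: "nat \<Rightarrow> real" where "\<kappa> k = 1 - z (Suc k) / z k"

lemma f_nonneg: "0 \<le> f k n"
  by (induction k arbitrary: n)
    (auto simp: T_def intro!: add_nonneg_nonneg mult_nonneg_nonneg e_nonneg less_imp_le[OF d_pos])

lemma F_nonneg: "0 \<le> F k n"
  using f_nonneg[of k n] h_pos[of n] by (simp add: F_def)

lemma F_0: "F k 0 = z k"
  by (simp add: F_def z_def)

lemma f_eq: "f k n = h n * F k n"
  by (simp add: F_def)

lemma F_antimono: "m \<le> n \<Longrightarrow> F k n \<le> F k m"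
proof -
  assume "m \<le> n"
  have "tp2 h (f k)"
  proof (induction k)
    case 0
    then show ?case by (auto simp: tp2_def less_imp_le[OF h_pos])
  next
    case (Suc k)
    have "T h = h" by (rule ext) (rule T_h)
    then show ?case using tp2_T[OF Suc] by simp
  qed
  then have "h m * f k n \<le> h n * f k m" using \<open>m \<le> n\<close> by (simp add: tp2_def)
  then show ?thesis using h_pos[of m] h_pos[of n] by (simp add: F_def field_simps)
qed

lemma F_le_z: "F k n \<le> z k"
  using F_antimono[of 0 n k] by (simp add: F_0)

text \<open>
  The point mass at the origin has the order property in the first step because it vanishes elsewhere.
\<close>

lemma tp2_f: "tp2 (f (Suc k)) (f k)"
proof (induction k)
  case 0
  show ?case unfolding tp2_def
  proof (intro allI impI)
    fix i j :: nat assume "i \<le> j"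
    show "f (Suc 0) i * f 0 j \<le> f (Suc 0) j * f 0 i"
    proof (cases "j = 0")
      case True
      with \<open>i \<le> j\<close> show ?thesis by simp
    next
      case False
      then show ?thesis using f_nonneg[of "Suc 0" j] f_nonneg[of 0 i] 
        by (simp del: f.simps(2))
    qed
  qed
next
  case (Suc k)
  then show ?case using tp2_T[of "f (Suc k)" "f k"] by simp
qed

lemma z_0: "z 0 = 1" by (simp add: z_def)

lemma z_Suc: "z (Suc k) = d 0 * z k + e (Suc 0) * f k (Suc 0)"
  by (simp add: z_def T_def e_0)

lemma z_pos: "0 < z k"
proof (induction k)
  case 0
  show ?case by (simp add: z_0)
next
  case (Suc k)
  then show ?case unfolding z_Suc using d_pos[of 0] e_nonneg f_nonneg
    by (intro add_pos_nonneg mult_pos_pos mult_nonneg_nonneg) auto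
qed

lemma z_Suc_le: "z (Suc k) \<le> z k"
proof -
  have "f k (Suc 0) \<le> h (Suc 0) * z k"
    unfolding f_eq using F_le_z[of k "Suc 0"] h_pos[of "Suc 0"] by (intro mult_left_mono) auto
  then have "e (Suc 0) * f k (Suc 0) \<le> e (Suc 0) * (h (Suc 0) * z k)"
    by (intro mult_left_mono e_nonneg)
  also have "\<dots> = (e (Suc 0) * h (Suc 0)) * z k" by simp
  also have "e (Suc 0) * h (Suc 0) = 1 - d 0" using h_rec[of 0] e_0 by simp
  finally show ?thesis by (simp add: z_Suc algebra_simps)
qed

lemma z_antimono: "j \<le> k \<Longrightarrow> z k \<le> z j"
  using z_Suc_le by (rule lift_Suc_antimono_le)

lemma z_Suc_\<kappa>: "z (Suc k) = z k * (1 - \<kappa> k)"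
  using z_pos[of k] by (simp add: \<kappa>_def)

lemma \<kappa>_nonneg: "0 \<le> \<kappa> k"
  using z_Suc_le[of k] z_pos[of k] by (simp add: \<kappa>_def)

lemma \<kappa>_less_1: "\<kappa> k < 1"
  using z_pos[of k] z_pos[of "Suc k"] by (simp add: \<kappa>_def)

text \<open>
  One step from the origin averages \<open>f k\<close> over the sites 0 and 1, and \<open>f (k+1) / f k\<close> is larger at 1
  than at 0. This gives log-convexity of \<open>z\<close> without any spectral theory.
\<close>

lemma z_logconvex: "(z (Suc k))\<^sup>2 \<le> z (Suc (Suc k)) * z k"
proof -
  have "f (Suc k) 0 * f k (Suc 0) \<le> f (Suc k) (Suc 0) * f k 0"
    using tp2_f[of k] unfolding tp2_def by blast
  then have "e (Suc 0) * (z (Suc k) * f k (Suc 0)) \<le> e (Suc 0) * (f (Suc k) (Suc 0) * z k)"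
    unfolding z_def by (intro mult_left_mono e_nonneg) 
  then have "z (Suc k) * (d 0 * z k + e (Suc 0) * f k (Suc 0)) 
      \<le> (d 0 * z (Suc k) + e (Suc 0) * f (Suc k) (Suc 0)) * z k"
    by (simp only: algebra_simps)
  then show ?thesis unfolding z_Suc[of "Suc k"] z_Suc[of k, symmetric] by (simp add: power2_eq_square)
qed

lemma \<kappa>_antimono: "j \<le> k \<Longrightarrow> \<kappa> k \<le> \<kappa> j"
proof (rule lift_Suc_antimono_le[of \<kappa>])
  show "\<kappa> (Suc n) \<le> \<kappa> n" for n
    using z_logconvex[of n] z_pos[of n] z_pos[of "Suc n"]
    by (simp add: \<kappa>_def field_simps power2_eq_square)
qed

lemma green:
  "(\<Sum>n\<le>M. \<phi> n * T \<psi> n - \<psi> n * T \<phi> n) = e (Suc M) * (\<phi> M * \<psi> (Suc M) - \<psi> M * \<phi> (Suc M))"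
  by (induction M) (simp_all add: T_def e_0 algebra_simps)

lemma flux_F:
  "(\<Sum>i\<le>n. \<pi> i * (F k i - F (Suc k) i)) = \<pi> n * (e (Suc n) * s n) * (F k n - F k (Suc n))"
proof -
  have "(\<Sum>i\<le>n. \<pi> i * (F k i - F (Suc k) i)) = (\<Sum>i\<le>n. h i * (f k i - T (f k) i))"
    by (intro sum.cong) (auto simp: \<pi>_def F_def power2_eq_square algebra_simps)
  also have "\<dots> = (\<Sum>i\<le>n. f k i * T h i - h i * T (f k) i)"
    by (simp add: T_h algebra_simps)
  also have "\<dots> = e (Suc n) * (f k n * h (Suc n) - h n * f k (Suc n))" by (rule green)
  also have "\<dots> = \<pi> n * (e (Suc n) * s n) * (F k n - F k (Suc n))"
    unfolding f_eq by (simp add: \<pi>_def s_def power2_eq_square algebra_simps)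
  finally show ?thesis .
qed

text \<open>
  The relative decay \<open>1 - F (k+1) i / F k i\<close> is largest at the origin, where it equals \<open>\<kappa> k\<close>.
\<close>

lemma F_time_diff: "F k i - F (Suc k) i \<le> \<kappa> k * z k"
proof -
  have "z (Suc k) * f k i \<le> f (Suc k) i * z k"
    using tp2_f[of k] by (simp add: tp2_def z_def)
  then have "z k * (1 - \<kappa> k) * (h i * F k i) \<le> h i * F (Suc k) i * z k"
    unfolding z_Suc_\<kappa> f_eq .
  then have "(z k * h i) * ((1 - \<kappa> k) * F k i) \<le> (z k * h i) * F (Suc k) i"
    by (simp add: mult_ac)
  then have "(1 - \<kappa> k) * F k i \<le> F (Suc k) i"
    using z_pos[of k] h_pos[of i] by simp
  then have "F k i - F (Suc k) i \<le> \<kappa> k * F k i" by (simp add: algebra_simps)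
  also have "\<dots> \<le> \<kappa> k * z k" using F_le_z \<kappa>_nonneg by (intro mult_left_mono) auto
  finally show ?thesis .
qed

text \<open>
  By the divergence theorem the flux of \<open>F k\<close> through an edge is the mass lost to its left in one time
  step, and that loss is at most \<open>\<kappa> k * z k\<close> per unit of volume.
\<close>

lemma F_step: "F k n - F k (Suc n) \<le> \<kappa> k * z k * w n / \<rho>"
proof -
  have "\<rho> * \<pi> n * (F k n - F k (Suc n)) \<le> \<pi> n * (e (Suc n) * s n) * (F k n - F k (Suc n))"
    using up_lower[of n] F_antimono[of n "Suc n" k] \<pi>_pos[of n]
    by (intro mult_right_mono) (auto simp: mult_ac)
  also have "\<dots> = (\<Sum>i\<le>n. \<pi> i * (F k i - F (Suc k) i))" by (rule flux_F[symmetric])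
  also have "\<dots> \<le> (\<Sum>i\<le>n. \<pi> i * (\<kappa> k * z k))"
    by (intro sum_mono mult_left_mono F_time_diff less_imp_le[OF \<pi>_pos])
  also have "\<dots> = \<kappa> k * z k * V n" by (simp add: V_def sum_distrib_left mult_ac)
  also have "\<dots> = \<kappa> k * z k * w n * \<pi> n" using \<pi>_pos[of n] by (simp add: w_def)
  finally have "\<pi> n * (\<rho> * (F k n - F k (Suc n))) \<le> \<pi> n * (\<kappa> k * z k * w n)"
    by (simp add: mult_ac)
  then have "\<rho> * (F k n - F k (Suc n)) \<le> \<kappa> k * z k * w n"
    using \<pi>_pos[of n] by simp
  then show ?thesis using \<rho>_pos by (simp add: field_simps)
qed

lemma F_diff: "F k m - F k n \<le> \<kappa> k * z k / \<rho> * real (n - m) * real n" if "m \<le> n"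
  using that
proof (induction n rule: dec_induct)
  case base
  show ?case by simp
next
  case (step n)
  have K: "0 \<le> \<kappa> k * z k / \<rho>" using \<kappa>_nonneg[of k] z_pos[of k] \<rho>_pos by simp
  have "F k m - F k (Suc n) = (F k m - F k n) + (F k n - F k (Suc n))" by simp
  also have "\<dots> \<le> \<kappa> k * z k / \<rho> * real (n - m) * real n + \<kappa> k * z k * w n / \<rho>"
    using step F_step by (intro add_mono) auto
  also have "\<dots> \<le> \<kappa> k * z k / \<rho> * (real (n - m) * real (Suc n)) + \<kappa> k * z k / \<rho> * real (Suc n)"
  proof (intro add_mono)
    show "\<kappa> k * z k / \<rho> * real (n - m) * real n \<le> \<kappa> k * z k / \<rho> * (real (n - m) * real (Suc n))"
      unfolding mult.assoc using K by (intro mult_left_mono) (auto simp: mult_left_mono)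
    have "\<kappa> k * z k / \<rho> * w n \<le> \<kappa> k * z k / \<rho> * real (Suc n)"
      using K w_le[of n] by (intro mult_left_mono) auto
    then show "\<kappa> k * z k * w n / \<rho> \<le> \<kappa> k * z k / \<rho> * real (Suc n)" by simp
  qed
  also have "\<dots> = \<kappa> k * z k / \<rho> * (real (n - m) + 1) * real (Suc n)"
    by (simp add: ring_distribs add_divide_distrib mult_ac del: of_nat_Suc)
  also have "real (n - m) + 1 = real (Suc n - m)" using step by (simp add: Suc_diff_le)
  finally show ?case .
qed

text \<open>
  The flux through every edge points outwards because \<open>F\<close> is decreasing.
\<close>

lemma mass_le_1: "(\<Sum>i\<le>n. \<pi> i * F k i) \<le> 1"
proof (induction k)
  case 0
  have "(\<Sum>i\<le>n. \<pi> i * F 0 i) = (\<Sum>i\<le>n. if i = 0 then 1 else 0)"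
    by (intro sum.cong) (auto simp: \<pi>_def F_def)
  then show ?case by simp
next
  case (Suc k)
  have "0 \<le> \<pi> n * (e (Suc n) * s n) * (F k n - F k (Suc n))"
    using F_antimono[of n "Suc n" k] \<pi>_pos[of n] up_lower[of n] \<rho>_pos by simp
  then have "(\<Sum>i\<le>n. \<pi> i * F (Suc k) i) \<le> (\<Sum>i\<le>n. \<pi> i * F k i)"
    unfolding flux_F[symmetric] by (simp add: right_diff_distrib sum_subtractf)
  then show ?case using Suc by linarith
qed

lemma F_drop_from_0: "z k - F k (Suc n) \<le> \<kappa> k * z k * (real (Suc n) * w n / \<rho>)"
proof -
  have "z k - F k (Suc n) = (\<Sum>i\<le>n. F k i - F k (Suc i))"
    using F_0[of k] sum_telescope[of "F k" n] by simp
  also have "\<dots> \<le> (\<Sum>i\<le>n. \<kappa> k * z k * w n / \<rho>)"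
  proof (intro sum_mono)
    fix i assume "i \<in> {..n}"
    then have "\<kappa> k * z k * w i / \<rho> \<le> \<kappa> k * z k * w n / \<rho>"
      using \<kappa>_nonneg[of k] z_pos[of k] \<rho>_pos w_mono[of i n]
      by (intro divide_right_mono mult_left_mono) auto
    then show "F k i - F k (Suc i) \<le> \<kappa> k * z k * w n / \<rho>" using F_step[of k i] by linarith
  qed
  also have "\<dots> = \<kappa> k * z k * (real (Suc n) * w n / \<rho>)" by simp
  finally show ?thesis .
qed

text \<open>
  If the decay rate were smaller, \<open>F k\<close> would exceed \<open>z k / 2\<close> on \<open>{0..n+1}\<close>, and its mass there would
  exceed 1.
\<close>

lemma \<kappa>_lower:
  assumes "2 < z k * V (Suc n)"
  shows "\<rho> / (2 * real (Suc n) * w n) \<le> \<kappa> k"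
proof -
  have "F k (Suc n) * V (Suc n) = (\<Sum>i\<le>Suc n. \<pi> i * F k (Suc n))"
    unfolding V_def by (simp only: sum_distrib_left mult_ac)
  also have "\<dots> \<le> (\<Sum>i\<le>Suc n. \<pi> i * F k i)"
    by (intro sum_mono mult_left_mono F_antimono less_imp_le[OF \<pi>_pos]) auto
  also have "\<dots> \<le> 1" by (rule mass_le_1)
  finally have "F k (Suc n) * V (Suc n) \<le> 1" .
  then have "2 * F k (Suc n) * V (Suc n) < z k * V (Suc n)" using assms by linarith
  then have "2 * F k (Suc n) < z k" using V_pos[of "Suc n"] by simp
  then have "z k * 1 \<le> z k * (2 * (\<kappa> k * (real (Suc n) * w n / \<rho>)))"
  proof -
    have "z k * 1 \<le> 2 * (\<kappa> k * z k * (real (Suc n) * w n / \<rho>))"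
      using F_drop_from_0[of k n] \<open>2 * F k (Suc n) < z k\<close> by linarith
    then show ?thesis by (simp only: mult_ac times_divide_eq_right)
  qed
  then have "1 \<le> 2 * (\<kappa> k * (real (Suc n) * w n / \<rho>))" using z_pos[of k] 
    by (metis mult_le_cancel_left_pos)
  moreover define X where "X = real (Suc n) * w n"
  moreover have "0 < X" using w_pos[of n] by (simp add: X_def)
  ultimately have "\<rho> / (2 * X) \<le> \<kappa> k" using \<rho>_pos by (simp add: field_simps)
  then show ?thesis unfolding X_def mult.assoc .
qed

lemma z_decay: "z (j + m) \<le> z j * (1 - \<kappa> (j + m)) ^ m"
proof (induction m)
  case 0
  show ?case by simp
next
  case (Suc m)
  have "z (j + Suc m) = z (j + m) * (1 - \<kappa> (j + m))" by (simp add: z_Suc_\<kappa>)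
  also have "\<dots> \<le> (z j * (1 - \<kappa> (j + m)) ^ m) * (1 - \<kappa> (j + m))"
    using Suc \<kappa>_less_1[of "j+m"] by (intro mult_right_mono) auto
  also have "\<dots> = z j * (1 - \<kappa> (j + m)) ^ Suc m" by simp
  also have "\<dots> \<le> z j * (1 - \<kappa> (j + Suc m)) ^ Suc m"
    using \<kappa>_antimono[of "j + m" "j + Suc m"] \<kappa>_less_1[of "j+m"] z_pos[of j]
    by (intro mult_left_mono power_mono) auto
  finally show ?case .
qed

lemma z_decay_linear: "z (j + m) * (1 + real m * \<kappa> (j + m)) \<le> z j"
proof -
  have "z (j + m) * (1 + real m * \<kappa> (j + m)) \<le> z j * (1 - \<kappa> (j + m)) ^ m * (1 + real m * \<kappa> (j + m))"
    using z_decay[of j m] \<kappa>_nonneg[of "j+m"] by (intro mult_right_mono) auto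
  also have "\<dots> \<le> z j * 1"
    unfolding mult.assoc using z_pos[of j] \<kappa>_nonneg \<kappa>_less_1
    by (intro mult_left_mono power_one_minus_le) auto
  finally show ?thesis by simp
qed

text \<open>
  A Nash-type argument, by induction on the volume. As long as \<open>z\<close> exceeds \<open>2 / V (n+1)\<close> it decays at the
  rate given by \<open>\<kappa>_lower\<close>, so the time needed to pass from \<open>2 / V n\<close> to \<open>2 / V (n+1)\<close> is at most
  \<open>2 (n+1) (s n)^2 / \<rho>\<close>, rounded up. Climbing one level at a time keeps the total time of order \<open>n (n + L)\<close>, even though
  \<open>V\<close> grows exponentially inside the wall.
\<close>

lemma z_upper:
  assumes "real n * (2 * C\<^sub>0 * real (n + L) / \<rho> + 1) \<le> real k"
  shows "z k * V n \<le> 2"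
  using assms
proof (induction n arbitrary: k)
  case 0
  then show ?case using z_antimono[of 0 k] by (simp add: V_0 z_0)
next
  case (Suc n)
  \<comment> \<open>Time spent between the two levels: \<open>m\<close> times the rate \<open>\<rho> / (2 (n+1) w n)\<close> is at least
    \<open>(s n)^2 / w n\<close>, the relative increment of \<open>V\<close>.\<close>
  define m where "m = nat \<lceil>2 * real (Suc n) * (s n)\<^sup>2 / \<rho>\<rceil>"
  have m1: "2 * real (Suc n) * (s n)\<^sup>2 / \<rho> \<le> real m" unfolding m_def by linarith
  have "0 \<le> 2 * real (Suc n) * (s n)\<^sup>2 / \<rho>" using \<rho>_pos by simp
  then have "real m \<le> 2 * real (Suc n) * (s n)\<^sup>2 / \<rho> + 1" unfolding m_def by linarith
  also have "2 * real (Suc n) * (s n)\<^sup>2 / \<rho> \<le> 2 * (C\<^sub>0 * real (Suc n + L)) / \<rho>"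
    unfolding mult.assoc using s_sq_bound[of n] \<rho>_pos
    by (intro divide_right_mono mult_left_mono) auto
  finally have m2: "real m \<le> 2 * C\<^sub>0 * real (Suc n + L) / \<rho> + 1" by simp
  have "real n * (2 * C\<^sub>0 * real (n + L) / \<rho> + 1) + real m
      \<le> real n * (2 * C\<^sub>0 * real (Suc n + L) / \<rho> + 1) + (2 * C\<^sub>0 * real (Suc n + L) / \<rho> + 1)"
    using m2 C\<^sub>0_ge \<rho>_pos by (intro add_mono mult_left_mono divide_right_mono) auto
  also have "\<dots> = real (Suc n) * (2 * C\<^sub>0 * real (Suc n + L) / \<rho> + 1)"
    unfolding of_nat_Suc[of n] by (simp only: distrib_right mult_1)
  also have "\<dots> \<le> real k" by (rule Suc.prems)
  finally have le: "real n * (2 * C\<^sub>0 * real (n + L) / \<rho> + 1) + real m \<le> real k" .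
  moreover have "0 \<le> real n * (2 * C\<^sub>0 * real (n + L) / \<rho> + 1)"
    using C\<^sub>0_ge \<rho>_pos by simp
  ultimately have "real m \<le> real k" by linarith
  then obtain j where k: "k = j + m" using le_Suc_ex[of m k] by (auto simp: add.commute)
  have "z j * V n \<le> 2" using le k by (intro Suc.IH) simp
  show ?case
  proof (rule ccontr)
    assume "\<not> z k * V (Suc n) \<le> 2"
    then have big: "2 < z k * V (Suc n)" by simp
    have "x / y = (c * x / \<rho>) * (\<rho> / (c * y))" if "0 < c" for x y c :: real
      using \<rho>_pos that by simp
    note scale = this
    have "(s n)\<^sup>2 / w n
        = (2 * real (Suc n) * (s n)\<^sup>2 / \<rho>) * (\<rho> / (2 * real (Suc n) * w n))"
      by (rule scale) simp
    also have "\<dots> \<le> real m * \<kappa> k"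
      using m1 \<kappa>_lower[OF big] \<rho>_pos w_pos[of n] by (intro mult_mono) auto
    finally have "1 + (s n)\<^sup>2 / w n \<le> 1 + real m * \<kappa> k" by simp
    moreover have "V (Suc n) = V n * (1 + (s n)\<^sup>2 / w n)"
      using V_pos[of n] \<pi>_pos[of n] h_pos[of n]
      by (simp add: V_Suc w_def \<pi>_def s_def field_simps)
    ultimately have "V (Suc n) \<le> V n * (1 + real m * \<kappa> k)" using V_pos[of n] by simp
    then have "z k * V (Suc n) \<le> z k * (V n * (1 + real m * \<kappa> k))"
      using z_pos[of k] by simp
    also have "\<dots> = (z k * (1 + real m * \<kappa> k)) * V n" by (simp add: mult_ac)
    also have "\<dots> \<le> z j * V n"
      using z_decay_linear[of j m] V_pos[of n] unfolding k by (intro mult_right_mono) auto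
    also have "\<dots> \<le> 2" by fact
    finally show False using big by simp
  qed
qed

end

section \<open>The walk conditioned to survive\<close>

text \<open>
  Transition operators act on functions on the naturals by finite sums, so expectations of the walk are
  written as iterates of such operators, without an underlying probability space.
\<close>

definition poslin :: "((nat \<Rightarrow> real) \<Rightarrow> nat \<Rightarrow> real) \<Rightarrow> bool" where
  "poslin G \<longleftrightarrow> (\<forall>\<phi> \<psi> n. G (\<lambda>y. \<phi> y + \<psi> y) n = G \<phi> n + G \<psi> n)
     \<and> (\<forall>c \<phi> n. G (\<lambda>y. c * \<phi> y) n = c * G \<phi> n)
     \<and> (\<forall>\<phi> n. (\<forall>y. 0 \<le> \<phi> y) \<longrightarrow> 0 \<le> G \<phi> n)"

lemma
  assumes "poslin G"
  shows poslin_add: "G (\<lambda>y. \<phi> y + \<psi> y) n = G \<phi> n + G \<psi> n"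
    and poslin_scale: "G (\<lambda>y. c * \<phi> y) n = c * G \<phi> n"
    and poslin_nonneg: "(\<And>y. 0 \<le> \<phi> y) \<Longrightarrow> 0 \<le> G \<phi> n"
  using assms by (auto simp: poslin_def)

lemma poslin_diff: "poslin G \<Longrightarrow> G (\<lambda>y. \<phi> y - \<psi> y) n = G \<phi> n - G \<psi> n"
  using poslin_add[of G \<phi> "\<lambda>y. (-1) * \<psi> y" n] poslin_scale[of G "-1" \<psi> n] by simp

lemma poslin_mono: "poslin G \<Longrightarrow> (\<And>y. \<phi> y \<le> \<psi> y) \<Longrightarrow> G \<phi> n \<le> G \<psi> n"
  using poslin_nonneg[of G "\<lambda>y. \<psi> y - \<phi> y" n] poslin_diff[of G \<psi> \<phi> n] by simp

lemma poslin_abs: "poslin G \<Longrightarrow> \<bar>G \<phi> n\<bar> \<le> G (\<lambda>y. \<bar>\<phi> y\<bar>) n"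
proof -
  assume G: "poslin G"
  have "G \<phi> n \<le> G (\<lambda>y. \<bar>\<phi> y\<bar>) n" by (rule poslin_mono[OF G]) auto
  moreover have "G (\<lambda>y. (-1) * \<phi> y) n \<le> G (\<lambda>y. \<bar>\<phi> y\<bar>) n" by (rule poslin_mono[OF G]) auto
  ultimately show ?thesis using poslin_scale[OF G, of "-1" \<phi> n] by linarith
qed

lemma poslin_0: "poslin G \<Longrightarrow> G (\<lambda>y. 0) n = 0"
  using poslin_scale[of G 0 "\<lambda>_. 0" n] by simp

lemma poslin_comp: "poslin G \<Longrightarrow> poslin H \<Longrightarrow> poslin (\<lambda>\<phi>. G (H \<phi>))"
proof -
  assume G: "poslin G" and H: "poslin H"
  have "H (\<lambda>y. \<phi> y + \<psi> y) = (\<lambda>y. H \<phi> y + H \<psi> y)" for \<phi> \<psi>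
    by (rule ext) (rule poslin_add[OF H])
  moreover have "H (\<lambda>y. c * \<phi> y) = (\<lambda>y. c * H \<phi> y)" for c \<phi>
    by (rule ext) (rule poslin_scale[OF H])
  ultimately show ?thesis
    unfolding poslin_def[of "\<lambda>\<phi>. G (H \<phi>)"]
    by (simp add: poslin_add[OF G] poslin_scale[OF G] poslin_nonneg[OF G] poslin_nonneg[OF H])
qed

lemma poslin_funpow: "poslin G \<Longrightarrow> poslin (G ^^ k)"
proof (induction k)
  case 0
  show ?case by (simp add: poslin_def)
next
  case (Suc k)
  then show ?case using poslin_comp[of G "G ^^ k"] by (simp add: o_def)
qed

context killed_walk
begin

lemma poslin_T: "poslin T"
  unfolding poslin_def T_def
  by (auto simp: algebra_simps intro!: add_nonneg_nonneg mult_nonneg_nonneg e_nonneg less_imp_le[OF d_pos])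

text \<open>
  The Doob transform of \<open>T\<close>: the walk conditioned never to be killed.
\<close>

definition P :: "(nat \<Rightarrow> real) \<Rightarrow> nat \<Rightarrow> real" where
  "P \<phi> n = T (\<lambda>y. h y * \<phi> y) n / h n"

lemma poslin_P: "poslin P"
proof -
  have [simp]: "T (\<lambda>y. h y * (\<phi> y + \<psi> y)) n = T (\<lambda>y. h y * \<phi> y) n + T (\<lambda>y. h y * \<psi> y) n" for \<phi> \<psi> n
    by (simp add: distrib_left poslin_add[OF poslin_T])
  have [simp]: "T (\<lambda>y. h y * (c * \<phi> y)) n = c * T (\<lambda>y. h y * \<phi> y) n" for c \<phi> n
    using poslin_scale[OF poslin_T, of c "\<lambda>y. h y * \<phi> y" n] by (simp add: mult.left_commute)
  show ?thesis unfolding poslin_def P_def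
    by (auto simp: add_divide_distrib intro!: divide_nonneg_pos poslin_nonneg[OF poslin_T] h_pos
        mult_nonneg_nonneg less_imp_le[OF h_pos])
qed

lemmas poslin_Pk = poslin_funpow[OF poslin_P]
lemmas poslin_Tk = poslin_funpow[OF poslin_T]

lemma Pk_T: "(P ^^ k) \<phi> n = (T ^^ k) (\<lambda>y. h y * \<phi> y) n / h n"
proof (induction k arbitrary: n)
  case 0
  show ?case by simp
next
  case (Suc k)
  have "(\<lambda>y. h y * (P ^^ k) \<phi> y) = (T ^^ k) (\<lambda>y. h y * \<phi> y)"
    using Suc by (intro ext) simp
  then have "P ((P ^^ k) \<phi>) n = T ((T ^^ k) (\<lambda>y. h y * \<phi> y)) n / h n"
    unfolding P_def[of "(P ^^ k) \<phi>"] by simp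
  then show ?case by simp
qed

lemma Tk_h: "(T ^^ k) h n = h n"
proof -
  have "T h = h" by (rule ext) (rule T_h)
  then have "(T ^^ k) h = h" by (induction k) auto
  then show ?thesis by simp
qed

lemma Pk_const: "(P ^^ k) (\<lambda>_. c) n = c"
  using poslin_scale[OF poslin_Tk, of k c h n] by (simp add: Pk_T Tk_h mult.commute)

lemma f_Tk: "f k = (T ^^ k) (f 0)"
  by (induction k) auto

lemma Pk_F: "(P ^^ k) (F j) n = F (k + j) n"
proof -
  have "(\<lambda>y. h y * F j y) = f j" by (rule ext) (simp add: F_def)
  then show ?thesis unfolding Pk_T F_def by (simp add: f_Tk[of j] f_Tk[of "k+j"] funpow_add del: f.simps)
qed

lemma f_support: "k < n \<Longrightarrow> f k n = 0"
  by (induction k arbitrary: n) (auto simp: T_def)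

text \<open>
  Reversibility: the symmetric operator is moved from \<open>\<psi>\<close> to the heat kernel; the boundary term vanishes
  because the walk started at the origin stays below its number of steps.
\<close>

lemma Tk_at_0: "k \<le> M \<Longrightarrow> (T ^^ k) \<psi> 0 = (\<Sum>n\<le>M. f k n * \<psi> n)"
proof (induction k arbitrary: \<psi>)
  case 0
  have "(\<Sum>n\<le>M. f 0 n * \<psi> n) = (\<Sum>n\<le>M. if n = 0 then \<psi> 0 else 0)" by (intro sum.cong) auto
  then show ?case by simp
next
  case (Suc k)
  have "(T ^^ Suc k) \<psi> 0 = (T ^^ k) (T \<psi>) 0" by (simp add: funpow_Suc_right del: funpow.simps)
  also have "\<dots> = (\<Sum>n\<le>M. f k n * T \<psi> n)" using Suc by simp
  also have "\<dots> = (\<Sum>n\<le>M. \<psi> n * T (f k) n)"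
    using green[where \<phi> = "f k" and \<psi> = \<psi> and M = M] f_support[of k M] f_support[of k "Suc M"] Suc.prems
    by (simp add: sum_subtractf)
  finally show ?case by (simp add: mult.commute)
qed

lemma Pk_le_indicator: "(P ^^ k) (\<lambda>y. if y \<le> n then 1 else 0) 0 \<le> z k * V n"
proof -
  define M where "M = max k n"
  have "(P ^^ k) (\<lambda>y. if y \<le> n then 1 else 0) 0 = (\<Sum>i\<le>M. f k i * (h i * (if i \<le> n then 1 else 0)))"
    by (simp add: Pk_T Tk_at_0[of k M] M_def)
  also have "\<dots> = (\<Sum>i\<in>{..M} \<inter> {..n}. f k i * h i)"
    by (subst sum.inter_restrict) (auto intro!: sum.cong)
  also have "{..M} \<inter> {..n} = {..n}" by (auto simp: M_def)
  also have "(\<Sum>i\<le>n. f k i * h i) = (\<Sum>i\<le>n. \<pi> i * F k i)"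
    by (simp add: f_eq \<pi>_def power2_eq_square mult_ac)
  also have "\<dots> \<le> (\<Sum>i\<le>n. \<pi> i * z k)"
    by (intro sum_mono mult_left_mono F_le_z less_imp_le[OF \<pi>_pos])
  also have "\<dots> = z k * V n" by (simp add: V_def sum_distrib_left mult_ac)
  finally show ?thesis .
qed

lemma P_eq: "P \<phi> n = (e n * h (n - 1) / h n) * \<phi> (n - 1) + d n * \<phi> n + (e (Suc n) * s n) * \<phi> (Suc n)"
  by (simp add: P_def T_def s_def field_simps)

text \<open>
  Squared excess over the level \<open>l\<close>. For \<open>l \<ge> 2 L\<close> the drift of the conditioned walk above \<open>l\<close> is at
  most of the order of the inverse distance to \<open>l\<close>, as for a Bessel process, so \<open>\<Phi> l\<close> grows at most
  linearly in time, however strong the drift is inside the wall.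
\<close>

definition \<Phi> :: "nat \<Rightarrow> nat \<Rightarrow> real" where
  "\<Phi> l y = (max 0 (real y - real l))\<^sup>2"

lemma P_\<Phi>: "P (\<Phi> l) y \<le> \<Phi> l y + 4" if l: "2 * L \<le> l"
proof -
  consider "y < l" | "y = l" | "l < y" by linarith
  then show ?thesis
  proof cases
    case 1
    then show ?thesis by (simp add: P_eq \<Phi>_def)
  next
    case 2
    then show ?thesis using s_upper[of l] by (simp add: P_eq \<Phi>_def)
  next
    case 3
    define j where "j = y - l"
    define J where "J = y - L"
    have j: "1 \<le> j" "y = l + j" using 3 by (auto simp: j_def)
    have J: "y = L + J" "j + 1 \<le> J" "1 \<le> J - 1" "y - 1 = L + (J - 1)" using 3 l L_pos by (auto simp: J_def j_def)
    \<comment> \<open>With step probabilities \<open>dn\<close>, \<open>d y\<close>, \<open>up\<close> the increment of \<open>\<Phi>\<close> is \<open>2 j (up - dn) + (up + dn)\<close>.\<close>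
    define dn up where "dn = e y * h (y - 1) / h y" and "up = e (Suc y) * s y"
    define \<xi> where "\<xi> = 1 / (16 * real (J + 1) * real (J + 2))"
    have sum1: "dn + d y + up = 1"
      using P_eq[of "\<lambda>_. 1" y] Pk_const[of 1 1 y] by (simp add: dn_def up_def)
    have e1: "1 / 4 - \<xi> \<le> e y" and d1: "1 / 2 - \<xi> \<le> d y"
      using free_e[of J] free_d[of J] J(1) by (simp_all add: \<xi>_def)
    have sb: "s (y - 1) \<le> 1 + 2 / real j"
    proof -
      have "s (y - 1) \<le> 1 + 2 / real (J - 1)" unfolding J(4) by (rule s_free[OF J(3)])
      also have "2 / real (J - 1) \<le> 2 / real j" using J j by (intro divide_left_mono) auto
      finally show ?thesis by simp
    qed
    have y: "Suc (y - 1) = y" using 3 by simp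
    have "dn = e y * (1 / s (y - 1))" using y by (simp add: dn_def s_def)
    also have "\<dots> \<ge> e y * (1 - 2 / real j)"
    proof (intro mult_left_mono e_nonneg)
      have "2 - s (y - 1) \<le> 1 / s (y - 1)"
      proof -
        have "0 \<le> (s (y - 1) - 1)\<^sup>2" by simp
        then show ?thesis using s_ge_1[of "y-1"] by (simp add: field_simps power2_eq_square)
      qed
      then show "1 - 2 / real j \<le> 1 / s (y - 1)" using sb by linarith
    qed
    finally have "e y - e y * (2 / real j) \<le> dn" by (simp add: algebra_simps)
    moreover have "e y * (2 / real j) \<le> 1 / 4 * (2 / real j)"
      using e_le[of y] by (intro mult_right_mono) auto
    ultimately have dn: "e y - 1 / (2 * real j) \<le> dn" by simp
    have "real j * \<xi> \<le> 1 / 16"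
    proof -
      define a b where "a = real (J + 1)" and "b = real (J + 2)"
      have ab: "0 < a" "0 < b" by (simp_all add: a_def b_def)
      have "real j * 1 \<le> a * b" unfolding a_def b_def using J by (intro mult_mono) auto
      then have "real j * \<xi> \<le> (a * b) * \<xi>" by (intro mult_right_mono) (simp_all add: \<xi>_def)
      also have "\<dots> = 1 / 16" using ab unfolding \<xi>_def a_def[symmetric] b_def[symmetric] by simp
      finally show ?thesis .
    qed
    moreover have "real j * (1 - d y - 2 * dn) \<le> real j * (3 * \<xi> + 1 / real j)"
      using e1 d1 dn by (intro mult_left_mono) (auto simp: field_simps)
    moreover have "real j * (3 * \<xi> + 1 / real j) = 3 * (real j * \<xi>) + 1" using j by (simp add: field_simps)
    ultimately have main: "real j * (1 - d y - 2 * dn) \<le> 3 / 16 + 1" by linarith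
    have \<Phi>s: "\<Phi> l y = (real j)\<^sup>2" "\<Phi> l (y - 1) = (real j - 1)\<^sup>2" "\<Phi> l (Suc y) = (real j + 1)\<^sup>2"
      using j by (auto simp: \<Phi>_def)
    have "P (\<Phi> l) y = dn * (real j - 1)\<^sup>2 + d y * (real j)\<^sup>2 + up * (real j + 1)\<^sup>2"
      by (simp only: P_eq \<Phi>s dn_def up_def)
    also have "up = 1 - d y - dn" using sum1 by simp
    also have "dn * (real j - 1)\<^sup>2 + d y * (real j)\<^sup>2 + (1 - d y - dn) * (real j + 1)\<^sup>2
        = (real j)\<^sup>2 + 2 * (real j * (1 - d y - 2 * dn)) + (1 - d y)"
      by (simp add: algebra_simps power2_eq_square)
    also have "\<dots> \<le> (real j)\<^sup>2 + 4" using main d_pos[of y] by linarith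
    finally show ?thesis by (simp add: \<Phi>s)
  qed
qed

lemma Pk_\<Phi>: "2 * L \<le> l \<Longrightarrow> (P ^^ k) (\<Phi> l) y \<le> \<Phi> l y + 4 * real k"
proof (induction k)
  case 0
  show ?case by simp
next
  case (Suc k)
  have "(P ^^ Suc k) (\<Phi> l) y = (P ^^ k) (P (\<Phi> l)) y" by (simp add: funpow_Suc_right del: funpow.simps)
  also have "\<dots> \<le> (P ^^ k) (\<lambda>y. \<Phi> l y + 4) y"
    by (intro poslin_mono[OF poslin_Pk] P_\<Phi> Suc)
  also have "\<dots> = (P ^^ k) (\<Phi> l) y + 4" by (simp add: poslin_add[OF poslin_Pk] Pk_const)
  finally show ?case using Suc by simp
qed

text \<open>
  With probability at least 1/2 the conditioned walk is in \<open>{0..R}\<close> after \<open>k\<close> steps, and its density there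
  is at most \<open>z k\<close>.
\<close>

lemma z_lower:
  assumes R: "2 * L < R" and k: "8 * real k \<le> (real R - 2 * real L)\<^sup>2"
  shows "1 / 2 \<le> z k * V R"
proof -
  define c where "c = (real R - 2 * real L)\<^sup>2"
  have c: "0 < c" using R by (simp add: c_def)
  have "1 = (P ^^ k) (\<lambda>_. 1) 0" by (simp add: Pk_const)
  also have "\<dots> \<le> (P ^^ k) (\<lambda>y. (if y \<le> R then 1 else 0) + (1 / c) * \<Phi> (2 * L) y) 0"
  proof (rule poslin_mono[OF poslin_Pk])
    fix y
    show "1 \<le> (if y \<le> R then 1 else 0) + (1 / c) * \<Phi> (2 * L) y"
    proof (cases "y \<le> R")
      case True
      then show ?thesis using c by (simp add: \<Phi>_def)
    next
      case False
      then have "c \<le> \<Phi> (2 * L) y" unfolding c_def \<Phi>_def using R by (intro power_mono) auto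
      then show ?thesis using False c by simp
    qed
  qed
  also have "\<dots> = (P ^^ k) (\<lambda>y. if y \<le> R then 1 else 0) 0 + (1 / c) * (P ^^ k) (\<Phi> (2 * L)) 0"
    by (simp only: poslin_add[OF poslin_Pk] poslin_scale[OF poslin_Pk])
  also have "\<dots> \<le> z k * V R + (1 / c) * (4 * real k)"
    using Pk_\<Phi>[of "2 * L" k 0] c
    by (intro add_mono Pk_le_indicator mult_left_mono) (auto simp: \<Phi>_def)
  also have "(1 / c) * (4 * real k) \<le> 1 / 2" using k c unfolding c_def[symmetric] by (simp add: field_simps)
  finally show ?thesis by simp
qed

text \<open>
  Beyond the wall \<open>h\<close> grows at most quadratically, since \<open>1 + 2 / x \<le> ((x + 1) / x)^2\<close>.
\<close>

lemma h_growth: "h n' * (real n - real L)\<^sup>2 \<le> h n * (real n' - real L)\<^sup>2" if "L < n" "n \<le> n'"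
  using that(2)
proof (induction n' rule: dec_induct)
  case base
  show ?case by simp
next
  case (step m)
  define x where "x = real m - real L"
  have x: "1 \<le> x" using step that(1) by (simp add: x_def)
  have "s m \<le> 1 + 2 / x" using s_free[of "m - L"] step that(1) by (simp add: x_def of_nat_diff)
  then have "s m * x\<^sup>2 \<le> (1 + 2 / x) * x\<^sup>2" by (intro mult_right_mono) auto
  also have "\<dots> = x\<^sup>2 + 2 * x" using x by (simp add: field_simps power2_eq_square)
  also have "\<dots> \<le> (x + 1)\<^sup>2" by (simp add: power2_eq_square algebra_simps)
  finally have sx: "s m * x\<^sup>2 \<le> (x + 1)\<^sup>2" .
  have "x\<^sup>2 * (h (Suc m) * (real n - real L)\<^sup>2) = (s m * x\<^sup>2) * (h m * (real n - real L)\<^sup>2)"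
    by (simp add: h_Suc mult_ac)
  also have "\<dots> \<le> (x + 1)\<^sup>2 * (h n * x\<^sup>2)"
    using h_pos[of m] step.IH by (intro mult_mono[OF sx]) (auto simp: x_def)
  finally have "x\<^sup>2 * (h (Suc m) * (real n - real L)\<^sup>2) \<le> x\<^sup>2 * (h n * (x + 1)\<^sup>2)" by (simp add: mult_ac)
  then have "h (Suc m) * (real n - real L)\<^sup>2 \<le> h n * (x + 1)\<^sup>2" using x by simp
  then show ?case by (simp add: x_def algebra_simps)
qed

lemma V_doubling:
  assumes p: "2 * L \<le> p" and R: "p \<le> R" "real R \<le> K * real p"
  shows "V R \<le> 32 * K ^ 5 * V (2 * p)"
proof -
  have p0: "0 < p" using p L_pos by simp
  have "1 * real p \<le> K * real p" using R by simp
  then have K: "1 \<le> K" using p0 by (metis mult_le_cancel_right_pos of_nat_0_less_iff)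
  have "h R * (real p / 2)\<^sup>2 \<le> h R * (real p - real L)\<^sup>2"
    using p h_pos[of R] by (intro mult_left_mono power_mono) auto
  also have "\<dots> \<le> h p * (real R - real L)\<^sup>2" using p L_pos R by (intro h_growth) auto
  also have "\<dots> \<le> h p * (K * real p)\<^sup>2"
    using R p h_pos[of p] by (intro mult_left_mono power_mono) auto
  finally have "(real p)\<^sup>2 * h R \<le> (real p)\<^sup>2 * (4 * K\<^sup>2 * h p)"
    by (simp add: power_mult_distrib power_divide field_simps)
  then have hR: "h R \<le> 4 * K\<^sup>2 * h p" using p0 by simp
  have "\<pi> R \<le> (4 * K\<^sup>2 * h p)\<^sup>2" unfolding \<pi>_def using hR h_pos[of R] by (intro power_mono) auto
  also have "\<dots> = 16 * K ^ 4 * \<pi> p" by (simp add: power_mult_distrib \<pi>_def)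
  finally have \<pi>R: "\<pi> R \<le> 16 * K ^ 4 * \<pi> p" .
  have "V R = w R * \<pi> R" using \<pi>_pos[of R] by (simp add: w_def)
  also have "\<dots> \<le> (2 * K * real p) * (16 * K ^ 4 * \<pi> p)"
  proof (intro mult_mono)
    have "real R \<ge> 1" using R p0 by simp
    then show "w R \<le> 2 * K * real p" using w_le[of R] R by linarith
  qed (use K \<pi>R \<pi>_pos[of R] in auto)
  also have "\<dots> = 32 * K ^ 5 * (real p * \<pi> p)" by (simp add: eval_nat_numeral)
  also have "real p * \<pi> p = (\<Sum>i\<in>{p<..2*p}. \<pi> p)" by simp
  also have "\<dots> \<le> (\<Sum>i\<in>{p<..2*p}. \<pi> i)" by (intro sum_mono \<pi>_mono) auto
  also have "\<dots> \<le> V (2 * p)" unfolding V_def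
    by (intro sum_mono2) (auto simp: less_imp_le[OF \<pi>_pos])
  finally show ?thesis using K by simp
qed

text \<open>
  The constants depend only on \<open>\<rho>\<close> and \<open>C\<^sub>0\<close>; being explicit, they are uniform over all walks with the
  same \<open>\<rho>\<close> and \<open>C\<^sub>0\<close>, in particular in \<open>L\<close>.
\<close>

definition C\<^sub>1 :: real where "C\<^sub>1 = 4 * C\<^sub>0 / \<rho> + 1"
definition K\<^sub>1 :: real where "K\<^sub>1 = 128 * (42 * C\<^sub>1) ^ 5"

lemma C\<^sub>1_ge: "1 \<le> C\<^sub>1" using C\<^sub>0_ge \<rho>_pos by (simp add: C\<^sub>1_def)

lemma K\<^sub>1_ge: "1 \<le> K\<^sub>1"
proof -
  have "1 \<le> (42 * C\<^sub>1) ^ 5" using C\<^sub>1_ge by (intro one_le_power) simp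
  then show ?thesis by (simp add: K\<^sub>1_def)
qed

lemma z_upper_free:
  assumes "L \<le> n" "C\<^sub>1 * (real n)\<^sup>2 \<le> real k"
  shows "z k * V n \<le> 2"
proof (rule z_upper)
  have n: "1 \<le> real n" using assms(1) L_pos by simp
  have "2 * C\<^sub>0 * real (n + L) / \<rho> \<le> 2 * C\<^sub>0 * (2 * real n) / \<rho>"
    using assms(1) C\<^sub>0_ge \<rho>_pos by (intro divide_right_mono mult_left_mono) auto
  then have "2 * C\<^sub>0 * real (n + L) / \<rho> + 1 \<le> C\<^sub>1 * real n"
    using n by (simp add: C\<^sub>1_def algebra_simps)
  then have "real n * (2 * C\<^sub>0 * real (n + L) / \<rho> + 1) \<le> real n * (C\<^sub>1 * real n)"
    by (intro mult_left_mono) auto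
  also have "\<dots> \<le> real k" using assms(2) by (simp add: power2_eq_square mult_ac)
  finally show "real n * (2 * C\<^sub>0 * real (n + L) / \<rho> + 1) \<le> real k" .
qed

text \<open>
  The upper bound at time \<open>r / 2\<close> and the lower bound at time \<open>N \<le> 3 r\<close> involve volumes of balls with
  comparable radii \<open>2 p\<close> and \<open>R\<close>, both of order \<open>sqrt r\<close>. Log-convexity turns the resulting bound on
  \<open>z (r / 2) / z r\<close> into one on the decay rate at time \<open>r\<close>.
\<close>

lemma z_comparable:
  assumes r: "64 * C\<^sub>1 * (real L)\<^sup>2 \<le> real r" and N: "N \<le> 3 * r" "r \<le> N"
  shows "z r \<le> K\<^sub>1 * z N" and "real r * \<kappa> r \<le> 2 * K\<^sub>1"
proof -
  have L1: "1 \<le> (real L)\<^sup>2" using L_pos by simp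
  have "64 * 1 * 1 \<le> 64 * C\<^sub>1 * (real L)\<^sup>2" using C\<^sub>1_ge L1 by (intro mult_mono) auto
  then have r64: "64 \<le> real r" using r by linarith
  \<comment> \<open>Chosen such that \<open>C\<^sub>1 * (2 y)^2 = r / 4\<close>, as required by the upper bound at time \<open>r / 2\<close>.\<close>
  define y where "y = sqrt (real r / (16 * C\<^sub>1))"
  have y2: "y\<^sup>2 = real r / (16 * C\<^sub>1)" using C\<^sub>1_ge by (simp add: y_def)
  have y0: "0 \<le> y" using C\<^sub>1_ge by (simp add: y_def)
  have yL: "2 * real L \<le> y"
  proof (rule power2_le_imp_le[OF _ y0])
    show "(2 * real L)\<^sup>2 \<le> y\<^sup>2" using r C\<^sub>1_ge by (simp add: y2 field_simps power_mult_distrib)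
  qed
  define p where "p = nat \<lfloor>y\<rfloor>"
  have p1: "real p \<le> y" "y < real p + 1" using y0 by (simp_all add: p_def)
  have p2: "2 * L \<le> p"
  proof -
    have "int (2 * L) \<le> \<lfloor>y\<rfloor>" using yL by (simp add: le_floor_iff)
    then show ?thesis by (simp add: p_def)
  qed
  have p0: "1 \<le> real p" using p2 L_pos by simp
  define k where "k = r div 2"
  have k: "real r / 4 \<le> real k" "real r / 2 \<le> real (r - k)" "k \<le> r" using r64 by (auto simp: k_def)
  have zk: "z k * V (2 * p) \<le> 2"
  proof (rule z_upper_free)
    show "L \<le> 2 * p" using p2 by simp
    have "C\<^sub>1 * (real (2 * p))\<^sup>2 = 4 * C\<^sub>1 * (real p)\<^sup>2" by (simp add: power_mult_distrib)
    also have "\<dots> \<le> 4 * C\<^sub>1 * y\<^sup>2" using p1 C\<^sub>1_ge by (intro mult_left_mono power_mono) auto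
    also have "\<dots> = real r / 4" using C\<^sub>1_ge by (simp add: y2)
    finally show "C\<^sub>1 * (real (2 * p))\<^sup>2 \<le> real k" using k by linarith
  qed
  define R where "R = 2 * L + nat \<lceil>sqrt (8 * real N)\<rceil>"
  have "0 < N" using N r64 by auto
  then have sq0: "0 < sqrt (8 * real N)" by simp
  then have Rlow: "2 * L < R" by (simp add: R_def)
  have "sqrt (8 * real N) \<le> real (nat \<lceil>sqrt (8 * real N)\<rceil>)" by linarith
  then have "(sqrt (8 * real N))\<^sup>2 \<le> (real R - 2 * real L)\<^sup>2"
    using sq0 by (intro power_mono) (auto simp: R_def)
  then have zN: "1 / 2 \<le> z N * V R" using Rlow by (intro z_lower) auto
  have "real (nat \<lceil>sqrt (8 * real N)\<rceil>) \<le> sqrt (8 * real N) + 1" using sq0 by linarith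
  also have "sqrt (8 * real N) \<le> 40 * C\<^sub>1 * real p"
  proof (rule real_le_lsqrt)
    have "8 * real N \<le> 24 * real r" using N by simp
    also have "\<dots> = 24 * 16 * C\<^sub>1 * y\<^sup>2" using C\<^sub>1_ge by (simp add: y2)
    also have "\<dots> \<le> 24 * 16 * C\<^sub>1 * (2 * real p)\<^sup>2"
      using p1 p0 y0 C\<^sub>1_ge by (intro mult_left_mono power_mono) auto
    also have "\<dots> = 1536 * (C\<^sub>1 * 1) * (real p)\<^sup>2" by (simp add: power_mult_distrib)
    also have "\<dots> \<le> 1600 * (C\<^sub>1 * C\<^sub>1) * (real p)\<^sup>2"
      using C\<^sub>1_ge by (intro mult_right_mono mult_mono) auto
    finally show "8 * real N \<le> (40 * C\<^sub>1 * real p)\<^sup>2"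
      by (simp add: power_mult_distrib power2_eq_square mult_ac)
  qed (use C\<^sub>1_ge in auto)
  finally have "real R \<le> 2 * real L + 40 * C\<^sub>1 * real p + 1" by (simp add: R_def)
  also have "\<dots> \<le> real p + 40 * C\<^sub>1 * real p + real p" using p0 p2 by linarith
  also have "\<dots> = (40 * C\<^sub>1 + 2 * 1) * real p" by (simp add: algebra_simps)
  also have "\<dots> \<le> (42 * C\<^sub>1) * real p" using C\<^sub>1_ge by (intro mult_right_mono) auto
  finally have Rup: "real R \<le> 42 * C\<^sub>1 * real p" .
  have pR: "p \<le> R"
  proof -
    have "(real p)\<^sup>2 \<le> y\<^sup>2" using p1 by (intro power_mono) auto
    also have "\<dots> \<le> real r" unfolding y2 using C\<^sub>1_ge by (simp add: divide_le_eq mult_le_cancel_left1)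
    also have "\<dots> \<le> 8 * real N" using N by simp
    finally have "real p \<le> sqrt (8 * real N)" by (rule real_le_rsqrt)
    then have "real p \<le> real R" unfolding R_def by linarith
    then show ?thesis by simp
  qed
  have VR: "V R \<le> 32 * (42 * C\<^sub>1) ^ 5 * V (2 * p)" by (rule V_doubling[OF p2 pR Rup])
  have "z k * V (2 * p) \<le> 4 * (z N * V R)" using zk zN by linarith
  also have "\<dots> \<le> 4 * (z N * (32 * (42 * C\<^sub>1) ^ 5 * V (2 * p)))"
    using VR z_pos[of N] by (intro mult_left_mono) auto
  also have "\<dots> = (K\<^sub>1 * z N) * V (2 * p)" by (simp add: K\<^sub>1_def)
  finally have zkN: "z k \<le> K\<^sub>1 * z N" using V_pos[of "2 * p"] by simp
  then show "z r \<le> K\<^sub>1 * z N" using z_antimono[OF k(3)] by linarith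
  have "z (k + (r - k)) * (1 + real (r - k) * \<kappa> (k + (r - k))) \<le> z k" by (rule z_decay_linear)
  then have "z r * (1 + real (r - k) * \<kappa> r) \<le> z k" using k by simp
  also have "\<dots> \<le> K\<^sub>1 * z N" by fact
  also have "\<dots> \<le> K\<^sub>1 * z r" using z_antimono[OF N(2)] K\<^sub>1_ge by (intro mult_left_mono) auto
  finally have "z r * (1 + real (r - k) * \<kappa> r) \<le> z r * K\<^sub>1" by (simp add: mult.commute)
  then have "1 + real (r - k) * \<kappa> r \<le> K\<^sub>1" using z_pos[of r] by simp
  moreover have "real r / 2 * \<kappa> r \<le> real (r - k) * \<kappa> r" using k \<kappa>_nonneg by (intro mult_right_mono) auto
  ultimately show "real r * \<kappa> r \<le> 2 * K\<^sub>1" by linarith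
qed

end

section \<open>Splitting each step into two letters\<close>

lemma poslin_sum: "poslin G \<Longrightarrow> G (\<lambda>y. \<Sum>i\<in>I. \<phi> i y) n = (\<Sum>i\<in>I. G (\<phi> i) n)"
  by (induction I rule: infinite_finite_induct) (simp_all add: poslin_0[of G] poslin_add[of G])

definition words :: "nat \<Rightarrow> bool list set" where "words m = {xs. length xs = m}"

lemma finite_words [simp]: "finite (words m)"
  using finite_lists_length_eq[of "UNIV :: bool set" m] by (simp add: words_def)

lemma words_0: "words 0 = {[]}" by (auto simp: words_def)

lemma words_Suc: "words (Suc m) = (#) True ` words m \<union> (#) False ` words m"
  by (auto simp: words_def length_Suc_conv)

lemma sum_words_Suc:
  "(\<Sum>xs\<in>words (Suc m). g xs) = (\<Sum>xs\<in>words m. g (True # xs)) + (\<Sum>xs\<in>words m. g (False # xs) :: real)"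
  unfolding words_Suc by (subst sum.union_disjoint) (auto simp: sum.reindex)

lemma card_words: "card (words m) = 2 ^ m"
  using card_lists_length_eq[of "UNIV :: bool set" m] by (simp add: words_def)

text \<open>
  The average of the two letters is one step of the walk, and their row sums differ from 1 by at most a
  multiple of the killing probability: the letters are indistinguishable in mass except where the walk
  risks being killed.
\<close>

locale word_walk = killed_walk +
  fixes A :: "bool \<Rightarrow> (nat \<Rightarrow> real) \<Rightarrow> nat \<Rightarrow> real" and B :: real
  assumes poslin_A: "\<And>b. poslin (A b)"
    and A_sum: "\<And>\<phi> n. A True \<phi> n + A False \<phi> n = 2 * T \<phi> n"
    and A_one: "\<And>b n. \<bar>A b (\<lambda>_. 1) n - 1\<bar> \<le> B * (1 - T (\<lambda>_. 1) n)"
    and B_nonneg: "0 \<le> B"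
begin

primrec W :: "bool list \<Rightarrow> (nat \<Rightarrow> real) \<Rightarrow> nat \<Rightarrow> real" where
  "W [] \<phi> = \<phi>"
| "W (b # xs) \<phi> = A b (W xs \<phi>)"

lemma W_append: "W (xs @ ys) \<phi> = W xs (W ys \<phi>)"
  by (induction xs) auto

lemma poslin_W: "poslin (W xs)"
proof (induction xs)
  case Nil
  show ?case by (simp add: poslin_def)
next
  case (Cons b xs)
  then show ?case using poslin_comp[OF poslin_A[of b], of "W xs"] by simp
qed

lemma sum_W: "(\<Sum>xs\<in>words m. W xs \<phi> n) = 2 ^ m * (T ^^ m) \<phi> n"
proof (induction m arbitrary: n)
  case 0
  show ?case by (simp add: words_0)
next
  case (Suc m)
  have "(\<Sum>xs\<in>words (Suc m). W xs \<phi> n)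
      = A True (\<lambda>y. \<Sum>xs\<in>words m. W xs \<phi> y) n + A False (\<lambda>y. \<Sum>xs\<in>words m. W xs \<phi> y) n"
    by (simp add: sum_words_Suc poslin_sum[OF poslin_A])
  also have "\<dots> = 2 * T (\<lambda>y. 2 ^ m * (T ^^ m) \<phi> y) n" by (simp add: A_sum Suc)
  also have "\<dots> = 2 ^ Suc m * (T ^^ Suc m) \<phi> n" by (simp add: poslin_scale[OF poslin_T])
  finally show ?case .
qed

lemma T_one_le: "T (\<lambda>_. 1) n \<le> 1"
  using row[of n] by (simp add: T_def)

lemma Tk_one_le: "(T ^^ k) (\<lambda>_. 1) n \<le> 1"
proof (induction k arbitrary: n)
  case 0
  show ?case by simp
next
  case (Suc k)
  have "(T ^^ Suc k) (\<lambda>_. 1) n \<le> T (\<lambda>_. 1) n"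
    using poslin_mono[OF poslin_T, of "(T ^^ k) (\<lambda>_. 1)" "\<lambda>_. 1" n] Suc by simp
  then show ?case using T_one_le[of n] by linarith
qed

text \<open>
  Errors in the row sums are created only where killing happens, so the total error telescopes to the
  probability of having been killed within \<open>m\<close> steps.
\<close>

lemma W_one: "(\<Sum>xs\<in>words m. \<bar>W xs (\<lambda>_. 1) n - 1\<bar>) \<le> 2 ^ m * (B * (1 - (T ^^ m) (\<lambda>_. 1) n))"
proof (induction m arbitrary: n)
  case 0
  show ?case by (simp add: words_0)
next
  case (Suc m)
  define D where "D xs y = \<bar>W xs (\<lambda>_. 1) y - 1\<bar>" for xs y
  define K where "K = B * (1 - T (\<lambda>_. 1) n)"
  have 1: "D (b # xs) n \<le> A b (D xs) n + K" for b xs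
  proof -
    have "W (b # xs) (\<lambda>_. 1) n - 1 = A b (\<lambda>y. W xs (\<lambda>_. 1) y - 1) n + (A b (\<lambda>_. 1) n - 1)"
      by (simp add: poslin_diff[OF poslin_A])
    moreover have "\<bar>A b (\<lambda>y. W xs (\<lambda>_. 1) y - 1) n\<bar> \<le> A b (D xs) n"
      unfolding D_def by (rule poslin_abs[OF poslin_A])
    ultimately show ?thesis using A_one[of b n] unfolding D_def K_def by linarith
  qed
  have "(\<Sum>xs\<in>words (Suc m). D xs n) \<le>
      (\<Sum>xs\<in>words m. A True (D xs) n + K) + (\<Sum>xs\<in>words m. A False (D xs) n + K)"
    unfolding sum_words_Suc by (intro add_mono sum_mono 1)
  also have "\<dots> = A True (\<lambda>y. \<Sum>xs\<in>words m. D xs y) n + A False (\<lambda>y. \<Sum>xs\<in>words m. D xs y) n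
      + 2 * 2 ^ m * K"
    by (simp add: sum.distrib poslin_sum[OF poslin_A] card_words)
  also have "\<dots> = 2 * T (\<lambda>y. \<Sum>xs\<in>words m. D xs y) n + 2 * 2 ^ m * K" by (simp add: A_sum)
  also have "T (\<lambda>y. \<Sum>xs\<in>words m. D xs y) n \<le> T (\<lambda>y. 2 ^ m * (B * (1 - (T ^^ m) (\<lambda>_. 1) y))) n"
    using Suc by (intro poslin_mono[OF poslin_T]) (simp add: D_def)
  also have "\<dots> = 2 ^ m * (B * (T (\<lambda>_. 1) n - (T ^^ Suc m) (\<lambda>_. 1) n))"
    by (simp add: poslin_scale[OF poslin_T] poslin_diff[OF poslin_T])
  finally show ?case by (simp add: D_def K_def algebra_simps)
qed

lemma W_deviation:
  assumes g: "0 \<le> g n"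
  shows "(\<Sum>xs\<in>words m. \<bar>W xs g n - g n\<bar>)
    \<le> 2 ^ m * ((T ^^ m) (\<lambda>y. \<bar>g y - g n\<bar>) n + B * (g n * (1 - (T ^^ m) (\<lambda>_. 1) n)))"
proof -
  have 1: "\<bar>W xs g n - g n\<bar> \<le> W xs (\<lambda>y. \<bar>g y - g n\<bar>) n + g n * \<bar>W xs (\<lambda>_. 1) n - 1\<bar>" for xs
  proof -
    have "W xs (\<lambda>y. g y - g n * 1) n = W xs g n - g n * W xs (\<lambda>_. 1) n"
      unfolding poslin_diff[OF poslin_W] poslin_scale[OF poslin_W] ..
    then have "W xs g n - g n = W xs (\<lambda>y. g y - g n) n + g n * (W xs (\<lambda>_. 1) n - 1)"
      by (simp add: algebra_simps)
    moreover have "\<bar>W xs (\<lambda>y. g y - g n) n\<bar> \<le> W xs (\<lambda>y. \<bar>g y - g n\<bar>) n"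
      by (rule poslin_abs[OF poslin_W])
    moreover have "\<bar>g n * (W xs (\<lambda>_. 1) n - 1)\<bar> = g n * \<bar>W xs (\<lambda>_. 1) n - 1\<bar>"
      using g by (simp add: abs_mult)
    ultimately show ?thesis by linarith
  qed
  have "(\<Sum>xs\<in>words m. \<bar>W xs g n - g n\<bar>)
      \<le> (\<Sum>xs\<in>words m. W xs (\<lambda>y. \<bar>g y - g n\<bar>) n + g n * \<bar>W xs (\<lambda>_. 1) n - 1\<bar>)"
    by (intro sum_mono 1)
  also have "\<dots> = 2 ^ m * (T ^^ m) (\<lambda>y. \<bar>g y - g n\<bar>) n + g n * (\<Sum>xs\<in>words m. \<bar>W xs (\<lambda>_. 1) n - 1\<bar>)"
    by (simp add: sum.distrib sum_W sum_distrib_left)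
  also have "\<dots> \<le> 2 ^ m * (T ^^ m) (\<lambda>y. \<bar>g y - g n\<bar>) n + g n * (2 ^ m * (B * (1 - (T ^^ m) (\<lambda>_. 1) n)))"
    using g by (intro add_left_mono mult_left_mono W_one)
  finally show ?thesis by (simp add: algebra_simps)
qed

text \<open>
  Expected decrease of \<open>F r\<close>, and expected relative increase of \<open>h\<close>, over \<open>m\<close> steps of the
  conditioned walk from \<open>n\<close>. Only upward moves contribute.
\<close>

definition loss_F :: "nat \<Rightarrow> nat \<Rightarrow> nat \<Rightarrow> real" where
  "loss_F m r n = (P ^^ m) (\<lambda>y. max 0 (F r n - F r y)) n"
definition loss_h :: "nat \<Rightarrow> nat \<Rightarrow> real" where
  "loss_h m n = (P ^^ m) (\<lambda>y. max 0 (1 - h n / h y)) n"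

text \<open>
  Changing a word moves the walk only within its \<open>m\<close> steps, so by the triangle inequality the sum
  is bounded by the variation of \<open>f r = h * F r\<close> along \<open>m\<close> steps of \<open>T\<close> plus the killing probability.
  In terms of the conditioned walk these are the absolute variations of \<open>F r\<close> and of \<open>1 / h\<close>. In the mean,
  \<open>F r\<close> decreases by monotonicity of \<open>z\<close> and \<open>1 / h\<close> decreases because constants are superharmonic;
  therefore positive and negative parts compensate and the one-sided losses suffice.
\<close>

lemma word_sum_le_loss:
  "(\<Sum>xs\<in>words m. \<bar>(T ^^ i) (W xs (f r)) 0 - z (i + r)\<bar>)
    \<le> 2 ^ m * (2 * (P ^^ i) (loss_F m r) 0 + 2 * (1 + B) * z r * (P ^^ i) (loss_h m) 0)"
proof -
  define g where "g = f r"
  define E1 where "E1 n = (P ^^ m) (\<lambda>y. \<bar>F r y - F r n\<bar>) n" for n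
  define E2 where "E2 n = (P ^^ m) (\<lambda>y. \<bar>1 - h n / h y\<bar>) n" for n
  define D where "D n = (T ^^ m) (\<lambda>y. \<bar>g y - g n\<bar>) n + B * (g n * (1 - (T ^^ m) (\<lambda>_. 1) n))" for n
  have zir: "z (i + r) = (T ^^ i) g 0"
    by (simp add: z_def g_def f_Tk[of r] f_Tk[of "i + r"] funpow_add del: f.simps)
  \<comment> \<open>The killing probability is the mean relative increase of \<open>h\<close> along the conditioned walk.\<close>
  have E2': "1 - (T ^^ m) (\<lambda>_. 1) n = (P ^^ m) (\<lambda>y. 1 - h n / h y) n" for n
  proof -
    have "(\<lambda>y. h y * (h n / h y)) = (\<lambda>y. h n * 1)" by (auto simp: fun_eq_iff)
    then have "(P ^^ m) (\<lambda>y. h n / h y) n = (T ^^ m) (\<lambda>_. 1) n"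
      by (simp only: Pk_T poslin_scale[OF poslin_Tk]) simp
    then show ?thesis by (simp add: poslin_diff[OF poslin_Pk] Pk_const)
  qed
  have D: "D n / h n \<le> E1 n + (1 + B) * z r * E2 n" for n
  proof -
    have "(T ^^ m) (\<lambda>y. \<bar>g y - g n\<bar>) n / h n = (P ^^ m) (\<lambda>y. \<bar>F r y - F r n * (h n / h y)\<bar>) n"
    proof -
      have "h y * \<bar>F r y - F r n * (h n / h y)\<bar> = \<bar>g y - g n\<bar>" for y
      proof -
        have "h y * \<bar>F r y - F r n * (h n / h y)\<bar> = \<bar>h y * (F r y - F r n * (h n / h y))\<bar>"
          using h_pos[of y] by (simp add: abs_mult)
        also have "h y * (F r y - F r n * (h n / h y)) = g y - g n"
          by (simp add: g_def f_eq right_diff_distrib)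
        finally show ?thesis .
      qed
      then show ?thesis by (simp add: Pk_T)
    qed
    also have "\<dots> \<le> (P ^^ m) (\<lambda>y. \<bar>F r y - F r n\<bar> + F r n * \<bar>1 - h n / h y\<bar>) n"
    proof (rule poslin_mono[OF poslin_Pk])
      fix y
      have "F r y - F r n * (h n / h y) = (F r y - F r n) + F r n * (1 - h n / h y)"
        by (simp add: algebra_simps)
      then show "\<bar>F r y - F r n * (h n / h y)\<bar> \<le> \<bar>F r y - F r n\<bar> + F r n * \<bar>1 - h n / h y\<bar>"
        using abs_triangle_ineq[of "F r y - F r n" "F r n * (1 - h n / h y)"] F_nonneg[of r n]
        by (simp add: abs_mult)
    qed
    also have "\<dots> = E1 n + F r n * E2 n"
      by (simp add: E1_def E2_def poslin_add[OF poslin_Pk] poslin_scale[OF poslin_Pk])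
    finally have 1: "(T ^^ m) (\<lambda>y. \<bar>g y - g n\<bar>) n / h n \<le> E1 n + F r n * E2 n" .
    have "1 - (T ^^ m) (\<lambda>_. 1) n \<le> E2 n"
      unfolding E2' E2_def by (rule poslin_mono[OF poslin_Pk]) auto
    then have 2: "B * (F r n * (1 - (T ^^ m) (\<lambda>_. 1) n)) \<le> B * (F r n * E2 n)"
      by (intro mult_left_mono B_nonneg F_nonneg)
    have "D n / h n = (T ^^ m) (\<lambda>y. \<bar>g y - g n\<bar>) n / h n + B * (F r n * (1 - (T ^^ m) (\<lambda>_. 1) n))"
      by (simp add: D_def g_def f_eq add_divide_distrib)
    also have "\<dots> \<le> E1 n + (1 + B) * (F r n * E2 n)" using 1 2 by (simp add: algebra_simps)
    also have "\<dots> \<le> E1 n + (1 + B) * (z r * E2 n)"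
    proof -
      have "0 \<le> E2 n" unfolding E2_def by (rule poslin_nonneg[OF poslin_Pk]) simp
      then show ?thesis using B_nonneg F_le_z[of r n]
        by (intro add_left_mono mult_left_mono mult_right_mono) auto
    qed
    finally show ?thesis by (simp add: mult.assoc)
  qed
  have "(\<Sum>xs\<in>words m. \<bar>(T ^^ i) (W xs g) 0 - z (i + r)\<bar>)
      \<le> (\<Sum>xs\<in>words m. (T ^^ i) (\<lambda>n. \<bar>W xs g n - g n\<bar>) 0)"
    unfolding zir poslin_diff[OF poslin_Tk, symmetric] by (intro sum_mono poslin_abs[OF poslin_Tk])
  also have "\<dots> = (T ^^ i) (\<lambda>n. \<Sum>xs\<in>words m. \<bar>W xs g n - g n\<bar>) 0"
    by (rule poslin_sum[OF poslin_Tk, symmetric])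
  also have "\<dots> \<le> (T ^^ i) (\<lambda>n. 2 ^ m * D n) 0"
    unfolding D_def by (intro poslin_mono[OF poslin_Tk] W_deviation) (simp add: g_def f_nonneg)
  also have "\<dots> = 2 ^ m * (P ^^ i) (\<lambda>n. D n / h n) 0"
    by (simp add: Pk_T poslin_scale[OF poslin_Tk])
  also have "(P ^^ i) (\<lambda>n. D n / h n) 0 \<le> (P ^^ i) (\<lambda>n. E1 n + (1 + B) * z r * E2 n) 0"
    by (intro poslin_mono[OF poslin_Pk] D)
  also have "\<dots> = (P ^^ i) E1 0 + (1 + B) * z r * (P ^^ i) E2 0"
    by (simp add: poslin_add[OF poslin_Pk] poslin_scale[OF poslin_Pk])
  also have "(P ^^ i) E1 0 \<le> 2 * (P ^^ i) (loss_F m r) 0"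
  proof -
    have "E1 n = 2 * loss_F m r n + (F (m + r) n - F r n)" for n
    proof -
      have "\<bar>x\<bar> = 2 * max 0 (- x) + x" for x :: real by auto
      then have "(\<lambda>y. \<bar>F r y - F r n\<bar>) = (\<lambda>y. 2 * max 0 (F r n - F r y) + (F r y - F r n))"
        by (intro ext) (metis minus_diff_eq)
      then show ?thesis
        by (simp add: E1_def loss_F_def poslin_add[OF poslin_Pk] poslin_diff[OF poslin_Pk]
            poslin_scale[OF poslin_Pk] Pk_const Pk_F)
    qed
    then have "E1 = (\<lambda>n. 2 * loss_F m r n + (F (m + r) n - F r n))" by (rule ext)
    then have "(P ^^ i) E1 0 = 2 * (P ^^ i) (loss_F m r) 0 + (z (i + (m + r)) - z (i + r))"
      by (simp add: poslin_add[OF poslin_Pk] poslin_diff[OF poslin_Pk]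
          poslin_scale[OF poslin_Pk] Pk_F F_0)
    then show ?thesis using z_antimono[of "i + r" "i + (m + r)"] by simp
  qed
  also have "(P ^^ i) E2 0 \<le> 2 * (P ^^ i) (loss_h m) 0"
  proof -
    have "E2 n \<le> 2 * loss_h m n" for n
    proof -
      have "\<bar>x\<bar> = 2 * max 0 x - x" for x :: real by auto
      then have "(\<lambda>y. \<bar>1 - h n / h y\<bar>) = (\<lambda>y. 2 * max 0 (1 - h n / h y) - (1 - h n / h y))"
        by (intro ext) blast
      then have "E2 n = 2 * loss_h m n - (1 - (T ^^ m) (\<lambda>_. 1) n)"
        unfolding E2_def E2' loss_h_def
        by (simp only: poslin_diff[OF poslin_Pk] poslin_scale[OF poslin_Pk])
      then show ?thesis using Tk_one_le[of m n] by linarith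
    qed
    then have "(P ^^ i) E2 0 \<le> (P ^^ i) (\<lambda>n. 2 * loss_h m n) 0" by (rule poslin_mono[OF poslin_Pk])
    then show ?thesis by (simp add: poslin_scale[OF poslin_Pk])
  qed
  finally have "(\<Sum>xs\<in>words m. \<bar>(T ^^ i) (W xs g) 0 - z (i + r)\<bar>)
     \<le> 2 ^ m * (2 * (P ^^ i) (loss_F m r) 0 + (1 + B) * z r * (2 * (P ^^ i) (loss_h m) 0))"
    using B_nonneg z_pos[of r] by (simp add: mult_left_mono add_mono)
  then show ?thesis by (simp only: g_def mult_ac)
qed

text \<open>
  The second moment bound combined with \<open>x \<le> (x^2 / t + t) / 2\<close> for \<open>t = sqrt k\<close>.
\<close>

lemma first_moment: "(P ^^ k) (\<lambda>y. max 0 (real y - real l)) y \<le> (\<Phi> l y / sqrt (real k) + 5 * sqrt (real k)) / 2"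
  if "2 * L \<le> l" "1 \<le> k"
proof -
  define c where "c = sqrt (real k)"
  have c: "0 < c" "c * c = real k" using that by (simp_all add: c_def)
  have "(P ^^ k) (\<lambda>y. max 0 (real y - real l)) y \<le> (P ^^ k) (\<lambda>y. c / 2 + (1 / (2 * c)) * \<Phi> l y) y"
  proof (rule poslin_mono[OF poslin_Pk])
    fix y
    define x where "x = max 0 (real y - real l)"
    have "0 \<le> (x - c)\<^sup>2" by simp
    then have "x \<le> c / 2 + (1 / (2 * c)) * x\<^sup>2" using c by (simp add: field_simps power2_eq_square)
    then show "max 0 (real y - real l) \<le> c / 2 + (1 / (2 * c)) * \<Phi> l y" by (simp add: x_def \<Phi>_def)
  qed
  also have "\<dots> = c / 2 + (1 / (2 * c)) * (P ^^ k) (\<Phi> l) y"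
    by (simp only: poslin_add[OF poslin_Pk] poslin_scale[OF poslin_Pk] Pk_const)
  also have "\<dots> \<le> c / 2 + (1 / (2 * c)) * (\<Phi> l y + 4 * (c * c))"
    using c Pk_\<Phi>[OF that(1), of k y] by (intro add_left_mono mult_left_mono) auto
  also have "\<dots> = (\<Phi> l y / c + 5 * c) / 2" using c by (simp add: field_simps)
  finally show ?thesis by (simp add: c_def)
qed

lemma loss_F_le_z: "loss_F m r n \<le> z r"
proof -
  have "loss_F m r n \<le> (P ^^ m) (\<lambda>y. z r) n"
    unfolding loss_F_def using F_le_z[of r n] F_nonneg[of r] z_pos[of r]
    by (intro poslin_mono[OF poslin_Pk]) (smt (verit))
  then show ?thesis by (simp add: Pk_const)
qed

lemma loss_h_le_1: "loss_h m n \<le> 1"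
proof -
  have "loss_h m n \<le> (P ^^ m) (\<lambda>y. 1) n"
    unfolding loss_h_def using h_pos
    by (intro poslin_mono[OF poslin_Pk]) (simp add: less_imp_le)
  then show ?thesis by (simp add: Pk_const)
qed

lemma loss_F_le:
  assumes "2 * L \<le> n" "1 \<le> m"
  shows "loss_F m r n \<le> \<kappa> r * z r / \<rho> * (4 * real m + 3 * sqrt (real m) * real n)"
proof -
  define c where "c = \<kappa> r * z r / \<rho>"
  have c: "0 \<le> c" using \<kappa>_nonneg[of r] z_pos[of r] \<rho>_pos by (simp add: c_def)
  have "loss_F m r n \<le> (P ^^ m) (\<lambda>y. c * (\<Phi> n y + real n * max 0 (real y - real n))) n"
    unfolding loss_F_def
  proof (rule poslin_mono[OF poslin_Pk])
    fix y
    show "max 0 (F r n - F r y) \<le> c * (\<Phi> n y + real n * max 0 (real y - real n))"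
    proof (cases "n \<le> y")
      case True
      have "F r n - F r y \<le> c * real (y - n) * real y" using F_diff[OF True, of r] by (simp add: c_def)
      also have "\<dots> = c * (\<Phi> n y + real n * max 0 (real y - real n))"
        using True by (simp add: \<Phi>_def of_nat_diff power2_eq_square algebra_simps)
      finally show ?thesis using c by (simp add: \<Phi>_def)
    next
      case False
      then have "F r n \<le> F r y" by (intro F_antimono) auto
      then show ?thesis using c by (simp add: \<Phi>_def)
    qed
  qed
  also have "\<dots> = c * ((P ^^ m) (\<Phi> n) n + real n * (P ^^ m) (\<lambda>y. max 0 (real y - real n)) n)"
    by (simp only: poslin_add[OF poslin_Pk] poslin_scale[OF poslin_Pk])
  also have "\<dots> \<le> c * (4 * real m + real n * (3 * sqrt (real m)))"
  proof (intro mult_left_mono add_mono c)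
    show "(P ^^ m) (\<Phi> n) n \<le> 4 * real m" using Pk_\<Phi>[OF assms(1), of m n] by (simp add: \<Phi>_def)
    have "(P ^^ m) (\<lambda>y. max 0 (real y - real n)) n \<le> 5 * sqrt (real m) / 2"
      using first_moment[OF assms, of n] by (simp add: \<Phi>_def)
    also have "\<dots> \<le> 3 * sqrt (real m)" by simp
    finally show "(P ^^ m) (\<lambda>y. max 0 (real y - real n)) n \<le> 3 * sqrt (real m)" .
  qed simp
  finally show ?thesis by (simp add: c_def mult_ac)
qed

lemma h_power: "n \<le> y \<Longrightarrow> h y \<le> s n ^ (y - n) * h n"
proof (induction y rule: dec_induct)
  case base
  show ?case by simp
next
  case (step y)
  have "h (Suc y) = s y * h y" by (rule h_Suc)
  also have "\<dots> \<le> s n * (s n ^ (y - n) * h n)"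
    using step s_antimono[of n y] s_ge_1[of n] h_pos[of y] by (intro mult_mono) auto
  finally show ?case using step by (simp add: Suc_diff_le mult_ac)
qed

text \<open>
  By log-concavity \<open>h\<close> increases from \<open>n\<close> to \<open>y\<close> by at most the factor \<open>(s n)^(y-n)\<close>, and
  \<open>s n - 1\<close> is of order \<open>1 / n\<close> beyond the wall.
\<close>

lemma loss_h_le:
  assumes "2 * L \<le> n" "1 \<le> m"
  shows "loss_h m n \<le> 12 * sqrt (real m) / real n"
proof -
  have n: "L < n" "0 < real n" using assms(1) L_pos by auto
  have "s n - 1 \<le> 2 / real (n - L)" using s_free[of "n - L"] n by (simp add: Suc_le_eq)
  also have "\<dots> \<le> 2 / (real n / 2)"
    using n assms(1) by (intro divide_left_mono) (auto simp: of_nat_diff)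
  finally have t: "s n - 1 \<le> 4 / real n" by simp
  have "loss_h m n \<le> (P ^^ m) (\<lambda>y. 4 / real n * max 0 (real y - real n)) n"
    unfolding loss_h_def
  proof (rule poslin_mono[OF poslin_Pk])
    fix y
    show "max 0 (1 - h n / h y) \<le> 4 / real n * max 0 (real y - real n)"
    proof (cases "n \<le> y")
      case True
      define x where "x = 1 / s n"
      have x: "0 < x" "x \<le> 1" using s_ge_1[of n] by (simp_all add: x_def)
      have "1 + real (y - n) * (x - 1) \<le> (1 + (x - 1)) ^ (y - n)"
        using x by (intro Bernoulli_inequality) auto
      also have "\<dots> = x ^ (y - n)" by simp
      also have "x ^ (y - n) \<le> h n / h y"
        using h_power[OF True] h_pos[of y] h_pos[of n] s_ge_1[of n]
        by (simp add: x_def power_divide field_simps)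
      finally have "1 - h n / h y \<le> real (y - n) * (1 - x)" by (simp add: algebra_simps)
      also have "1 - x \<le> s n - 1"
      proof -
        have "0 \<le> (s n - 1)\<^sup>2" by simp
        then show ?thesis using s_ge_1[of n] by (simp add: x_def field_simps power2_eq_square)
      qed
      then have "real (y - n) * (1 - x) \<le> real (y - n) * (4 / real n)"
        using t by (intro mult_left_mono) auto
      finally show ?thesis using True n by (simp add: of_nat_diff mult.commute)
    next
      case False
      then have "h y \<le> h n" by (intro h_mono) auto
      then show ?thesis using h_pos[of y] by simp
    qed
  qed
  also have "\<dots> = 4 / real n * (P ^^ m) (\<lambda>y. max 0 (real y - real n)) n"
    by (simp only: poslin_scale[OF poslin_Pk])
  also have "\<dots> \<le> 4 / real n * (3 * sqrt (real m))"
  proof (rule mult_left_mono)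
    have "(P ^^ m) (\<lambda>y. max 0 (real y - real n)) n \<le> 5 * sqrt (real m) / 2"
      using first_moment[OF assms, of n] by (simp add: \<Phi>_def)
    also have "\<dots> \<le> 3 * sqrt (real m)" by simp
    finally show "(P ^^ m) (\<lambda>y. max 0 (real y - real n)) n \<le> 3 * sqrt (real m)" .
  qed simp
  finally show ?thesis by simp
qed

definition K\<^sub>2 :: real where
  "K\<^sub>2 = K\<^sub>1 * (4 * (2 + B) * 2 * C\<^sub>1 + 4 * K\<^sub>1 / \<rho> * 16 + 24 * (1 + B)) * 4"

text \<open>
  The density of the conditioned walk at time \<open>i\<close> is at most \<open>z i\<close>, that is, at most twice the inverse
  volume of a ball of radius \<open>n'\<close> of order \<open>sqrt i\<close>; as the averages of \<open>\<pi>\<close> increase, a ball of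
  radius \<open>n\<^sub>0\<close> has at most the proportion \<open>n\<^sub>0 / n'\<close> of that volume.
\<close>

lemma Pk_below:
  assumes "C\<^sub>1 * (real L)\<^sup>2 \<le> real i" "1 \<le> n\<^sub>0" "1 \<le> i"
  shows "(P ^^ i) (\<lambda>y. if y < n\<^sub>0 then 1 else 0) 0 \<le> 2 * C\<^sub>1 * (real n\<^sub>0 / sqrt (real i))"
proof -
  define y where "y = sqrt (real i / C\<^sub>1)"
  define n' where "n' = nat \<lfloor>y\<rfloor>"
  have y: "0 < y" "y\<^sup>2 = real i / C\<^sub>1" using assms C\<^sub>1_ge by (simp_all add: y_def)
  have n': "real n' \<le> y" "y < real n' + 1" using y by (simp_all add: n'_def)
  have key: "real n\<^sub>0 / y \<le> C\<^sub>1 * (real n\<^sub>0 / sqrt (real i))"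
  proof -
    have "real n\<^sub>0 / y = sqrt C\<^sub>1 * (real n\<^sub>0 / sqrt (real i))"
      using C\<^sub>1_ge assms by (simp add: y_def real_sqrt_divide field_simps)
    also have "sqrt C\<^sub>1 \<le> C\<^sub>1" using C\<^sub>1_ge by (intro real_le_lsqrt) (auto simp: power2_eq_square)
    then have "sqrt C\<^sub>1 * (real n\<^sub>0 / sqrt (real i)) \<le> C\<^sub>1 * (real n\<^sub>0 / sqrt (real i))"
      by (intro mult_right_mono) auto
    finally show ?thesis .
  qed
  have ind: "(\<lambda>y. if y < n\<^sub>0 then 1 else 0 :: real) = (\<lambda>y. if y \<le> n\<^sub>0 - 1 then 1 else 0)"
    using assms by (auto simp: fun_eq_iff)
  have "(P ^^ i) (\<lambda>y. if y < n\<^sub>0 then 1 else 0) 0 \<le> 2 * (real n\<^sub>0 / y)"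
  proof (cases "n\<^sub>0 - 1 \<le> n'")
    case True
    have "real L \<le> y"
    proof (rule power2_le_imp_le)
      show "(real L)\<^sup>2 \<le> y\<^sup>2" using assms C\<^sub>1_ge by (simp add: y field_simps)
    qed (use y in auto)
    then have "L \<le> n'" unfolding n'_def by (simp add: le_nat_floor)
    moreover have "C\<^sub>1 * (real n')\<^sup>2 \<le> C\<^sub>1 * y\<^sup>2"
      using n' C\<^sub>1_ge by (intro mult_left_mono power_mono) auto
    then have "C\<^sub>1 * (real n')\<^sup>2 \<le> real i" using C\<^sub>1_ge by (simp add: y)
    ultimately have z2: "z i * V n' \<le> 2" by (rule z_upper_free)
    have "z i * (V (n\<^sub>0 - 1) * (real n' + 1)) \<le> z i * (V n' * (real (n\<^sub>0 - 1) + 1))"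
      using V_over_Suc_mono[OF True] z_pos[of i] by (intro mult_left_mono) auto
    also have "\<dots> = (z i * V n') * real n\<^sub>0" using assms by (simp add: of_nat_diff)
    also have "\<dots> \<le> 2 * real n\<^sub>0" using z2 by (intro mult_right_mono) auto
    finally have "z i * V (n\<^sub>0 - 1) * (real n' + 1) \<le> 2 * real n\<^sub>0" by (simp add: mult.assoc)
    moreover have "z i * V (n\<^sub>0 - 1) * y \<le> z i * V (n\<^sub>0 - 1) * (real n' + 1)"
      using n' z_pos[of i] V_pos[of "n\<^sub>0 - 1"] by (intro mult_left_mono) auto
    ultimately have "z i * V (n\<^sub>0 - 1) \<le> 2 * (real n\<^sub>0 / y)"
      using y by (simp add: field_simps)
    then show ?thesis unfolding ind using Pk_le_indicator[of i "n\<^sub>0 - 1"] by linarith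
  next
    case False
    then have "y \<le> real n\<^sub>0" using n' by linarith
    then have "1 \<le> real n\<^sub>0 / y" using y by simp
    moreover have "(P ^^ i) (\<lambda>y. if y < n\<^sub>0 then 1 else 0) 0 \<le> (P ^^ i) (\<lambda>y. 1) 0"
      by (intro poslin_mono[OF poslin_Pk]) auto
    ultimately show ?thesis unfolding Pk_const by linarith
  qed
  then show ?thesis using key by linarith
qed

text \<open>
  At time \<open>i\<close> the conditioned walk is at height of order \<open>sqrt i\<close>. It is below \<open>n\<^sub>0\<close> with probability
  of order \<open>n\<^sub>0 / sqrt i\<close>. From a height \<open>n \<ge> n\<^sub>0\<close> it moves by \<open>sqrt m\<close>, at the cost
  \<open>sqrt m / n\<^sub>0\<close> in \<open>h\<close> and, as \<open>\<kappa> r\<close> is of order \<open>1 / r\<close>, at the cost \<open>sqrt m * n / r\<close> in \<open>F r\<close>,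
  relative to \<open>z r\<close>.
\<close>

lemma word_sum_bound:
  assumes i: "64 * C\<^sub>1 * (real L)\<^sup>2 \<le> real i" and m: "1 \<le> m" "m \<le> i" and r: "i \<le> r"
  shows "(\<Sum>xs\<in>words m. \<bar>(T ^^ i) (W xs (f r)) 0 - z (i + r)\<bar>)
    \<le> 2 ^ m * (K\<^sub>2 * z (i + m + r) * (root 4 (real m / real i) + real L / sqrt (real i)))"
proof -
  have i1: "1 \<le> real i" "0 < real i" using m by auto
  have r1: "0 < real r" "real i \<le> real r" using i1 r by auto
  define \<delta> where "\<delta> = root 4 (real m / real i)"
  define \<Lambda> where "\<Lambda> = real L / sqrt (real i)"
  have \<delta>: "0 < \<delta>" "\<delta> \<le> 1" using m i1 by (auto simp: \<delta>_def)
  have \<delta>4: "\<delta> ^ 4 = real m / real i" unfolding \<delta>_def using i1 by (intro real_root_pow_pos2) auto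
  have \<delta>2: "sqrt (real m) = \<delta>\<^sup>2 * sqrt (real i)"
  proof (rule real_sqrt_unique)
    show "(\<delta>\<^sup>2 * sqrt (real i))\<^sup>2 = real m"
      using i1 \<delta>4 by (simp add: power_mult_distrib power_mult[symmetric])
  qed (use \<delta> in auto)
  have \<Lambda>: "0 \<le> \<Lambda>" by (simp add: \<Lambda>_def)
  have iL: "64 * (real L)\<^sup>2 \<le> real i"
  proof -
    have "64 * 1 * (real L)\<^sup>2 \<le> 64 * C\<^sub>1 * (real L)\<^sup>2" using C\<^sub>1_ge by (intro mult_right_mono) auto
    then show ?thesis using i by simp
  qed
  have L8: "8 * real L \<le> sqrt (real i)" using iL by (intro real_le_rsqrt) (simp add: power_mult_distrib)
  \<comment> \<open>The cut-off balances \<open>n\<^sub>0 / sqrt i\<close> against \<open>sqrt m / n\<^sub>0\<close>; both become \<open>\<delta>\<close>, up to the wall.\<close>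
  define n\<^sub>0 where "n\<^sub>0 = 2 * L + nat \<lceil>\<delta> * sqrt (real i)\<rceil>"
  have \<delta>i: "0 < \<delta> * sqrt (real i)" using \<delta> i1 by simp
  have n0a: "\<delta> * sqrt (real i) \<le> real n\<^sub>0" unfolding n\<^sub>0_def by linarith
  have "real n\<^sub>0 \<le> 2 * real L + \<delta> * sqrt (real i) + 1" unfolding n\<^sub>0_def using \<delta>i by linarith
  then have n0b: "real n\<^sub>0 \<le> \<delta> * sqrt (real i) + 3 * real L" using L_pos by linarith
  have n0c: "2 * L \<le> n\<^sub>0" "1 \<le> n\<^sub>0" using L_pos by (auto simp: n\<^sub>0_def)
  define q where "q = (P ^^ i) (\<lambda>y. if y < n\<^sub>0 then 1 else 0) 0"
  have "C\<^sub>1 * (real L)\<^sup>2 \<le> 64 * C\<^sub>1 * (real L)\<^sup>2" using C\<^sub>1_ge by simp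
  then have "q \<le> 2 * C\<^sub>1 * (real n\<^sub>0 / sqrt (real i))"
    unfolding q_def using i m n0c by (intro Pk_below) auto
  also have "real n\<^sub>0 / sqrt (real i) \<le> (\<delta> * sqrt (real i) + 3 * real L) / sqrt (real i)"
    using n0b by (intro divide_right_mono) auto
  also have "\<dots> = \<delta> + 3 * \<Lambda>" using i1 by (simp add: \<Lambda>_def add_divide_distrib)
  finally have q: "q \<le> 2 * C\<^sub>1 * (\<delta> + 3 * \<Lambda>)" using C\<^sub>1_ge by simp
  have lossF: "(P ^^ i) (loss_F m r) 0 \<le> z r * q + z r * (4 * K\<^sub>1 / \<rho> * 8) * \<delta>"
  proof -
    define c where "c = \<kappa> r * z r / \<rho>"
    have c: "0 \<le> c" using \<kappa>_nonneg[of r] z_pos[of r] \<rho>_pos by (simp add: c_def)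
    have "(P ^^ i) (loss_F m r) 0 \<le>
        (P ^^ i) (\<lambda>n. z r * (if n < n\<^sub>0 then 1 else 0)
          + c * (4 * real m + 3 * sqrt (real m) * (2 * real L + max 0 (real n - real (2 * L))))) 0"
    proof (rule poslin_mono[OF poslin_Pk])
      fix n
      have nn: "0 \<le> c * (4 * real m + 3 * sqrt (real m) * (2 * real L + max 0 (real n - real (2 * L))))"
        using c by simp
      show "loss_F m r n \<le> z r * (if n < n\<^sub>0 then 1 else 0)
          + c * (4 * real m + 3 * sqrt (real m) * (2 * real L + max 0 (real n - real (2 * L))))"
      proof (cases "n < n\<^sub>0")
        case True
        then show ?thesis using loss_F_le_z[of m r n] nn by simp
      next
        case False
        then have "loss_F m r n \<le> c * (4 * real m + 3 * sqrt (real m) * real n)"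
          unfolding c_def using n0c m by (intro loss_F_le) auto
        also have "real n = 2 * real L + max 0 (real n - real (2 * L))" using False n0c by simp
        finally show ?thesis using False by simp
      qed
    qed
    also have "\<dots> = z r * q + c * (4 * real m + 3 * sqrt (real m) *
        (2 * real L + (P ^^ i) (\<lambda>n. max 0 (real n - real (2 * L))) 0))"
      unfolding q_def by (simp only: poslin_add[OF poslin_Pk] poslin_scale[OF poslin_Pk] Pk_const)
    also have "\<dots> \<le> z r * q + c * (4 * (\<delta> * real i) + 3 * (\<delta> * sqrt (real i)) * (4 * sqrt (real i)))"
    proof (intro add_left_mono mult_left_mono[OF _ c] add_mono mult_mono)
      have "real m = \<delta> ^ 4 * real i" using \<delta>4 i1 by simp
      also have "\<delta> ^ 4 \<le> \<delta> ^ 1" using \<delta> by (intro power_decreasing) auto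
      finally show "real m \<le> \<delta> * real i" using i1 by simp
      have "\<delta>\<^sup>2 \<le> \<delta> ^ 1" using \<delta> by (intro power_decreasing) auto
      then show "sqrt (real m) \<le> \<delta> * sqrt (real i)" unfolding \<delta>2 using i1 by (intro mult_right_mono) auto
      have "(P ^^ i) (\<lambda>n. max 0 (real n - real (2 * L))) 0 \<le> 5 * sqrt (real i) / 2"
        using first_moment[of "2 * L" i 0] m by (simp add: \<Phi>_def)
      then show "2 * real L + (P ^^ i) (\<lambda>n. max 0 (real n - real (2 * L))) 0 \<le> 4 * sqrt (real i)"
        using L8 by linarith
      show "0 \<le> 2 * real L + (P ^^ i) (\<lambda>n. max 0 (real n - real (2 * L))) 0"
        by (intro add_nonneg_nonneg poslin_nonneg[OF poslin_Pk]) auto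
    qed (use \<delta> in auto)
    also have "4 * (\<delta> * real i) + 3 * (\<delta> * sqrt (real i)) * (4 * sqrt (real i)) = 16 * \<delta> * real i"
      by simp
    also have "c * (16 * \<delta> * real i) \<le> c * (16 * \<delta> * real r)"
      using c \<delta> r1 by (intro mult_left_mono) auto
    also have "\<dots> = (z r * 16 * \<delta> / \<rho>) * (real r * \<kappa> r)" by (simp add: c_def)
    also have "\<dots> \<le> (z r * 16 * \<delta> / \<rho>) * (2 * K\<^sub>1)"
    proof (intro mult_left_mono z_comparable(2)[of r r])
      show "64 * C\<^sub>1 * (real L)\<^sup>2 \<le> real r" using i r1 by linarith
      show "0 \<le> z r * 16 * \<delta> / \<rho>" using z_pos[of r] \<delta> \<rho>_pos by simp
    qed auto
    finally show ?thesis by (simp add: mult_ac)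
  qed
  have lossh: "(P ^^ i) (loss_h m) 0 \<le> q + 12 * \<delta>"
  proof -
    have "(P ^^ i) (loss_h m) 0 \<le> (P ^^ i) (\<lambda>n. (if n < n\<^sub>0 then 1 else 0) + 12 * \<delta>) 0"
    proof (rule poslin_mono[OF poslin_Pk])
      fix n
      show "loss_h m n \<le> (if n < n\<^sub>0 then 1 else 0) + 12 * \<delta>"
      proof (cases "n < n\<^sub>0")
        case True
        then show ?thesis using loss_h_le_1[of m n] \<delta> by simp
      next
        case False
        have "loss_h m n \<le> 12 * sqrt (real m) / real n" using False n0c m by (intro loss_h_le) auto
        also have "\<dots> \<le> 12 * sqrt (real m) / (\<delta> * sqrt (real i))"
          using False n0a \<delta>i by (intro divide_left_mono) auto
        also have "\<dots> = 12 * \<delta>" unfolding \<delta>2 using \<delta> i1 by (simp add: power2_eq_square)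
        finally show ?thesis using False by simp
      qed
    qed
    then show ?thesis unfolding q_def by (simp only: poslin_add[OF poslin_Pk] Pk_const)
  qed
  define C where "C = 4 * (2 + B) * 2 * C\<^sub>1 + 4 * K\<^sub>1 / \<rho> * 16 + 24 * (1 + B)"
  have "2 * (P ^^ i) (loss_F m r) 0 + 2 * (1 + B) * z r * (P ^^ i) (loss_h m) 0
     \<le> 2 * (z r * q + z r * (4 * K\<^sub>1 / \<rho> * 8) * \<delta>) + 2 * (1 + B) * z r * (q + 12 * \<delta>)"
    using lossF lossh B_nonneg z_pos[of r] by (intro add_mono mult_left_mono) auto
  also have "\<dots> = z r * ((2 * (2 + B)) * q + (4 * K\<^sub>1 / \<rho> * 16 + 24 * (1 + B)) * \<delta>)"
    by (simp add: algebra_simps)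
  also have "\<dots> \<le> z r * ((2 * (2 + B)) * (2 * C\<^sub>1 * (\<delta> + 3 * \<Lambda>)) + (4 * K\<^sub>1 / \<rho> * 16 + 24 * (1 + B)) * (\<delta> + 3 * \<Lambda>))"
    using q z_pos[of r] B_nonneg K\<^sub>1_ge \<rho>_pos \<Lambda> by (intro mult_left_mono add_mono) auto
  also have "\<dots> \<le> z r * (C * (\<delta> + 3 * \<Lambda>))"
    using z_pos[of r] B_nonneg K\<^sub>1_ge C\<^sub>1_ge \<rho>_pos \<Lambda> \<delta>
    unfolding distrib_right[symmetric] mult.assoc[symmetric]
    by (intro mult_left_mono mult_right_mono) (auto simp: C_def algebra_simps)
  also have "\<dots> \<le> (K\<^sub>1 * z (i + m + r)) * (C * (4 * (\<delta> + \<Lambda>)))"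
  proof (intro mult_mono z_comparable(1))
    show "64 * C\<^sub>1 * (real L)\<^sup>2 \<le> real r" using i r1 by linarith
    show "0 \<le> K\<^sub>1 * z (i + m + r)" using K\<^sub>1_ge z_pos[of "i + m + r"] by simp
    show "0 \<le> C" "C \<le> C" using B_nonneg K\<^sub>1_ge C\<^sub>1_ge \<rho>_pos by (simp_all add: C_def)
    then show "0 \<le> C * (\<delta> + 3 * \<Lambda>)" using \<delta> \<Lambda> by simp
  qed (use m r \<delta> \<Lambda> in auto)
  also have "\<dots> = K\<^sub>2 * z (i + m + r) * (\<delta> + \<Lambda>)" by (simp add: K\<^sub>2_def C_def)
  finally have "2 * (P ^^ i) (loss_F m r) 0 + 2 * (1 + B) * z r * (P ^^ i) (loss_h m) 0
     \<le> K\<^sub>2 * z (i + m + r) * (\<delta> + \<Lambda>)" .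
  then have "2 ^ m * (2 * (P ^^ i) (loss_F m r) 0 + 2 * (1 + B) * z r * (P ^^ i) (loss_h m) 0)
     \<le> 2 ^ m * (K\<^sub>2 * z (i + m + r) * (\<delta> + \<Lambda>))"
    by (intro mult_left_mono) auto
  then show ?thesis using word_sum_le_loss[of i r m] unfolding \<delta>_def \<Lambda>_def by linarith
qed

definition block_sum :: "nat \<Rightarrow> nat \<Rightarrow> bool list \<Rightarrow> real" where
  "block_sum i r xs = (\<Sum>pre\<in>words i. \<Sum>suf\<in>words r. W (pre @ xs @ suf) (f 0) 0)"

lemma sum_W_f: "(\<Sum>xs\<in>words n. W xs (f 0) 0) = 2 ^ n * z n"
  unfolding sum_W z_def f_Tk[of n] ..

lemma block_sum_eq: "block_sum i r xs = 2 ^ (i + r) * (T ^^ i) (W xs (f r)) 0"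
proof -
  have "(\<Sum>suf\<in>words r. W (pre @ xs @ suf) (f 0) 0) = W pre (W xs (\<lambda>n. 2 ^ r * f r n)) 0" for pre
  proof -
    have "(\<Sum>suf\<in>words r. W (pre @ xs @ suf) (f 0) 0)
        = W pre (\<lambda>y. \<Sum>suf\<in>words r. W xs (W suf (f 0)) y) 0"
      by (simp only: W_append poslin_sum[OF poslin_W])
    also have "(\<lambda>y. \<Sum>suf\<in>words r. W xs (W suf (f 0)) y) = W xs (\<lambda>n. \<Sum>suf\<in>words r. W suf (f 0) n)"
      by (rule ext) (simp only: poslin_sum[OF poslin_W])
    also have "(\<lambda>n. \<Sum>suf\<in>words r. W suf (f 0) n) = (\<lambda>n. 2 ^ r * f r n)"
      by (rule ext) (simp only: sum_W f_Tk[of r])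
    finally show ?thesis .
  qed
  moreover have "W xs (\<lambda>n. 2 ^ r * f r n) = (\<lambda>n. 2 ^ r * W xs (f r) n)"
    by (rule ext) (rule poslin_scale[OF poslin_W])
  ultimately have "block_sum i r xs = (\<Sum>pre\<in>words i. 2 ^ r * W pre (W xs (f r)) 0)"
    by (simp add: block_sum_def poslin_scale[OF poslin_W])
  then show ?thesis by (simp add: sum_W sum_distrib_left[symmetric] power_add)
qed

lemma sum_block_sum: "(\<Sum>xs\<in>words m. block_sum i r xs) = 2 ^ (i + m + r) * z (i + m + r)"
proof -
  have "(\<Sum>xs\<in>words m. (T ^^ i) (W xs (f r)) 0) = (T ^^ i) (\<lambda>y. \<Sum>xs\<in>words m. W xs (f r) y) 0"
    by (simp only: poslin_sum[OF poslin_Tk])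
  also have "\<dots> = 2 ^ m * (T ^^ (i + m + r)) (f 0) 0"
    by (simp add: sum_W poslin_scale[OF poslin_Tk] f_Tk[of r] funpow_add del: f.simps)
  also have "\<dots> = 2 ^ m * z (i + m + r)" unfolding z_def f_Tk[of "i + m + r"] ..
  finally show ?thesis by (simp add: block_sum_eq sum_distrib_left[symmetric] power_add mult_ac)
qed

lemma block_sum_near_uniform:
  assumes i: "64 * C\<^sub>1 * (real L)\<^sup>2 \<le> real i" and m: "1 \<le> m" "m \<le> i" and r: "i \<le> r"
  shows "(\<Sum>xs\<in>words m. \<bar>block_sum i r xs / (2 ^ (i + m + r) * z (i + m + r)) - 1 / 2 ^ m\<bar>)
    \<le> 2 * K\<^sub>2 * (root 4 (real m / real i) + real L / sqrt (real i))"
proof -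
  define Z where "Z = 2 ^ (i + m + r) * z (i + m + r)"
  define \<epsilon> where "\<epsilon> = K\<^sub>2 * (root 4 (real m / real i) + real L / sqrt (real i))"
  define y where "y = 2 ^ (i + r) * z (i + r)"
  have Z: "0 < Z" by (simp add: Z_def z_pos)
  define S where "S = (\<Sum>xs\<in>words m. \<bar>block_sum i r xs - y\<bar>)"
  have "S = 2 ^ (i + r) * (\<Sum>xs\<in>words m. \<bar>(T ^^ i) (W xs (f r)) 0 - z (i + r)\<bar>)"
    unfolding S_def y_def block_sum_eq right_diff_distrib[symmetric] by (simp add: abs_mult sum_distrib_left)
  also have "\<dots> \<le> 2 ^ (i + r) * (2 ^ m * (K\<^sub>2 * z (i + m + r) * (root 4 (real m / real i) + real L / sqrt (real i))))"
    by (intro mult_left_mono word_sum_bound assms) auto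
  also have "\<dots> = Z * \<epsilon>" by (simp add: Z_def \<epsilon>_def power_add)
  finally have S: "S \<le> Z * \<epsilon>" .
  have "Z - 2 ^ m * y = (\<Sum>xs\<in>words m. block_sum i r xs - y)"
    by (simp add: sum_subtractf sum_block_sum Z_def card_words)
  then have "\<bar>Z - 2 ^ m * y\<bar> \<le> S" unfolding S_def by simp
  have "(\<Sum>xs\<in>words m. \<bar>block_sum i r xs - Z / 2 ^ m\<bar>) \<le> (\<Sum>xs\<in>words m. \<bar>block_sum i r xs - y\<bar> + \<bar>Z - 2 ^ m * y\<bar> / 2 ^ m)"
  proof (intro sum_mono)
    fix xs :: "bool list"
    have "y - Z / 2 ^ m = - ((Z - 2 ^ m * y) / 2 ^ m)" by (simp add: diff_divide_distrib)
    then have "\<bar>y - Z / 2 ^ m\<bar> = \<bar>Z - 2 ^ m * y\<bar> / 2 ^ m" by (simp add: abs_divide)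
    then show "\<bar>block_sum i r xs - Z / 2 ^ m\<bar> \<le> \<bar>block_sum i r xs - y\<bar> + \<bar>Z - 2 ^ m * y\<bar> / 2 ^ m" by linarith
  qed
  also have "\<dots> = S + \<bar>Z - 2 ^ m * y\<bar>" by (simp add: sum.distrib S_def card_words)
  also have "\<dots> \<le> Z * (2 * \<epsilon>)" using S \<open>\<bar>Z - 2 ^ m * y\<bar> \<le> S\<close> by linarith
  finally have *: "(\<Sum>xs\<in>words m. \<bar>block_sum i r xs - Z / 2 ^ m\<bar>) \<le> Z * (2 * \<epsilon>)" .
  have "(\<Sum>xs\<in>words m. \<bar>block_sum i r xs / Z - 1 / 2 ^ m\<bar>) = (\<Sum>xs\<in>words m. \<bar>block_sum i r xs - Z / 2 ^ m\<bar> / Z)"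
  proof (intro sum.cong refl)
    fix xs :: "bool list"
    have "block_sum i r xs / Z - 1 / 2 ^ m = (block_sum i r xs - Z / 2 ^ m) / Z" using Z by (simp add: diff_divide_distrib)
    then show "\<bar>block_sum i r xs / Z - 1 / 2 ^ m\<bar> = \<bar>block_sum i r xs - Z / 2 ^ m\<bar> / Z" using Z by (simp add: abs_divide)
  qed
  also have "\<dots> = (\<Sum>xs\<in>words m. \<bar>block_sum i r xs - Z / 2 ^ m\<bar>) / Z" by (simp add: sum_divide_distrib)
  also have "\<dots> \<le> 2 * \<epsilon>" using * Z by (simp add: divide_le_eq mult.commute)
  finally show ?thesis by (simp add: Z_def \<epsilon>_def mult.assoc)
qed

end

section \<open>The bidiagonal matrices of the open ASEP\<close>

text \<open>
  The hypotheses on \<open>q\<close> say that it is close enough to 1, depending on \<open>u\<close> and \<open>v\<close>.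
\<close>

locale asep_params =
  fixes u v q :: real
  assumes u: "-1 < u" "u < 1" and v: "-1 < v" "v < 1"
    and q_half: "1 / 2 \<le> q" and q_less: "q < 1"
    and q_uv: "\<bar>u * v\<bar> \<le> q" and q_theta: "1 - q \<le> (1 - u) * (1 - v) / 2"
begin

text \<open>
  Dividing by \<open>q\<close> gives \<open>c (n+1) = (1 - q^(n+1)) (1 - u v q^n)\<close> and \<open>c 0 = 0\<close> by one formula.
  The constants \<open>\<theta>\<close>, \<open>\<rho>\<close> and \<open>C\<^sub>0\<close> depend on \<open>u\<close> and \<open>v\<close> only, so that all later estimates are
  uniform in \<open>q\<close>. Positivity of \<open>\<theta>\<close> is the maximal current condition.
\<close>

definition c :: "nat \<Rightarrow> real" where "c n = (1 - q ^ n) * (1 - u * v * (q ^ n / q))"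
definition e :: "nat \<Rightarrow> real" where "e n = sqrt (c n) / 4"
definition d :: "nat \<Rightarrow> real" where "d n = (2 + (u + v) * q ^ n) / 4"
definition \<theta> :: real where "\<theta> = (1 - u) * (1 - v)"
definition \<rho> :: real where "\<rho> = (2 - max (u + v) 0) / 8"
definition C\<^sub>0 :: real where "C\<^sub>0 = 16 / (1 - \<bar>u * v\<bar>)"

lemma q_pos: "0 < q" using q_half by simp
lemma x_pos: "0 < q ^ n" using q_pos by simp
lemma x_le: "q ^ n \<le> 1" using q_pos q_less by (simp add: power_le_one)
lemma \<theta>_pos: "0 < \<theta>" using u v by (simp add: \<theta>_def)
lemma uv_less: "\<bar>u * v\<bar> < 1" using q_uv q_less by linarith

lemma c_Suc: "c (Suc n) = (1 - q * q ^ n) * (1 - u * v * q ^ n)"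
  using q_pos by (simp add: c_def)

lemma uv_x_le: "u * v * q ^ n \<le> \<bar>u * v\<bar>" "- \<bar>u * v\<bar> \<le> u * v * q ^ n"
proof -
  have "\<bar>u * v * q ^ n\<bar> = \<bar>u * v\<bar> * q ^ n" using x_pos[of n] by (simp add: abs_mult)
  also have "\<dots> \<le> \<bar>u * v\<bar> * 1" using x_le by (intro mult_left_mono) auto
  finally show "u * v * q ^ n \<le> \<bar>u * v\<bar>" "- \<bar>u * v\<bar> \<le> u * v * q ^ n" by linarith+
qed

lemma c_0: "c 0 = 0" by (simp add: c_def)

lemma c_Suc_pos: "0 < c (Suc n)"
proof -
  have "q * q ^ n \<le> q * 1" using x_le[of n] q_pos by (intro mult_left_mono) auto
  then have "0 < 1 - q * q ^ n" using q_less by simp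
  moreover have "0 < 1 - u * v * q ^ n" using uv_x_le[of n] uv_less by linarith
  ultimately show ?thesis unfolding c_Suc by simp
qed

lemma c_nonneg: "0 \<le> c n"
  by (cases n) (auto simp: c_0 less_imp_le[OF c_Suc_pos])

lemma uv_div: "\<bar>u * v * (q ^ n / q)\<bar> \<le> q ^ n"
proof -
  have "\<bar>u * v * (q ^ n / q)\<bar> = \<bar>u * v\<bar> * q ^ n / q" using x_pos[of n] q_pos by (simp add: abs_mult)
  also have "\<dots> \<le> q * q ^ n / q" using q_uv x_pos[of n] q_pos by (intro divide_right_mono mult_right_mono) auto
  finally show ?thesis using q_pos by simp
qed

lemma uv_div': "1 - u * v * (q ^ n / q) \<le> 1 + q ^ n" "1 - q ^ n \<le> 1 - u * v * (q ^ n / q)"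
  using uv_div[of n] by linarith+

lemma c_le: "c n \<le> 1"
proof -
  have "c n \<le> (1 - q ^ n) * (1 + q ^ n)" unfolding c_def
    using x_le[of n] by (intro mult_left_mono uv_div') auto
  also have "\<dots> = 1 - (q ^ n)\<^sup>2" by (simp add: power2_eq_square algebra_simps)
  finally show ?thesis using zero_le_power2[of "q ^ n"] by linarith
qed

lemma c_lower: "1 - 2 * q ^ n \<le> c n"
proof -
  have "(1 - q ^ n) * (1 - q ^ n) \<le> c n" unfolding c_def
    using x_le[of n] by (intro mult_left_mono uv_div') auto
  moreover have "(1 - q ^ n) * (1 - q ^ n) = 1 - 2 * q ^ n + (q ^ n)\<^sup>2" by (simp add: power2_eq_square algebra_simps)
  ultimately show ?thesis using zero_le_power2[of "q ^ n"] by linarith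
qed

text \<open>
  The difference \<open>q (c (n+1) - c n)\<close> factors as \<open>x (1 - q) (q + p - p x (1 + q))\<close> with \<open>x = q^n\<close>
  and \<open>p = u v\<close>.
\<close>

lemma c_mono: "c n \<le> c (Suc n)"
proof -
  define x p where "x = q ^ n" and "p = u * v"
  have x: "0 < x" "x \<le> 1" by (simp_all add: x_def x_pos x_le)
  have "0 \<le> q + p - p * x * (1 + q)"
  proof (cases "0 \<le> p")
    case True
    have "p * x * (1 + q) \<le> p * 1 * (1 + q)" using x True q_pos by (intro mult_right_mono mult_left_mono) auto
    moreover have "p * q \<le> 1 * q" using uv_less q_pos by (intro mult_right_mono) (auto simp: p_def)
    ultimately show ?thesis by (simp add: algebra_simps)
  next
    case False
    then have "p * x * (1 + q) \<le> 0" using x q_pos by (simp add: mult_nonpos_nonneg)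
    moreover have "0 \<le> q + p" using q_uv by (simp add: p_def)
    ultimately show ?thesis by linarith
  qed
  then have "0 \<le> x * (1 - q) * (q + p - p * x * (1 + q))" using x q_less by simp
  also have "\<dots> = q * (c (Suc n) - c n)"
  proof -
    have "q * c n = (1 - x) * (q - p * x)" using q_pos by (simp add: c_def x_def p_def field_simps)
    then show ?thesis unfolding right_diff_distrib
      by (simp add: c_Suc flip: x_def p_def) (simp add: algebra_simps)
  qed
  finally show ?thesis using q_pos by (simp add: zero_le_mult_iff)
qed

text \<open>
  Twice the off-diagonal mass \<open>1 - d n\<close> is \<open>leave (q^n)\<close>, and by \<open>leave_sq\<close> its square exceeds \<open>c (n+1)\<close> by
  \<open>gap (q^n)\<close>. Hence a positive gap means killing, and monotonicity of the gap gives \<open>growth_mono\<close>. The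
  linear coefficient of the gap is \<open>\<theta> - (1 - q)\<close>, the quadratic one is \<open>(u - v)^2 / 4 + (1 - q) u v\<close>.
\<close>

definition leave :: "real \<Rightarrow> real" where "leave x = 1 - (u + v) * x / 2"
definition gap :: "real \<Rightarrow> real" where
  "gap x = x * (q + u * v - (u + v)) + x\<^sup>2 * ((u + v)\<^sup>2 / 4 - q * (u * v))"

lemma leave_sq: "(leave (q ^ n))\<^sup>2 = c (Suc n) + gap (q ^ n)"
  unfolding c_Suc leave_def gap_def by (simp add: power2_eq_square algebra_simps)

lemma gap_coeffs: "\<theta> / 2 \<le> q + u * v - (u + v)" "0 \<le> (u + v)\<^sup>2 / 4 - q * (u * v)"
proof -
  have "\<theta> = 1 + u * v - (u + v)" by (simp add: \<theta>_def algebra_simps)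
  then show "\<theta> / 2 \<le> q + u * v - (u + v)" using q_theta unfolding \<theta>_def[symmetric] by linarith
  show "0 \<le> (u + v)\<^sup>2 / 4 - q * (u * v)"
  proof (cases "0 \<le> u * v")
    case True
    have "q * (u * v) \<le> 1 * (u * v)" using True q_less by (intro mult_right_mono) auto
    moreover have "0 \<le> (u - v)\<^sup>2" by simp
    ultimately show ?thesis by (simp add: power2_eq_square algebra_simps)
  next
    case False
    then have "q * (u * v) \<le> 0" using q_pos by (simp add: mult_nonneg_nonpos)
    moreover have "0 \<le> (u + v)\<^sup>2 / 4" by simp
    ultimately show ?thesis by linarith
  qed
qed

lemma gap_lower: "0 \<le> x \<Longrightarrow> x * (\<theta> / 2) \<le> gap x"
  unfolding gap_def using mult_left_mono[OF gap_coeffs(1), of x] gap_coeffs(2)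
  by (intro add_increasing2) auto

lemma gap_mono: "0 \<le> x \<Longrightarrow> x \<le> y \<Longrightarrow> gap x \<le> gap y"
  using gap_coeffs \<theta>_pos unfolding gap_def by (intro add_mono mult_right_mono power_mono) auto

lemma sx: "-2 < u + v" "u + v < 2" using u v by auto

lemma leave_pos: "0 < leave (q ^ n)"
proof -
  have "(u + v) * q ^ n < 2"
  proof (cases "0 \<le> u + v")
    case True
    then have "(u + v) * q ^ n \<le> (u + v) * 1" using x_le by (intro mult_left_mono) auto
    also have "\<dots> < 2" using sx by simp
    finally show ?thesis .
  next
    case False
    then have "(u + v) * q ^ n \<le> 0" using x_pos[of n] by (intro mult_nonpos_nonneg) auto
    then show ?thesis by linarith
  qed
  then show ?thesis by (simp add: leave_def)
qed

lemma sqrt_c_le: "sqrt (c (Suc n)) \<le> leave (q ^ n) - \<theta> * q ^ n / 8"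
proof (rule real_le_lsqrt)
  define x where "x = q ^ n"
  have x: "0 < x" "x \<le> 1" by (simp_all add: x_def x_pos x_le)
  have uv1: "u * v < 1" using uv_less by linarith
  have lin: "\<theta> / 8 + (u + v) / 2 \<le> 1" 
  proof -
    have "\<theta> = 1 + u * v - (u + v)" by (simp add: \<theta>_def algebra_simps)
    then show ?thesis using uv1 sx by argo
  qed
  have "(\<theta> / 8 + (u + v) / 2) * x \<le> 1 * x" using lin x by (intro mult_right_mono) auto
  also have "\<dots> \<le> 1" using x by simp
  finally have "(\<theta> / 8 + (u + v) / 2) * x \<le> 1" .
  then show nn: "0 \<le> leave (q ^ n) - \<theta> * q ^ n / 8" unfolding leave_def x_def[symmetric] by (simp add: algebra_simps)
  have "-2 * x \<le> (u + v) * x" using sx x by (intro mult_right_mono) auto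
  then have a2: "leave x \<le> 2" using x by (simp add: leave_def)
  have "\<theta> * x / 4 * leave x \<le> \<theta> * x / 4 * 2" using a2 \<theta>_pos x by (intro mult_left_mono) auto
  then have "(leave x)\<^sup>2 - x * (\<theta> / 2) \<le> (leave x - \<theta> * x / 8)\<^sup>2"
  proof -
    have "(leave x - \<theta> * x / 8)\<^sup>2 = (leave x)\<^sup>2 - \<theta> * x / 4 * leave x + (\<theta> * x / 8)\<^sup>2"
      by (simp add: power2_eq_square algebra_simps)
    moreover have "\<theta> * x / 4 * 2 = x * (\<theta> / 2)" by simp
    ultimately show ?thesis
      using \<open>\<theta> * x / 4 * leave x \<le> \<theta> * x / 4 * 2\<close> zero_le_power2[of "\<theta> * x / 8"] by linarith
  qed
  then show "c (Suc n) \<le> (leave (q ^ n) - \<theta> * q ^ n / 8)\<^sup>2"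
    using leave_sq[of n] gap_lower[of x] x unfolding x_def by linarith
qed

text \<open>
  The walk is killed at every level in the maximal current phase, also where \<open>u + v > 0\<close> makes the
  diagonal entries larger than in the free walk.
\<close>

lemma killing: "\<theta> / 16 * q ^ n \<le> 1 - (e n + d n + e (Suc n))"
proof -
  have "e n \<le> e (Suc n)" using c_mono[of n] by (simp add: e_def)
  moreover have "e (Suc n) \<le> (leave (q ^ n) - \<theta> * q ^ n / 8) / 4" using sqrt_c_le[of n] by (simp add: e_def)
  moreover have "d n = 1 - leave (q ^ n) / 2" by (simp add: d_def leave_def field_simps)
  ultimately show ?thesis by simp
qed

text \<open>
  The difference \<open>c (n+1)^2 - c n * c (n+2)\<close> is \<open>(1 - q)^2 x / q\<close> times a quadratic polynomial in
  \<open>x = q^n\<close>. For \<open>p = u v \<ge> 0\<close> that polynomial decreases on \<open>[0, 1]\<close> to the value \<open>q (1 - p)^2\<close>; for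
  \<open>p < 0\<close> both of its terms are nonnegative.
\<close>

lemma c_logconcave: "c n * c (Suc (Suc n)) \<le> (c (Suc n))\<^sup>2"
proof -
  define x p where "x = q ^ n" and "p = u * v"
  have x: "0 < x" "x \<le> 1" by (simp_all add: x_def x_pos x_le)
  have pq: "0 \<le> q + p" "p \<le> 1" using q_uv uv_less by (simp_all add: p_def)
  have "0 \<le> (q + p) * (1 + p * q * x\<^sup>2) - p * (1 + q)\<^sup>2 * x"
  proof (cases "0 \<le> p")
    case True
    have "(q + p) * q * (1 + x) \<le> (q + 1) * q * (1 + 1)"
      using pq x q_pos by (intro mult_mono add_mono) auto
    also have "\<dots> \<le> (1 + q)\<^sup>2"
    proof -
      have "q * q \<le> 1 * 1" using q_pos q_less by (intro mult_mono) auto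
      then show ?thesis by (simp add: power2_eq_square algebra_simps)
    qed
    finally have "0 \<le> (1 - x) * p * ((1 + q)\<^sup>2 - (q + p) * q * (1 + x))" using True x by simp
    moreover have "0 \<le> q * (1 - p)\<^sup>2" using q_pos by simp
    moreover have "(q + p) * (1 + p * q * x\<^sup>2) - p * (1 + q)\<^sup>2 * x
       = (1 - x) * p * ((1 + q)\<^sup>2 - (q + p) * q * (1 + x)) + q * (1 - p)\<^sup>2"
      by (simp add: power2_eq_square algebra_simps)
    ultimately show ?thesis by linarith
  next
    case False
    have "- p * (q * x\<^sup>2) \<le> 1 * (1 * 1)"
      using False q_uv q_less q_pos x by (intro mult_mono) (auto simp: p_def power_le_one)
    then have "0 \<le> 1 + p * q * x\<^sup>2" by (simp add: mult.assoc)
    then have "0 \<le> (q + p) * (1 + p * q * x\<^sup>2)" using pq by simp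
    moreover have "p * ((1 + q)\<^sup>2 * x) \<le> 0" using False x by (intro mult_nonpos_nonneg) auto
    ultimately show ?thesis by (simp add: mult.assoc)
  qed
  then have "0 \<le> (1 - q)\<^sup>2 * x * ((q + p) * (1 + p * q * x\<^sup>2) - p * (1 + q)\<^sup>2 * x)" using x by simp
  also have "\<dots> = q * ((c (Suc n))\<^sup>2 - c n * c (Suc (Suc n)))"
  proof -
    have qc: "q * c n = (1 - x) * (q - p * x)" using q_pos by (simp add: c_def x_def p_def field_simps)
    have "q * ((c (Suc n))\<^sup>2 - c n * c (Suc (Suc n))) = q * (c (Suc n))\<^sup>2 - (q * c n) * c (Suc (Suc n))"
      by (simp add: algebra_simps)
    also have "\<dots> = q * ((1 - q * x) * (1 - p * x))\<^sup>2 - ((1 - x) * (q - p * x)) * ((1 - q * (q * x)) * (1 - p * (q * x)))"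
      unfolding qc by (simp add: c_Suc x_def p_def)
    also have "\<dots> = (1 - q)\<^sup>2 * x * ((q + p) * (1 + p * q * x\<^sup>2) - p * (1 + q)\<^sup>2 * x)"
      by (simp add: power2_eq_square algebra_simps)
    finally show ?thesis by simp
  qed
  finally show ?thesis using q_pos by (simp add: zero_le_mult_iff)
qed

text \<open>
  Bernoulli's inequality for \<open>sqrt q\<close>, squared.
\<close>

lemma geometric_decay: "q ^ j * (real (j + 1) * real (j + 2)) \<le> 8 / (1 - q)\<^sup>2"
proof -
  define r where "r = sqrt q"
  have r: "0 < r" "r < 1" "r * r = q" using q_pos q_less by (simp_all add: r_def)
  have "(1 - (1 - r)) ^ j * (1 + real j * (1 - r)) \<le> 1" using r by (intro power_one_minus_le) auto
  moreover have "real (j + 1) * (1 - r) \<le> 1 + real j * (1 - r)" using r by (simp add: algebra_simps)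
  then have "r ^ j * (real (j + 1) * (1 - r)) \<le> r ^ j * (1 + real j * (1 - r))"
    using r by (intro mult_left_mono) auto
  ultimately have 1: "r ^ j * (real (j + 1) * (1 - r)) \<le> 1" by simp
  have "(1 - q) / 2 = (1 - r) * ((1 + r) / 2)" using r(3) by (simp add: field_simps)
  also have "\<dots> \<le> (1 - r) * 1" using r by (intro mult_left_mono) auto
  finally have 2: "(1 - q) / 2 \<le> 1 - r" by simp
  have "r ^ j * real (j + 1) * ((1 - q) / 2) \<le> r ^ j * real (j + 1) * (1 - r)"
    using 2 r by (intro mult_left_mono) auto
  also have "\<dots> \<le> 1" using 1 by (simp only: mult.assoc)
  finally have 3: "r ^ j * real (j + 1) * ((1 - q) / 2) \<le> 1" .
  have "(r ^ j * real (j + 1) * ((1 - q) / 2))\<^sup>2 \<le> 1"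
    using 3 r q_less by (intro power_le_one) auto
  moreover have "(r ^ j * real (j + 1) * ((1 - q) / 2))\<^sup>2 = q ^ j * (real (j + 1))\<^sup>2 * (1 - q)\<^sup>2 / 4"
    unfolding r(3)[symmetric] by (simp add: power_mult_distrib power2_eq_square)
  ultimately have "q ^ j * (real (j + 1))\<^sup>2 * (1 - q)\<^sup>2 \<le> 4" by simp
  then have 4: "q ^ j * (real (j + 1))\<^sup>2 \<le> 4 / (1 - q)\<^sup>2" using q_less by (simp add: field_simps)
  have "real (j + 1) * real (j + 2) \<le> real (j + 1) * (2 * real (j + 1))" by (intro mult_left_mono) auto
  then have "q ^ j * (real (j + 1) * real (j + 2)) \<le> q ^ j * (2 * (real (j + 1))\<^sup>2)"
    using x_pos[of j] by (intro mult_left_mono) (auto simp: power2_eq_square)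
  then show ?thesis using 4 by linarith
qed

text \<open>
  For \<open>up = True\<close> and \<open>y = v\<close> this is the matrix \<open>D\<close> of an occupied site, for \<open>up = False\<close> and \<open>y = u\<close>
  the matrix \<open>E\<close> of an empty one. Exchanging \<open>up\<close> transposes the matrix.
\<close>

definition op :: "bool \<Rightarrow> real \<Rightarrow> (nat \<Rightarrow> real) \<Rightarrow> nat \<Rightarrow> real" where
  "op up y \<phi> n = (1 + y * q ^ n) * \<phi> n
     + (if up then sqrt (c (Suc n)) * \<phi> (Suc n) else sqrt (c n) * \<phi> (n - 1))"

text \<open>
  The normalised letters; \<open>t = False\<close> selects the transposed matrices, which are needed because the
  comparison of words assumes that the part to the left of the block is the shorter one.
\<close>

definition A :: "bool \<Rightarrow> bool \<Rightarrow> (nat \<Rightarrow> real) \<Rightarrow> nat \<Rightarrow> real" where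
  "A t b \<phi> n = op (b = t) (if b then v else u) \<phi> n / 2"

lemma one_plus_pos: "-1 < y \<Longrightarrow> 0 < 1 + y * q ^ n"
  using mult_strict_right_mono[of "-1" y "q ^ n"] x_pos[of n] x_le[of n] by linarith

lemma poslin_op: "-1 < y \<Longrightarrow> poslin (\<lambda>\<phi> n. op up y \<phi> n / 2)"
  unfolding poslin_def
proof (intro conjI allI impI)
  fix \<phi> :: "nat \<Rightarrow> real" and n
  assume "-1 < y" "\<forall>y. 0 \<le> \<phi> y"
  then show "0 \<le> op up y \<phi> n / 2"
    using one_plus_pos[of y n] c_nonneg by (auto simp: op_def)
qed (auto simp: op_def field_simps)

lemma op_one:
  assumes "-1 < y" "y < 1"
  shows "\<bar>op up y (\<lambda>_. 1) n / 2 - 1\<bar> \<le> 3 / 2 * q ^ n"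
proof -
  define k where "k = (if up then Suc n else n)"
  have "1 - 2 * q ^ n \<le> c k"
    using c_lower[of n] c_mono[of n] by (auto simp: k_def)
  moreover have "c k \<le> sqrt (c k)"
    using c_le[of k] c_nonneg[of k] real_le_rsqrt[of "c k" "c k"]
    by (simp add: power2_eq_square mult_left_le)
  moreover have "sqrt (c k) \<le> 1" using c_le[of k] by simp
  ultimately have s: "1 - 2 * q ^ n \<le> sqrt (c k)" "sqrt (c k) \<le> 1" by linarith+
  have "\<bar>y * q ^ n\<bar> \<le> 1 * q ^ n" unfolding abs_mult using assms x_pos[of n] by (intro mult_mono) auto
  moreover have "op up y (\<lambda>_. 1) n / 2 - 1 = (y * q ^ n - (1 - sqrt (c k))) / 2"
    by (simp add: op_def k_def field_simps)
  ultimately show ?thesis using s x_pos[of n] unfolding abs_le_iff by argo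
qed

text \<open>
  The width \<open>L\<close> has to exceed \<open>1 / (1 - q)\<close>, the scale on which \<open>q^n\<close> varies, by a factor that makes
  \<open>q^L\<close> small compared with \<open>(1 - q)^2\<close>: then \<open>q^(L + j)\<close> is below the error \<open>1 / j^2\<close> for all \<open>j\<close> at once.
\<close>

lemma asep_killed_walk:
  assumes L: "1 / (1 - q) \<le> real L" "q ^ L \<le> (1 - q)\<^sup>2 / 96"
  shows "killed_walk e d \<rho> C\<^sub>0 L"
proof
  show "e 0 = 0" by (simp add: e_def c_0)
  show "0 < e (Suc n)" for n by (simp add: e_def c_Suc_pos)
  show "e n \<le> 1 / 4" for n using c_le[of n] by (simp add: e_def)
  show dpos: "0 < d n" for n
  proof -
    have "-2 * q ^ n < (u + v) * q ^ n" using sx x_pos[of n] by (intro mult_strict_right_mono) auto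
    then show ?thesis using x_le[of n] by (simp add: d_def)
  qed
  show "(e (Suc n))\<^sup>2 \<le> d n * d (Suc n)" for n
  proof -
    define x where "x = q ^ n"
    have x: "0 < x" "x \<le> 1" by (simp_all add: x_def x_pos x_le)
    have qx: "0 < q * x" "q * x \<le> 1" using x q_pos q_less by (auto simp: mult_le_one)
    have 1: "2 * (1 - q * x) \<le> 2 + (u + v) * (q * x)"
      using mult_right_mono[of "-2" "u + v" "q * x"] sx qx by (simp add: algebra_simps)
    have 2: "1 - u * v * x \<le> 2 * (2 + (u + v) * x)"
    proof -
      have "1 * 1 \<le> (2 + u) * (2 + v)" using u v by (intro mult_mono) auto
      then have "-3 \<le> 2 * (u + v) + u * v" by (simp add: algebra_simps)
      then have "-3 * x \<le> (2 * (u + v) + u * v) * x" using x by (intro mult_right_mono) auto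
      moreover have "-3 \<le> -3 * x" using x by simp
      ultimately have "-3 \<le> (2 * (u + v) + u * v) * x" by linarith
      then show ?thesis by (simp add: algebra_simps)
    qed
    have "c (Suc n) = (1 - u * v * x) * (1 - q * x)" by (simp add: c_Suc x_def)
    also have "\<dots> \<le> (2 * (2 + (u + v) * x)) * (1 - q * x)" using 2 qx by (intro mult_right_mono) auto
    also have "\<dots> = (2 + (u + v) * x) * (2 * (1 - q * x))" by (simp only: mult_ac)
    also have "\<dots> \<le> (2 + (u + v) * x) * (2 + (u + v) * (q * x))"
      using 1 dpos[of n] by (intro mult_left_mono) (auto simp: d_def x_def)
    finally have "c (Suc n) \<le> 16 * (d n * d (Suc n))" by (simp add: d_def x_def)
    then show ?thesis by (simp add: e_def power_divide c_nonneg)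
  qed
  show "e n + d n + e (Suc n) \<le> 1" for n
  proof -
    have "0 \<le> \<theta> / 16 * q ^ n" using \<theta>_pos x_pos[of n] by simp
    then show ?thesis using killing[of n] by linarith
  qed
  show "(1 - d (Suc n)) * e (Suc n) \<le> (1 - d n) * e (Suc (Suc n))" for n
  proof -
    define x where "x = q ^ n"
    have x: "0 < x" by (simp add: x_def x_pos)
    have y: "q ^ Suc n \<le> q ^ n" "0 \<le> q ^ Suc n" using q_pos q_less by (simp_all add: mult_left_le_one_le)
    have "leave (q ^ Suc n) * sqrt (c (Suc n)) \<le> leave (q ^ n) * sqrt (c (Suc (Suc n)))"
    proof (rule power2_le_imp_le)
      have "gap (q ^ Suc n) * c (Suc n) \<le> gap (q ^ n) * c (Suc (Suc n))"
        using y c_mono[of "Suc n"] c_nonneg[of "Suc n"] gap_mono[of "q ^ Suc n" "q ^ n"]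
          gap_lower[of "q ^ n"] x \<theta>_pos
        by (intro mult_mono) (auto simp: x_def intro: order_trans[OF _ gap_lower])
      then have "(leave (q ^ Suc n))\<^sup>2 * c (Suc n) \<le> (leave (q ^ n))\<^sup>2 * c (Suc (Suc n))"
        unfolding leave_sq by (simp add: algebra_simps)
      then show "(leave (q ^ Suc n) * sqrt (c (Suc n)))\<^sup>2 \<le> (leave (q ^ n) * sqrt (c (Suc (Suc n))))\<^sup>2"
        by (simp add: power_mult_distrib c_nonneg)
      show "0 \<le> leave (q ^ n) * sqrt (c (Suc (Suc n)))"
        using leave_pos[of n] c_nonneg by simp
    qed
    then have "leave (q ^ Suc n) * sqrt (c (Suc n)) / 8 \<le> leave (q ^ n) * sqrt (c (Suc (Suc n))) / 8"
      by (rule divide_right_mono) simp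
    moreover have "(1 - d k) * e j = leave (q ^ k) * sqrt (c j) / 8" for k j
    proof -
      have "1 - d k = leave (q ^ k) / 2" by (simp add: d_def leave_def field_simps)
      then show ?thesis by (simp only: e_def)
    qed
    ultimately show ?thesis by (simp only:)
  qed
  show "e n * e (Suc (Suc n)) \<le> (e (Suc n))\<^sup>2" for n
  proof -
    have "sqrt (c n * c (Suc (Suc n))) \<le> sqrt ((c (Suc n))\<^sup>2)"
      by (rule real_sqrt_le_mono) (rule c_logconcave)
    then have "sqrt (c n) * sqrt (c (Suc (Suc n))) \<le> c (Suc n)"
      using c_nonneg[of "Suc n"] by (simp add: real_sqrt_mult)
    then show ?thesis by (simp add: e_def power_divide c_nonneg)
  qed
  show "0 < \<rho>" using sx by (simp add: \<rho>_def)
  show "e n + d n \<le> 1 - \<rho>" for n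
  proof -
    have "sqrt (c n) \<le> sqrt (c (Suc n))" using c_mono[of n] by simp
    moreover have "sqrt (c (Suc n)) \<le> leave (q ^ n)"
    proof -
      have "0 \<le> \<theta> * q ^ n / 8" using \<theta>_pos x_pos[of n] by simp
      then show ?thesis using sqrt_c_le[of n] by linarith
    qed
    ultimately have "sqrt (c n) \<le> leave (q ^ n)" by linarith
    then have "e n \<le> leave (q ^ n) / 4" by (simp add: e_def)
    moreover have "(u + v) * q ^ n \<le> max (u + v) 0"
    proof -
      have "(u + v) * q ^ n \<le> max (u + v) 0 * q ^ n" using x_pos[of n] by (intro mult_right_mono) auto
      also have "\<dots> \<le> max (u + v) 0 * 1" using x_le[of n] by (intro mult_left_mono) auto
      finally show ?thesis by simp
    qed
    ultimately show ?thesis by (simp add: d_def leave_def \<rho>_def field_simps)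
  qed
  have m0: "0 < 1 - \<bar>u * v\<bar>" using uv_less by simp
  show "1 \<le> C\<^sub>0" using m0 by (simp add: C\<^sub>0_def)
  have L': "1 \<le> 1 / (1 - q)" using q_pos q_less by simp
  show "1 \<le> L" using L(1) L' by linarith
  show "real k \<le> C\<^sub>0 * real (k + L) * (e k)\<^sup>2" if k1: "1 \<le> k" for k
  proof -
    obtain j where k: "k = Suc j" using k1 by (cases k) auto
    have "(1 - (1 - q)) ^ k * (1 + real k * (1 - q)) \<le> 1" using q_pos q_less by (intro power_one_minus_le) auto
    then have "real k * (1 - q) \<le> (1 + real k * (1 - q)) * (1 - q ^ k)" by (simp add: algebra_simps)
    also have "1 + real k * (1 - q) \<le> real (k + L) * (1 - q)"
      using L(1) q_less by (simp add: field_simps)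
    then have "(1 + real k * (1 - q)) * (1 - q ^ k) \<le> real (k + L) * (1 - q) * (1 - q ^ k)"
      using x_le[of k] by (intro mult_right_mono) auto
    finally have "(1 - q) * real k \<le> (1 - q) * (real (k + L) * (1 - q ^ k))" by (simp add: mult_ac)
    then have 1: "real k \<le> real (k + L) * (1 - q ^ k)" using q_less by simp
    have "(1 - q ^ k) * (1 - \<bar>u * v\<bar>) \<le> c k"
      unfolding k c_Suc using uv_x_le[of j] x_le[of "Suc j"] m0 by (intro mult_mono) auto
    then have "(1 - q ^ k) \<le> c k / (1 - \<bar>u * v\<bar>)" using m0 by (simp add: field_simps)
    then have "real (k + L) * (1 - q ^ k) \<le> real (k + L) * (c k / (1 - \<bar>u * v\<bar>))"
      by (intro mult_left_mono) auto
    also have "\<dots> = C\<^sub>0 * real (k + L) * (e k)\<^sup>2"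
    proof -
      have "(e k)\<^sup>2 = c k / 16" by (simp add: e_def power_divide c_nonneg)
      moreover have "X * (y / m) = 16 / m * X * (y / 16)" for X y m :: real by simp
      ultimately show ?thesis unfolding C\<^sub>0_def by metis
    qed
    finally show ?thesis using 1 by linarith
  qed
  have small: "q ^ (L + j) \<le> 1 / (12 * (real (j + 1) * real (j + 2)))" for j
  proof -
    have "q ^ (L + j) * (real (j + 1) * real (j + 2)) = q ^ L * (q ^ j * (real (j + 1) * real (j + 2)))"
      by (simp add: power_add)
    also have "\<dots> \<le> (1 - q)\<^sup>2 / 96 * (8 / (1 - q)\<^sup>2)"
      using L(2) geometric_decay[of j] x_pos[of j] by (intro mult_mono) auto
    also have "\<dots> = 1 / 12" using q_less by simp
    finally have *: "q ^ (L + j) * (real (j + 1) * real (j + 2)) \<le> 1 / 12" .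
    have "0 < real (j + 1) * real (j + 2)" by (simp add: add_pos_pos)
    moreover have "x \<le> 1 / (12 * y)" if "x * y \<le> 1 / 12" "0 < y" for x y :: real
      using that by (simp add: field_simps)
    ultimately show ?thesis using * by blast
  qed
  show "1 / 4 - 1 / (16 * real (j + 1) * real (j + 2)) \<le> e (L + j)" for j
  proof -
    define k where "k = L + j"
    have "c k \<le> sqrt (c k)"
      using c_le[of k] c_nonneg[of k] real_le_rsqrt[of "c k" "c k"]
      by (simp add: power2_eq_square mult_left_le)
    then have "1 / 4 - q ^ k / 2 \<le> e k" using c_lower[of k] by (simp add: e_def)
    moreover have "q ^ k / 2 \<le> 1 / (12 * (real (j + 1) * real (j + 2))) / 2"
      unfolding k_def using small[of j] by (intro divide_right_mono) auto
    moreover have "1 / (12 * (real (j + 1) * real (j + 2))) / 2 \<le> 1 / (16 * (real (j + 1) * real (j + 2)))"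
    proof -
      have weaken: "1 / (12 * X) / 2 \<le> 1 / (16 * X)" if "0 < X" for X :: real using that by (simp add: field_simps)
      show ?thesis by (rule weaken) (simp add: add_pos_pos)
    qed
    ultimately show ?thesis unfolding k_def mult.assoc by linarith
  qed
  show "1 / 2 - 1 / (16 * real (j + 1) * real (j + 2)) \<le> d (L + j)" for j
  proof -
    define k where "k = L + j"
    have "-2 * q ^ k \<le> (u + v) * q ^ k" using sx x_pos[of k] by (intro mult_right_mono) auto
    then have "1 / 2 - q ^ k / 2 \<le> d k" by (simp add: d_def)
    moreover have "q ^ k / 2 \<le> 1 / (12 * (real (j + 1) * real (j + 2))) / 2"
      unfolding k_def using small[of j] by (intro divide_right_mono) auto
    moreover have "1 / (12 * (real (j + 1) * real (j + 2))) / 2 \<le> 1 / (16 * (real (j + 1) * real (j + 2)))"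
    proof -
      have weaken: "1 / (12 * X) / 2 \<le> 1 / (16 * X)" if "0 < X" for X :: real using that by (simp add: field_simps)
      show ?thesis by (rule weaken) (simp add: add_pos_pos)
    qed
    ultimately show ?thesis unfolding k_def mult.assoc by linarith
  qed
qed

lemma asep_word_walk:
  assumes "1 / (1 - q) \<le> real L" "q ^ L \<le> (1 - q)\<^sup>2 / 96"
  shows "word_walk e d \<rho> C\<^sub>0 L (A t) (24 / \<theta>)"
proof -
  interpret killed_walk e d \<rho> C\<^sub>0 L by (rule asep_killed_walk[OF assms])
  have T1: "1 - T (\<lambda>_. 1) n = 1 - (e n + d n + e (Suc n))" for n by (simp add: T_def)
  have one: "\<bar>op up y (\<lambda>_. 1) n / 2 - 1\<bar> \<le> 24 / \<theta> * (1 - T (\<lambda>_. 1) n)" if "-1 < y" "y < 1" for up y n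
  proof -
    have "3 / 2 * q ^ n = 24 / \<theta> * (\<theta> / 16 * q ^ n)" using \<theta>_pos by simp
    also have "\<dots> \<le> 24 / \<theta> * (1 - T (\<lambda>_. 1) n)"
      unfolding T1 using killing[of n] \<theta>_pos by (intro mult_left_mono) auto
    finally show ?thesis using op_one[OF that, of up n] by linarith
  qed
  have eta: "A t b = (\<lambda>\<phi> n. op (b = t) (if b then v else u) \<phi> n / 2)" for b
    by (simp add: fun_eq_iff A_def)
  show ?thesis
  proof
    show "poslin (A t b)" for b unfolding eta using u v by (intro poslin_op) auto
    show "A t True \<phi> n + A t False \<phi> n = 2 * T \<phi> n" for \<phi> n
      by (simp add: A_def op_def T_def e_def d_def field_simps)
    show "\<bar>A t b (\<lambda>_. 1) n - 1\<bar> \<le> 24 / \<theta> * (1 - T (\<lambda>_. 1) n)" for b n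
      unfolding eta using u v by (intro one) auto
    show "0 \<le> 24 / \<theta>" using \<theta>_pos by simp
  qed
qed

text \<open>
  The product of the matrices along a word, the first letter being the outermost factor.
\<close>

primrec word_op :: "bool \<Rightarrow> bool list \<Rightarrow> (nat \<Rightarrow> real) \<Rightarrow> nat \<Rightarrow> real" where
  "word_op t [] \<phi> = \<phi>"
| "word_op t (b # xs) \<phi> = op (b = t) (if b then v else u) (word_op t xs \<phi>)"

lemma word_op_append: "word_op t (xs @ ys) \<phi> = word_op t xs (word_op t ys \<phi>)"
  by (induction xs) auto

definition vac :: "nat \<Rightarrow> real" where "vac n = (if n = 0 then 1 else 0)"

definition weight :: "bool list \<Rightarrow> real" where "weight xs = word_op True xs vac 0"

lemma op_adjoint:
  assumes "\<And>n. M \<le> n \<Longrightarrow> \<psi> n = 0"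
  shows "(\<Sum>n\<le>M. \<phi> n * op up y \<psi> n) = (\<Sum>n\<le>M. op (\<not> up) y \<phi> n * \<psi> n)"
proof -
  have "(\<Sum>n\<le>N. \<phi> n * op True y \<psi> n) = (\<Sum>n\<le>N. op False y \<phi> n * \<psi> n) + sqrt (c (Suc N)) * \<phi> N * \<psi> (Suc N)"
    for N \<phi> \<psi> by (induction N) (simp_all add: op_def c_0 algebra_simps)
  from this[where \<phi> = \<phi> and \<psi> = \<psi> and N = M] this[where \<phi> = \<psi> and \<psi> = \<phi> and N = M] show ?thesis
    using assms[of M] assms[of "Suc M"] by (cases up) (simp_all add: mult.commute)
qed

lemma word_op_support: "(\<And>n. k < n \<Longrightarrow> \<phi> n = 0) \<Longrightarrow> k + length xs < n \<Longrightarrow> word_op t xs \<phi> n = 0"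
  by (induction xs arbitrary: n) (auto simp: op_def)

lemma word_op_adjoint:
  assumes "\<And>n. k < n \<Longrightarrow> \<psi> n = 0" "k + length xs \<le> M"
  shows "(\<Sum>n\<le>M. \<phi> n * word_op t xs \<psi> n) = (\<Sum>n\<le>M. word_op (\<not> t) (rev xs) \<phi> n * \<psi> n)"
  using assms(2)
proof (induction xs arbitrary: \<phi>)
  case Nil
  show ?case by simp
next
  case (Cons b xs)
  have "(\<Sum>n\<le>M. \<phi> n * word_op t (b # xs) \<psi> n)
      = (\<Sum>n\<le>M. op (\<not> (b = t)) (if b then v else u) \<phi> n * word_op t xs \<psi> n)"
    using Cons.prems by (simp only: word_op.simps, intro op_adjoint word_op_support[of k] assms(1)) auto
  also have "\<dots> = (\<Sum>n\<le>M. word_op (\<not> t) (rev xs) (op (\<not> (b = t)) (if b then v else u) \<phi>) n * \<psi> n)"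
    using Cons by simp
  also have "(\<not> (b = t)) = (b = (\<not> t))" by auto
  finally show ?case by (simp add: word_op_append)
qed

text \<open>
  Transposing the product reverses the word.
\<close>

lemma weight_rev: "word_op False (rev xs) vac 0 = weight xs"
proof -
  have *: "(\<Sum>n\<le>M. vac n * \<phi> n) = \<phi> 0" "(\<Sum>n\<le>M. \<phi> n * vac n) = \<phi> 0" for \<phi> M
  proof -
    have "(\<Sum>n\<le>M. vac n * \<phi> n) = (\<Sum>n\<le>M. if n = 0 then \<phi> 0 else 0)"
      by (intro sum.cong) (auto simp: vac_def)
    then show "(\<Sum>n\<le>M. vac n * \<phi> n) = \<phi> 0" by simp
    then show "(\<Sum>n\<le>M. \<phi> n * vac n) = \<phi> 0" by (simp only: mult.commute)
  qed
  show ?thesis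
    using word_op_adjoint[of 0 vac xs "length xs" vac True] unfolding weight_def * by (simp add: vac_def)
qed

definition block_weight :: "nat \<Rightarrow> nat \<Rightarrow> bool list \<Rightarrow> real" where
  "block_weight i r xs = (\<Sum>pre\<in>words i. \<Sum>suf\<in>words r. weight (pre @ xs @ suf))"

definition total_weight :: "nat \<Rightarrow> real" where
  "total_weight n = (\<Sum>xs\<in>words n. weight xs)"

lemma sum_words_rev: "(\<Sum>xs\<in>words n. g (rev xs)) = (\<Sum>xs\<in>words n. g xs)"
  by (rule sum.reindex_bij_witness[of _ rev rev]) (auto simp: words_def)

text \<open>
  If the block is closer to the right end, the weights are rewritten with the transposed matrices and the
  words are read backwards.
\<close>

lemma block_near_uniform:
  assumes L: "1 / (1 - q) \<le> real L" "q ^ L \<le> (1 - q)\<^sup>2 / 96"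
    and k: "64 * killed_walk.C\<^sub>1 \<rho> C\<^sub>0 * (real L)\<^sup>2 \<le> real k" "k = min i r" and m: "1 \<le> m" "m \<le> k"
  shows "(\<Sum>xs\<in>words m. \<bar>block_weight i r xs / total_weight (i + m + r) - 1 / 2 ^ m\<bar>)
    \<le> 2 * word_walk.K\<^sub>2 \<rho> C\<^sub>0 (24 / \<theta>) * (root 4 (real m / real k) + real L / sqrt (real k))"
proof -
  have main: "(\<Sum>xs\<in>words m. \<bar>(\<Sum>pre\<in>words i. \<Sum>suf\<in>words r. word_op t (pre @ xs @ suf) vac 0)
        / (\<Sum>xs\<in>words (i + m + r). word_op t xs vac 0) - 1 / 2 ^ m\<bar>)
    \<le> 2 * word_walk.K\<^sub>2 \<rho> C\<^sub>0 (24 / \<theta>) * (root 4 (real m / real i) + real L / sqrt (real i))"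
    if ir: "i \<le> r" "64 * killed_walk.C\<^sub>1 \<rho> C\<^sub>0 * (real L)\<^sup>2 \<le> real i" "m \<le> i" for t i r
  proof -
    interpret word_walk e d \<rho> C\<^sub>0 L "A t" "24 / \<theta>" by (rule asep_word_walk[OF L])
    have op_scale: "op up y (\<lambda>n. \<phi> n / x) n = op up y \<phi> n / x" for up y x \<phi> n
      by (simp add: op_def add_divide_distrib)
    have W: "W xs \<phi> = (\<lambda>n. (1 / 2 ^ length xs) * word_op t xs \<phi> n)" for xs \<phi>
    proof (induction xs)
      case Nil
      show ?case by simp
    next
      case (Cons b xs)
      show ?case unfolding W.simps Cons by (rule ext) (simp add: A_def op_scale)
    qed
    have f0: "f 0 = vac" by (simp add: fun_eq_iff vac_def)
    have Z: "(\<Sum>xs\<in>words (i + m + r). word_op t xs vac 0) = 2 ^ (i + m + r) * (2 ^ (i + m + r) * z (i + m + r))"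
    proof -
      have "(\<Sum>xs\<in>words (i + m + r). W xs vac 0) = (1 / 2 ^ (i + m + r)) * (\<Sum>xs\<in>words (i + m + r). word_op t xs vac 0)"
        unfolding sum_distrib_left by (intro sum.cong) (auto simp: W words_def)
      then show ?thesis using sum_W_f[of "i + m + r"] unfolding f0 by simp
    qed
    have block_sum: "(\<Sum>pre\<in>words i. \<Sum>suf\<in>words r. word_op t (pre @ xs @ suf) vac 0) = 2 ^ (i + m + r) * block_sum i r xs"
      if "xs \<in> words m" for xs
    proof -
      have "block_sum i r xs = (1 / 2 ^ (i + m + r)) * (\<Sum>pre\<in>words i. \<Sum>suf\<in>words r. word_op t (pre @ xs @ suf) vac 0)"
        unfolding block_sum_def f0 sum_distrib_left using that
        by (intro sum.cong) (auto simp: W words_def add.assoc)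
      then show ?thesis by simp
    qed
    have "(\<Sum>xs\<in>words m. \<bar>(\<Sum>pre\<in>words i. \<Sum>suf\<in>words r. word_op t (pre @ xs @ suf) vac 0)
        / (\<Sum>xs\<in>words (i + m + r). word_op t xs vac 0) - 1 / 2 ^ m\<bar>)
      = (\<Sum>xs\<in>words m. \<bar>block_sum i r xs / (2 ^ (i + m + r) * z (i + m + r)) - 1 / 2 ^ m\<bar>)"
      unfolding Z by (intro sum.cong) (simp_all add: block_sum)
    also have "\<dots> \<le> 2 * K\<^sub>2 * (root 4 (real m / real i) + real L / sqrt (real i))"
      using ir m by (intro block_sum_near_uniform) simp_all
    finally show ?thesis .
  qed
  show ?thesis
  proof (cases "i \<le> r")
    case True
    then show ?thesis using main[of i r True] k m by (simp add: block_weight_def total_weight_def weight_def)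
  next
    case False
    have T: "total_weight (i + m + r) = (\<Sum>xs\<in>words (r + m + i). word_op False xs vac 0)"
      unfolding total_weight_def weight_rev[symmetric]
      using sum_words_rev[of "\<lambda>xs. word_op False xs vac 0"] by (simp add: add.commute add.left_commute)
    have B: "block_weight i r (rev xs) = (\<Sum>pre\<in>words r. \<Sum>suf\<in>words i. word_op False (pre @ xs @ suf) vac 0)" for xs
    proof -
      have "block_weight i r (rev xs) = (\<Sum>pre\<in>words i. \<Sum>suf\<in>words r. word_op False (rev suf @ xs @ rev pre) vac 0)"
        unfolding block_weight_def weight_rev[symmetric] by simp
      also have "\<dots> = (\<Sum>suf\<in>words r. \<Sum>pre\<in>words i. word_op False (rev suf @ xs @ rev pre) vac 0)"
        by (rule sum.swap)
      also have "\<dots> = (\<Sum>suf\<in>words r. \<Sum>pre\<in>words i. word_op False (rev suf @ xs @ pre) vac 0)"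
        by (intro sum.cong refl sum_words_rev)
      also have "\<dots> = (\<Sum>suf\<in>words r. \<Sum>pre\<in>words i. word_op False (suf @ xs @ pre) vac 0)"
        by (rule sum_words_rev)
      finally show ?thesis .
    qed
    have "(\<Sum>xs\<in>words m. \<bar>block_weight i r xs / total_weight (i + m + r) - 1 / 2 ^ m\<bar>)
        = (\<Sum>xs\<in>words m. \<bar>block_weight i r (rev xs) / total_weight (i + m + r) - 1 / 2 ^ m\<bar>)"
      by (rule sum_words_rev[symmetric])
    then show ?thesis using main[of r i False] k m False unfolding B T by simp
  qed
qed

end

section \<open>The stationary measure as a matrix product\<close>

lemma configs_iff: "\<eta> \<in> configs I \<longleftrightarrow> (\<forall>x. x \<notin> I \<longrightarrow> \<not> \<eta> x)"
  by (auto simp: configs_def PiE_dflt_def)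

lemma finite_configs [simp]: "finite I \<Longrightarrow> finite (configs I)"
  unfolding configs_def by (intro finite_PiE_dflt) auto

context asep_params
begin

lemma op_add: "op up y (\<lambda>n. \<phi> n + \<psi> n) n = op up y \<phi> n + op up y \<psi> n"
  by (simp add: op_def algebra_simps)

lemma op_scale: "op up y (\<lambda>n. x * \<phi> n) n = x * op up y \<phi> n"
  by (simp add: op_def algebra_simps)

lemma word_op_add: "word_op t xs (\<lambda>n. \<phi> n + \<psi> n) n = word_op t xs \<phi> n + word_op t xs \<psi> n"
proof (induction xs arbitrary: n)
  case (Cons b xs)
  then have "word_op t xs (\<lambda>n. \<phi> n + \<psi> n) = (\<lambda>n. word_op t xs \<phi> n + word_op t xs \<psi> n)" by (rule ext)
  then show ?case by (simp add: op_add)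
qed simp

lemma word_op_scale: "word_op t xs (\<lambda>n. x * \<phi> n) n = x * word_op t xs \<phi> n"
proof (induction xs arbitrary: n)
  case (Cons b xs)
  then have "word_op t xs (\<lambda>n. x * \<phi> n) = (\<lambda>n. x * word_op t xs \<phi> n)" by (rule ext)
  then show ?case by (simp add: op_scale)
qed simp

lemma c_rec: "c (Suc n) = q * c n + (1 - q) * (1 - u * v * (q ^ n)\<^sup>2)"
  using q_pos unfolding c_Suc by (simp add: c_def field_simps power2_eq_square)

text \<open>
  The diagonal part reduces to the recurrence \<open>c (n+1) = q c n + (1 - q) (1 - u v q^(2n))\<close>.
\<close>

lemma quadratic_relation:
  "op True v (op False u \<phi>) n - q * op False u (op True v \<phi>) n = (1 - q) * (op True v \<phi> n + op False u \<phi> n)"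
proof -
  have s: "sqrt (c k) * sqrt (c k) = c k" for k using c_nonneg[of k] by simp
  show ?thesis
  proof (cases n)
    case 0
    have "op True v (op False u \<phi>) n - q * op False u (op True v \<phi>) n
       - (1 - q) * (op True v \<phi> n + op False u \<phi> n)
      = \<phi> n * ((sqrt (c (Suc 0)) * sqrt (c (Suc 0))) - (1 - q) * (1 - u * v))"
      unfolding 0 by (simp add: op_def c_0 algebra_simps del: real_sqrt_mult_self)
    also have "\<dots> = 0" unfolding s by (simp add: c_rec c_0)
    finally show ?thesis by simp
  next
    case (Suc m)
    have "op True v (op False u \<phi>) n - q * op False u (op True v \<phi>) n
       - (1 - q) * (op True v \<phi> n + op False u \<phi> n)
      = \<phi> n * ((sqrt (c (Suc n)) * sqrt (c (Suc n))) - q * (sqrt (c n) * sqrt (c n))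
           - (1 - q) * (1 - u * v * (q ^ n)\<^sup>2))"
      unfolding Suc by (simp add: op_def algebra_simps power2_eq_square)
    also have "\<dots> = 0" unfolding s by (simp add: c_rec)
    finally show ?thesis by simp
  qed
qed

lemma weight_exchange:
  "weight (pre @ True # False # suf) - q * weight (pre @ False # True # suf)
    = (1 - q) * (weight (pre @ True # suf) + weight (pre @ False # suf))"
proof -
  define \<phi> where "\<phi> = word_op True suf vac"
  have rel: "op True v (op False u \<phi>) = (\<lambda>n. q * op False u (op True v \<phi>) n
      + (1 - q) * (op True v \<phi> n + op False u \<phi> n))"
    using quadratic_relation[of \<phi>] by (intro ext) (simp add: algebra_simps)
  have "weight (pre @ True # False # suf) = word_op True pre (op True v (op False u \<phi>)) 0"
    by (simp add: weight_def word_op_append \<phi>_def)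
  also have "\<dots> = q * word_op True pre (op False u (op True v \<phi>)) 0
     + (1 - q) * (word_op True pre (op True v \<phi>) 0 + word_op True pre (op False u \<phi>) 0)"
    unfolding rel by (simp only: word_op_add word_op_scale)
  also have "\<dots> = q * weight (pre @ False # True # suf)
      + (1 - q) * (weight (pre @ True # suf) + weight (pre @ False # suf))"
    by (simp add: weight_def word_op_append \<phi>_def)
  finally show ?thesis by simp
qed

lemma weight_first: "weight (False # xs) = (1 + u) * weight xs"
  by (simp add: weight_def op_def c_0)

lemma weight_last: "weight (xs @ [True]) = (1 + v) * weight xs"
proof -
  have "op True v vac = (\<lambda>n. (1 + v) * vac n)" by (auto simp: op_def vac_def fun_eq_iff)
  then show ?thesis by (simp add: weight_def word_op_append word_op_scale)
qed

lemma weight_pos: "0 < weight xs"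
proof -
  have "(\<forall>n. 0 \<le> word_op True xs vac n) \<and> 0 < word_op True xs vac 0"
  proof (induction xs)
    case Nil
    show ?case by (simp add: vac_def)
  next
    case (Cons b xs)
    define y \<phi> where "y = (if b then v else u)" and "\<phi> = word_op True xs vac"
    have y: "0 < 1 + y * q ^ n" for n using u v by (intro one_plus_pos) (simp add: y_def)
    have \<phi>: "0 \<le> \<phi> n" "0 < \<phi> 0" for n using Cons by (auto simp: \<phi>_def)
    have "0 \<le> op up y \<phi> n" for up n
    proof -
      have "0 \<le> (1 + y * q ^ n) * \<phi> n" using y[of n] \<phi> by (intro mult_nonneg_nonneg) auto
      moreover have "0 \<le> (if up then sqrt (c (Suc n)) * \<phi> (Suc n) else sqrt (c n) * \<phi> (n - 1))"
        using \<phi> c_nonneg by simp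
      ultimately show ?thesis unfolding op_def by linarith
    qed
    moreover have "0 < op up y \<phi> 0" for up
    proof -
      have "0 < (1 + y * q ^ 0) * \<phi> 0" using y[of 0] \<phi> by (intro mult_pos_pos)
      moreover have "0 \<le> (if up then sqrt (c (Suc 0)) * \<phi> (Suc 0) else sqrt (c 0) * \<phi> (0 - 1))"
        using \<phi> c_nonneg by simp
      ultimately show ?thesis unfolding op_def by linarith
    qed
    ultimately show ?case by (simp add: y_def \<phi>_def)
  qed
  then show ?thesis by (simp add: weight_def)
qed

end

locale open_asep = asep_params +
  fixes N :: nat
  assumes N: "1 \<le> N"
begin

definition wt :: "(nat \<Rightarrow> bool) \<Rightarrow> real" where "wt \<eta> = weight (map \<eta> [1..<Suc N])"

text \<open>
  The weight of the configuration on \<open>N - 1\<close> sites obtained by deleting the site \<open>x\<close>. The signs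
  \<open>hat_sign\<close> are the auxiliary scalars of the matrix ansatz: they turn the local exchange relation into a
  difference of neighbouring terms.
\<close>

definition weight_without :: "nat \<Rightarrow> (nat \<Rightarrow> bool) \<Rightarrow> real" where
  "weight_without x \<eta> = weight (map \<eta> [1..<x] @ map \<eta> [Suc x..<Suc N])"

definition hat_sign :: "bool \<Rightarrow> real" where "hat_sign b = (if b then -1 else 1)"

definition rate :: "nat \<Rightarrow> (nat \<Rightarrow> bool) \<Rightarrow> real" where
  "rate x \<eta> = of_bool (\<eta> x) * (1 - of_bool (\<eta> (x+1))) + q * of_bool (\<eta> (x+1)) * (1 - of_bool (\<eta> x))"

abbreviation gen :: "((nat \<Rightarrow> bool) \<Rightarrow> real) \<Rightarrow> (nat \<Rightarrow> bool) \<Rightarrow> real" where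
  "gen \<equiv> open_asep_generator N q ((1 - q) / (1 + u)) ((1 - q) / (1 + v))"

lemma swap_swap [simp]: "swap_sites (swap_sites \<eta> x y) x y = \<eta>"
  by (auto simp: swap_sites_def fun_eq_iff)

lemma flip_flip [simp]: "flip_site (flip_site \<eta> x) x = \<eta>"
  by (auto simp: flip_site_def fun_eq_iff)

lemma swap_configs: "\<eta> \<in> configs {1..N} \<Longrightarrow> x \<in> {1..N} \<Longrightarrow> y \<in> {1..N} \<Longrightarrow> swap_sites \<eta> x y \<in> configs {1..N}"
  by (auto simp: configs_iff swap_sites_def)

lemma flip_configs: "\<eta> \<in> configs {1..N} \<Longrightarrow> x \<in> {1..N} \<Longrightarrow> flip_site \<eta> x \<in> configs {1..N}"
  by (auto simp: configs_iff flip_site_def)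

text \<open>
  The net probability flow into \<open>\<eta>\<close> across a bond is a discrete derivative in the bond, so summation over
  the bonds leaves two boundary terms, which the reservoirs cancel.
\<close>

lemma bond_balance:
  assumes x: "1 \<le> x" "x < N"
  shows "wt (swap_sites \<eta> x (x+1)) * rate x (swap_sites \<eta> x (x+1)) - wt \<eta> * rate x \<eta>
    = (1 - q) * (hat_sign (\<eta> x) * weight_without x \<eta> - hat_sign (\<eta> (Suc x)) * weight_without (Suc x) \<eta>)"
proof -
  define pre suf where "pre = map \<eta> [1..<x]" and "suf = map \<eta> [Suc (Suc x)..<Suc N]"
  have split: "[1..<Suc N] = [1..<x] @ x # Suc x # [Suc (Suc x)..<Suc N]"
  proof -
    have "[1..<Suc N] = [1..<x] @ [x..<Suc N]" using x upt_add_eq_append[of 1 x "Suc N - x"] by simp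
    also have "[x..<Suc N] = x # Suc x # [Suc (Suc x)..<Suc N]" using x by (simp add: upt_conv_Cons)
    finally show ?thesis .
  qed
  have w1: "wt \<eta> = weight (pre @ \<eta> x # \<eta> (Suc x) # suf)"
    unfolding wt_def split by (simp add: pre_def suf_def)
  have "map (swap_sites \<eta> x (x+1)) [1..<x] = pre"
    by (auto simp: pre_def swap_sites_def)
  moreover have "map (swap_sites \<eta> x (x+1)) [Suc (Suc x)..<Suc N] = suf"
    by (auto simp: suf_def swap_sites_def simp del: upt_Suc)
  moreover have "swap_sites \<eta> x (x+1) x = \<eta> (Suc x)" "swap_sites \<eta> x (x+1) (Suc x) = \<eta> x"
    by (simp_all add: swap_sites_def)
  ultimately have w2: "wt (swap_sites \<eta> x (x+1)) = weight (pre @ \<eta> (Suc x) # \<eta> x # suf)"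
    unfolding wt_def split map_append list.map by (simp only:)
  have d1: "weight_without x \<eta> = weight (pre @ \<eta> (Suc x) # suf)"
  proof -
    have "[Suc x..<Suc N] = Suc x # [Suc (Suc x)..<Suc N]" using x by (intro upt_conv_Cons) simp
    then show ?thesis by (simp only: weight_without_def pre_def suf_def list.map)
  qed
  have d2: "weight_without (Suc x) \<eta> = weight (pre @ \<eta> x # suf)"
    unfolding weight_without_def using x by (simp add: pre_def suf_def)
  have sw: "swap_sites \<eta> x (Suc x) x = \<eta> (Suc x)" "swap_sites \<eta> x (Suc x) (Suc x) = \<eta> x"
    by (simp_all add: swap_sites_def)
  show ?thesis
    unfolding w1 w2 d1 d2 rate_def using weight_exchange[of pre suf]
    by (cases "\<eta> x"; cases "\<eta> (Suc x)") (simp_all add: sw hat_sign_def, simp_all add: algebra_simps)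
qed

lemma wt_first: "wt \<eta> = weight (\<eta> 1 # map \<eta> [Suc 1..<Suc N])"
proof -
  have "[1..<Suc N] = 1 # [Suc 1..<Suc N]" using N by (intro upt_conv_Cons) simp
  then show ?thesis by (simp only: wt_def list.map)
qed

lemma wt_last: "wt \<eta> = weight (map \<eta> [1..<N] @ [\<eta> N])"
  using N by (simp add: wt_def)

lemma left_balance:
  "wt (flip_site \<eta> 1) * ((1 - q) / (1 + u) * (1 - of_bool (flip_site \<eta> 1 1)))
    - wt \<eta> * ((1 - q) / (1 + u) * (1 - of_bool (\<eta> 1))) = - ((1 - q) * (hat_sign (\<eta> 1) * weight_without 1 \<eta>))"
proof -
  have d: "weight_without 1 \<eta> = weight (map \<eta> [Suc 1..<Suc N])" by (simp add: weight_without_def)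
  have m: "map (flip_site \<eta> 1) [Suc 1..<Suc N] = map \<eta> [Suc 1..<Suc N]"
    by (auto simp: flip_site_def simp del: upt_Suc)
  have "wt \<eta> = (1 + u) * weight_without 1 \<eta>" if "\<not> \<eta> 1"
    unfolding wt_first d using that by (simp add: weight_first)
  moreover have "wt (flip_site \<eta> 1) = (1 + u) * weight_without 1 \<eta>" if "\<eta> 1"
    unfolding wt_first m d using that by (simp add: weight_first flip_site_def)
  ultimately show ?thesis using u by (cases "\<eta> 1") (auto simp: hat_sign_def flip_site_def)
qed

lemma right_balance:
  "wt (flip_site \<eta> N) * ((1 - q) / (1 + v) * of_bool (flip_site \<eta> N N))
    - wt \<eta> * ((1 - q) / (1 + v) * of_bool (\<eta> N)) = (1 - q) * (hat_sign (\<eta> N) * weight_without N \<eta>)"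
proof -
  have d: "weight_without N \<eta> = weight (map \<eta> [1..<N])" by (simp add: weight_without_def)
  have m: "map (flip_site \<eta> N) [1..<N] = map \<eta> [1..<N]" by (auto simp: flip_site_def)
  have "wt \<eta> = (1 + v) * weight_without N \<eta>" if "\<eta> N" using that by (simp add: wt_last weight_last d)
  moreover have "wt (flip_site \<eta> N) = (1 + v) * weight_without N \<eta>" if "\<not> \<eta> N"
    unfolding wt_last m d using that by (simp add: weight_last flip_site_def)
  ultimately show ?thesis using v by (cases "\<eta> N") (auto simp: hat_sign_def flip_site_def)
qed

lemma gen_eq: "gen f \<eta> = (\<Sum>x=1..N-1. rate x \<eta> * (f (swap_sites \<eta> x (x+1)) - f \<eta>))
     + (1 - q) / (1 + u) * (1 - of_bool (\<eta> 1)) * (f (flip_site \<eta> 1) - f \<eta>)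
     + (1 - q) / (1 + v) * of_bool (\<eta> N) * (f (flip_site \<eta> N) - f \<eta>)"
  by (simp add: open_asep_generator_def rate_def)

text \<open>
  Moves the dynamics from the test function to the measure, for a move that is its own inverse.
\<close>

lemma sum_involution:
  fixes g f r :: "'a \<Rightarrow> real"
  assumes "\<And>\<eta>. \<eta> \<in> S \<Longrightarrow> j \<eta> \<in> S" "\<And>\<eta>. j (j \<eta>) = \<eta>"
  shows "(\<Sum>\<eta>\<in>S. g \<eta> * (r \<eta> * (f (j \<eta>) - f \<eta>))) = (\<Sum>\<eta>\<in>S. f \<eta> * (g (j \<eta>) * r (j \<eta>) - g \<eta> * r \<eta>))"
proof -
  have "(\<Sum>\<eta>\<in>S. g \<eta> * r \<eta> * f (j \<eta>)) = (\<Sum>\<eta>\<in>S. g (j \<eta>) * r (j \<eta>) * f \<eta>)"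
    by (rule sum.reindex_bij_witness[of _ j j]) (auto simp: assms)
  then show ?thesis by (simp add: algebra_simps sum_subtractf)
qed

lemma matrix_product_stationary: "(\<Sum>\<eta>\<in>configs {1..N}. wt \<eta> * gen f \<eta>) = 0"
proof -
  define S where "S = configs {1..N}"
  have bulk: "(\<Sum>\<eta>\<in>S. wt \<eta> * (rate x \<eta> * (f (swap_sites \<eta> x (x+1)) - f \<eta>)))
      = (\<Sum>\<eta>\<in>S. f \<eta> * ((1 - q) * (hat_sign (\<eta> x) * weight_without x \<eta> - hat_sign (\<eta> (Suc x)) * weight_without (Suc x) \<eta>)))"
    if "x \<in> {1..N-1}" for x
  proof -
    have "(\<Sum>\<eta>\<in>S. wt \<eta> * (rate x \<eta> * (f (swap_sites \<eta> x (x+1)) - f \<eta>)))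
       = (\<Sum>\<eta>\<in>S. f \<eta> * (wt (swap_sites \<eta> x (x+1)) * rate x (swap_sites \<eta> x (x+1)) - wt \<eta> * rate x \<eta>))"
    proof (rule sum_involution)
      show "swap_sites \<eta> x (x+1) \<in> S" if "\<eta> \<in> S" for \<eta>
        using that \<open>x \<in> {1..N-1}\<close> unfolding S_def by (intro swap_configs) auto
    qed simp
    also have "\<dots> = (\<Sum>\<eta>\<in>S. f \<eta> * ((1 - q) * (hat_sign (\<eta> x) * weight_without x \<eta> - hat_sign (\<eta> (Suc x)) * weight_without (Suc x) \<eta>)))"
      using that N by (subst bond_balance) auto
    finally show ?thesis .
  qed
  have left: "(\<Sum>\<eta>\<in>S. wt \<eta> * (((1 - q) / (1 + u) * (1 - of_bool (\<eta> 1))) * (f (flip_site \<eta> 1) - f \<eta>)))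
     = (\<Sum>\<eta>\<in>S. f \<eta> * (- ((1 - q) * (hat_sign (\<eta> 1) * weight_without 1 \<eta>))))"
  proof -
    have "(\<Sum>\<eta>\<in>S. wt \<eta> * (((1 - q) / (1 + u) * (1 - of_bool (\<eta> 1))) * (f (flip_site \<eta> 1) - f \<eta>)))
       = (\<Sum>\<eta>\<in>S. f \<eta> * (wt (flip_site \<eta> 1) * ((1 - q) / (1 + u) * (1 - of_bool (flip_site \<eta> 1 1)))
    - wt \<eta> * ((1 - q) / (1 + u) * (1 - of_bool (\<eta> 1)))))"
    proof (rule sum_involution)
      show "flip_site \<eta> 1 \<in> S" if "\<eta> \<in> S" for \<eta>
        using that N unfolding S_def by (intro flip_configs) auto
    qed simp
    then show ?thesis unfolding left_balance .
  qed
  have right: "(\<Sum>\<eta>\<in>S. wt \<eta> * (((1 - q) / (1 + v) * of_bool (\<eta> N)) * (f (flip_site \<eta> N) - f \<eta>)))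
     = (\<Sum>\<eta>\<in>S. f \<eta> * ((1 - q) * (hat_sign (\<eta> N) * weight_without N \<eta>)))"
  proof -
    have "(\<Sum>\<eta>\<in>S. wt \<eta> * (((1 - q) / (1 + v) * of_bool (\<eta> N)) * (f (flip_site \<eta> N) - f \<eta>)))
       = (\<Sum>\<eta>\<in>S. f \<eta> * (wt (flip_site \<eta> N) * ((1 - q) / (1 + v) * of_bool (flip_site \<eta> N N))
    - wt \<eta> * ((1 - q) / (1 + v) * of_bool (\<eta> N))))"
    proof (rule sum_involution)
      show "flip_site \<eta> N \<in> S" if "\<eta> \<in> S" for \<eta>
        using that N unfolding S_def by (intro flip_configs) auto
    qed simp
    then show ?thesis unfolding right_balance .
  qed
  have tele: "(\<Sum>x=1..N-1. hat_sign (\<eta> x) * weight_without x \<eta> - hat_sign (\<eta> (Suc x)) * weight_without (Suc x) \<eta>)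
      = hat_sign (\<eta> 1) * weight_without 1 \<eta> - hat_sign (\<eta> N) * weight_without N \<eta>" for \<eta>
    using sum_Suc_diff[of 1 "N - 1" "\<lambda>x. - (hat_sign (\<eta> x) * weight_without x \<eta>)"] N by simp
  have "(\<Sum>\<eta>\<in>S. wt \<eta> * gen f \<eta>)
     = (\<Sum>x=1..N-1. \<Sum>\<eta>\<in>S. wt \<eta> * (rate x \<eta> * (f (swap_sites \<eta> x (x+1)) - f \<eta>)))
     + (\<Sum>\<eta>\<in>S. wt \<eta> * (((1 - q) / (1 + u) * (1 - of_bool (\<eta> 1))) * (f (flip_site \<eta> 1) - f \<eta>)))
     + (\<Sum>\<eta>\<in>S. wt \<eta> * (((1 - q) / (1 + v) * of_bool (\<eta> N)) * (f (flip_site \<eta> N) - f \<eta>)))"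
    unfolding gen_eq distrib_left sum.distrib sum_distrib_left
    by (subst sum.swap) (simp add: mult.assoc)
  also have "\<dots> = (\<Sum>x=1..N-1. \<Sum>\<eta>\<in>S. f \<eta> * ((1 - q) * (hat_sign (\<eta> x) * weight_without x \<eta> - hat_sign (\<eta> (Suc x)) * weight_without (Suc x) \<eta>)))
     + (\<Sum>\<eta>\<in>S. f \<eta> * (- ((1 - q) * (hat_sign (\<eta> 1) * weight_without 1 \<eta>))))
     + (\<Sum>\<eta>\<in>S. f \<eta> * ((1 - q) * (hat_sign (\<eta> N) * weight_without N \<eta>)))"
    unfolding left right using bulk by simp
  also have "(\<Sum>x=1..N-1. \<Sum>\<eta>\<in>S. f \<eta> * ((1 - q) * (hat_sign (\<eta> x) * weight_without x \<eta> - hat_sign (\<eta> (Suc x)) * weight_without (Suc x) \<eta>)))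
    = (\<Sum>\<eta>\<in>S. f \<eta> * ((1 - q) * (hat_sign (\<eta> 1) * weight_without 1 \<eta> - hat_sign (\<eta> N) * weight_without N \<eta>)))"
    by (subst sum.swap) (simp only: sum_distrib_left[symmetric] tele)
  finally show ?thesis unfolding S_def[symmetric] sum.distrib[symmetric] by (simp add: algebra_simps)
qed

text \<open>
  Irreducibility of the reversed dynamics. Since \<open>q > 0\<close> any neighbouring sites can be exchanged, so a
  particle at any site can be carried to the left end and removed there, and a new particle can be
  brought to any empty site from the right end.
\<close>

lemma closed_configs_eq_all:
  assumes Z: "Z \<subseteq> configs {1..N}" "\<eta>\<^sub>0 \<in> Z"
    and swap: "\<And>\<eta> x. \<eta> \<in> Z \<Longrightarrow> 1 \<le> x \<Longrightarrow> x < N \<Longrightarrow> swap_sites \<eta> x (x+1) \<in> Z"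
    and left: "\<And>\<eta>. \<eta> \<in> Z \<Longrightarrow> \<eta> 1 \<Longrightarrow> flip_site \<eta> 1 \<in> Z"
    and right: "\<And>\<eta>. \<eta> \<in> Z \<Longrightarrow> \<not> \<eta> N \<Longrightarrow> flip_site \<eta> N \<in> Z"
  shows "configs {1..N} \<subseteq> Z"
proof -
  have remove: "\<eta>(j := False) \<in> Z" if "1 \<le> j" "j \<le> N" "\<eta> \<in> Z" for j \<eta>
    using that
  proof (induction j arbitrary: \<eta> rule: nat_induct_at_least)
    case base
    have "flip_site \<eta> 1 = \<eta>(1 := False)" if "\<eta> 1" using that by (simp add: flip_site_def)
    moreover have "\<eta>(1 := False) = \<eta>" if "\<not> \<eta> 1" using that by (auto simp: fun_eq_iff)
    ultimately show ?case using left[of \<eta>] base by (cases "\<eta> 1") metis+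
  next
    case (Suc j)
    show ?case
    proof (cases "\<eta> j")
      case True
      have "\<eta>(j := False) \<in> Z" using Suc.prems by (intro Suc.IH) auto
      then have sw: "swap_sites (\<eta>(j := False)) j (j+1) \<in> Z" using Suc.prems Suc.hyps by (intro swap) auto
      show ?thesis
      proof (cases "\<eta> (Suc j)")
        case True
        then have "swap_sites (\<eta>(j := False)) j (j+1) = \<eta>(Suc j := False)"
          using \<open>\<eta> j\<close> by (auto simp: swap_sites_def fun_eq_iff)
        then show ?thesis using sw by (simp only:)
      next
        case False
        then show ?thesis using Suc.prems by (simp add: fun_upd_idem)
      qed
    next
      case False
      have "swap_sites \<eta> j (j+1) \<in> Z" using Suc.prems Suc.hyps by (intro swap) auto
      then have "(swap_sites \<eta> j (j+1))(j := False) \<in> Z" using Suc.prems by (intro Suc.IH) auto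
      also have "(swap_sites \<eta> j (j+1))(j := False) = \<eta>(Suc j := False)"
        using False by (auto simp: swap_sites_def fun_eq_iff)
      finally show ?thesis .
    qed
  qed
  have add: "\<eta>(j := True) \<in> Z" if "j \<le> N" "1 \<le> j" "\<eta> \<in> Z" for j \<eta>
    using that
  proof (induction j arbitrary: \<eta> rule: inc_induct)
    case base
    have "flip_site \<eta> N = \<eta>(N := True)" if "\<not> \<eta> N" using that by (simp add: flip_site_def)
    moreover have "\<eta>(N := True) = \<eta>" if "\<eta> N" using that by (auto simp: fun_eq_iff)
    ultimately show ?case using right[of \<eta>] base by (cases "\<eta> N") metis+
  next
    case (step j)
    show ?case
    proof (cases "\<eta> (Suc j)")
      case True
      have "swap_sites \<eta> j (j+1) \<in> Z" using step.prems step.hyps by (intro swap) auto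
      then have "(swap_sites \<eta> j (j+1))(Suc j := True) \<in> Z" using step.prems by (intro step.IH) auto
      also have "(swap_sites \<eta> j (j+1))(Suc j := True) = \<eta>(j := True)"
        using True by (auto simp: swap_sites_def fun_eq_iff)
      finally show ?thesis .
    next
      case False
      have "\<eta>(Suc j := True) \<in> Z" using step.prems by (intro step.IH) auto
      then have sw: "swap_sites (\<eta>(Suc j := True)) j (j+1) \<in> Z" using step.prems step.hyps by (intro swap) auto
      show ?thesis
      proof (cases "\<eta> j")
        case True
        then show ?thesis using step.prems by (simp add: fun_upd_idem)
      next
        case F: False
        then have "swap_sites (\<eta>(Suc j := True)) j (j+1) = \<eta>(j := True)"
          using False by (auto simp: swap_sites_def fun_eq_iff)
        then show ?thesis using sw by (simp only:)
      qed
    qed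
  qed
  show ?thesis
  proof
    fix \<zeta> assume \<zeta>: "\<zeta> \<in> configs {1..N}"
    have "(\<lambda>x. if x \<le> k then \<zeta> x else \<eta>\<^sub>0 x) \<in> Z" if "k \<le> N" for k
      using that
    proof (induction k)
      case 0
      have "(\<lambda>x. if x \<le> 0 then \<zeta> x else \<eta>\<^sub>0 x) = \<eta>\<^sub>0"
        using \<zeta> Z by (auto simp: configs_iff fun_eq_iff)
      then show ?case using Z by simp
    next
      case (Suc k)
      define \<eta> where "\<eta> = (\<lambda>x. if x \<le> k then \<zeta> x else \<eta>\<^sub>0 x)"
      have "\<eta>(Suc k := \<zeta> (Suc k)) \<in> Z"
        using Suc remove[of "Suc k" \<eta>] add[of "Suc k" \<eta>] by (cases "\<zeta> (Suc k)") (auto simp: \<eta>_def)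
      also have "\<eta>(Suc k := \<zeta> (Suc k)) = (\<lambda>x. if x \<le> Suc k then \<zeta> x else \<eta>\<^sub>0 x)"
        by (auto simp: \<eta>_def fun_eq_iff le_Suc_eq)
      finally show ?case .
    qed
    from this[of N] have "(\<lambda>x. if x \<le> N then \<zeta> x else \<eta>\<^sub>0 x) \<in> Z" by simp
    also have "(\<lambda>x. if x \<le> N then \<zeta> x else \<eta>\<^sub>0 x) = \<zeta>"
      using \<zeta> Z by (auto simp: configs_iff fun_eq_iff)
    finally show "\<zeta> \<in> Z" .
  qed
qed

text \<open>
  Testing stationarity on the indicator of a state of mass 0 shows that all its predecessors have mass 0.
\<close>

lemma stationary_zero_propagates:
  assumes nonneg: "\<And>\<eta>. \<eta> \<in> configs {1..N} \<Longrightarrow> 0 \<le> \<nu> \<eta>"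
    and stat: "\<And>f. (\<Sum>\<eta>\<in>configs {1..N}. \<nu> \<eta> * gen f \<eta>) = 0"
    and zero: "\<eta>\<^sub>0 \<in> configs {1..N}" "\<nu> \<eta>\<^sub>0 = 0"
    and \<eta>: "\<eta> \<in> configs {1..N}"
  shows "\<nu> \<eta> = 0"
proof -
  define Z where "Z = {\<eta> \<in> configs {1..N}. \<nu> \<eta> = 0}"
  have r0: "0 \<le> rate x \<xi>" for x \<xi> using q_pos by (auto simp: rate_def)
  have uv: "0 < (1 - q) / (1 + u)" "0 < (1 - q) / (1 + v)" using u v q_less by simp_all
  have pred: "\<nu> \<xi> = 0" if "\<zeta> \<in> Z" "\<xi> \<in> configs {1..N}"
    "\<xi> \<noteq> \<zeta> \<Longrightarrow> 0 < gen (\<lambda>\<eta>. of_bool (\<eta> = \<zeta>)) \<xi>" for \<xi> \<zeta>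
  proof (rule ccontr)
    assume nz: "\<nu> \<xi> \<noteq> 0"
    define f :: "(nat \<Rightarrow> bool) \<Rightarrow> real" where "f = (\<lambda>\<eta>. of_bool (\<eta> = \<zeta>))"
    have "0 \<le> \<nu> \<eta> * gen f \<eta>" if "\<eta> \<in> configs {1..N}" for \<eta>
    proof (cases "\<eta> = \<zeta>")
      case True
      then show ?thesis using \<open>\<zeta> \<in> Z\<close> by (simp add: Z_def)
    next
      case False
      then have "0 \<le> gen f \<eta>" unfolding gen_eq using r0 uv
        by (auto simp: f_def intro!: add_nonneg_nonneg sum_nonneg mult_nonneg_nonneg)
      then show ?thesis using nonneg that by simp
    qed
    moreover have "0 < \<nu> \<xi> * gen f \<xi>"
    proof -
      have "\<xi> \<noteq> \<zeta>" using nz that(1) by (auto simp: Z_def)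
      then have "0 < gen f \<xi>" unfolding f_def by (rule that(3))
      moreover have "0 < \<nu> \<xi>" using nz nonneg[OF that(2)] by simp
      ultimately show ?thesis by simp
    qed
    ultimately have "0 < (\<Sum>\<eta>\<in>configs {1..N}. \<nu> \<eta> * gen f \<eta>)"
      using that by (intro sum_pos2[of _ \<xi>]) auto
    then show False using stat[of f] by simp
  qed
  have "configs {1..N} \<subseteq> Z"
  proof (rule closed_configs_eq_all)
    show "Z \<subseteq> configs {1..N}" by (auto simp: Z_def)
    show "\<eta>\<^sub>0 \<in> Z" using zero by (simp add: Z_def)
  next
    fix \<zeta> x assume \<zeta>: "\<zeta> \<in> Z" and x: "1 \<le> x" "x < N"
    define \<xi> where "\<xi> = swap_sites \<zeta> x (x+1)"
    have c\<xi>: "\<xi> \<in> configs {1..N}" unfolding \<xi>_def using \<zeta> x by (intro swap_configs) (auto simp: Z_def)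
    have "0 < gen (\<lambda>\<eta>. of_bool (\<eta> = \<zeta>)) \<xi>" if "\<xi> \<noteq> \<zeta>"
    proof -
      have revert: "swap_sites \<xi> x (x+1) = \<zeta>" by (simp add: \<xi>_def)
      have "\<xi> x \<noteq> \<xi> (Suc x)"
      proof
        assume "\<xi> x = \<xi> (Suc x)"
        then have "swap_sites \<xi> x (x+1) = \<xi>" by (auto simp: swap_sites_def fun_eq_iff)
        then show False using revert that by simp
      qed
      then have "0 < rate x \<xi>" using q_pos by (auto simp: rate_def)
      then have "0 < rate x \<xi> * (of_bool (swap_sites \<xi> x (x+1) = \<zeta>) - of_bool (\<xi> = \<zeta>))"
        using revert that by simp
      moreover have "0 \<le> rate y \<xi> * (of_bool (swap_sites \<xi> y (y+1) = \<zeta>) - of_bool (\<xi> = \<zeta>))" for y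
        using r0 that by simp
      ultimately have "0 < (\<Sum>x=1..N-1. rate x \<xi> * (of_bool (swap_sites \<xi> x (x+1) = \<zeta>) - of_bool (\<xi> = \<zeta>)))"
        using x by (intro sum_pos2[of _ x]) auto
      then show ?thesis unfolding gen_eq using uv that by (intro add_pos_nonneg) auto
    qed
    then have "\<nu> \<xi> = 0" by (rule pred[OF \<zeta> c\<xi>])
    then show "swap_sites \<zeta> x (x+1) \<in> Z" using c\<xi> by (simp add: Z_def \<xi>_def)
  next
    fix \<zeta> assume \<zeta>: "\<zeta> \<in> Z" and 1: "\<zeta> 1"
    define \<xi> where "\<xi> = flip_site \<zeta> 1"
    have c\<xi>: "\<xi> \<in> configs {1..N}" unfolding \<xi>_def using \<zeta> N by (intro flip_configs) (auto simp: Z_def)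
    have revert: "flip_site \<xi> 1 = \<zeta>" by (simp add: \<xi>_def)
    have "\<not> \<xi> 1" using 1 by (simp add: \<xi>_def flip_site_def)
    then have "0 < gen (\<lambda>\<eta>. of_bool (\<eta> = \<zeta>)) \<xi>" if "\<xi> \<noteq> \<zeta>"
      unfolding gen_eq using uv that r0 revert
      by (intro add_pos_nonneg add_nonneg_pos sum_nonneg mult_nonneg_nonneg mult_pos_pos) auto
    then have "\<nu> \<xi> = 0" by (rule pred[OF \<zeta> c\<xi>])
    then show "flip_site \<zeta> 1 \<in> Z" using c\<xi> by (simp add: Z_def \<xi>_def)
  next
    fix \<zeta> assume \<zeta>: "\<zeta> \<in> Z" and 1: "\<not> \<zeta> N"
    define \<xi> where "\<xi> = flip_site \<zeta> N"
    have c\<xi>: "\<xi> \<in> configs {1..N}" unfolding \<xi>_def using \<zeta> N by (intro flip_configs) (auto simp: Z_def)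
    have revert: "flip_site \<xi> N = \<zeta>" by (simp add: \<xi>_def)
    have "\<xi> N" using 1 by (simp add: \<xi>_def flip_site_def)
    then have "0 < gen (\<lambda>\<eta>. of_bool (\<eta> = \<zeta>)) \<xi>" if "\<xi> \<noteq> \<zeta>"
      unfolding gen_eq using uv that r0 revert
      by (intro add_nonneg_pos add_nonneg_nonneg sum_nonneg mult_nonneg_nonneg mult_pos_pos) auto
    then have "\<nu> \<xi> = 0" by (rule pred[OF \<zeta> c\<xi>])
    then show "flip_site \<zeta> N \<in> Z" using c\<xi> by (simp add: Z_def \<xi>_def)
  qed
  then show ?thesis using \<eta> by (auto simp: Z_def)
qed

lemma wt_pos: "0 < wt \<eta>" by (simp add: wt_def weight_pos)

text \<open>
  Subtract the largest multiple of the matrix product that leaves a nonnegative measure. The difference is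
  stationary and vanishes somewhere, hence everywhere.
\<close>

lemma stationary_eq_matrix_product:
  assumes "open_asep_stationary N q ((1 - q) / (1 + u)) ((1 - q) / (1 + v)) \<mu>"
    and \<eta>: "\<eta> \<in> configs {1..N}"
  shows "pmf \<mu> \<eta> = wt \<eta> / (\<Sum>\<zeta>\<in>configs {1..N}. wt \<zeta>)"
proof -
  define S where "S = configs {1..N}"
  have fin: "finite S" by (simp add: S_def)
  have supp: "set_pmf \<mu> \<subseteq> S" using assms(1) by (simp add: open_asep_stationary_def S_def)
  have "(\<Sum>\<eta>\<in>S. pmf \<mu> \<eta> * gen f \<eta>) = measure_pmf.expectation \<mu> (gen f)" for f
    using supp by (subst integral_measure_pmf[OF fin]) auto
  then have stat: "(\<Sum>\<eta>\<in>S. pmf \<mu> \<eta> * gen f \<eta>) = 0" for f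
    using assms(1) by (simp add: open_asep_stationary_def)
  define c where "c = Min ((\<lambda>\<eta>. pmf \<mu> \<eta> / wt \<eta>) ` S)"
  have "c \<in> (\<lambda>\<eta>. pmf \<mu> \<eta> / wt \<eta>) ` S" unfolding c_def using fin \<eta> by (intro Min_in) (auto simp: S_def)
  then obtain \<eta>\<^sub>0 where \<eta>0: "\<eta>\<^sub>0 \<in> S" "c = pmf \<mu> \<eta>\<^sub>0 / wt \<eta>\<^sub>0" by auto
  have le: "c * wt \<zeta> \<le> pmf \<mu> \<zeta>" if "\<zeta> \<in> S" for \<zeta>
  proof -
    have "c \<le> pmf \<mu> \<zeta> / wt \<zeta>" unfolding c_def using fin that by (intro Min_le) auto
    then show ?thesis using wt_pos[of \<zeta>] by (simp add: field_simps)
  qed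
  have eq: "pmf \<mu> \<zeta> = c * wt \<zeta>" if "\<zeta> \<in> S" for \<zeta>
  proof -
    have "pmf \<mu> \<zeta> - c * wt \<zeta> = 0"
    proof (rule stationary_zero_propagates[where \<eta>\<^sub>0 = \<eta>\<^sub>0])
      show "0 \<le> pmf \<mu> \<eta> - c * wt \<eta>" if "\<eta> \<in> configs {1..N}" for \<eta> using le that by (simp add: S_def)
      show "(\<Sum>\<eta>\<in>configs {1..N}. (pmf \<mu> \<eta> - c * wt \<eta>) * gen f \<eta>) = 0" for f
        using stat[of f] matrix_product_stationary[of f]
        by (simp add: S_def left_diff_distrib sum_subtractf mult.assoc sum_distrib_left[symmetric])
      show "pmf \<mu> \<eta>\<^sub>0 - c * wt \<eta>\<^sub>0 = 0" using \<eta>0 wt_pos[of \<eta>\<^sub>0] by simp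
    qed (use \<eta>0 that in \<open>auto simp: S_def\<close>)
    then show ?thesis by simp
  qed
  have "1 = (\<Sum>\<zeta>\<in>S. pmf \<mu> \<zeta>)" using sum_pmf_eq_1[OF fin supp] by simp
  also have "\<dots> = c * (\<Sum>\<zeta>\<in>S. wt \<zeta>)" by (simp add: eq sum_distrib_left)
  finally have "c = 1 / (\<Sum>\<zeta>\<in>S. wt \<zeta>)" by (metis mult_eq_0_iff nonzero_eq_divide_eq zero_neq_one)
  then show ?thesis using eq[of \<eta>] \<eta> by (simp add: S_def)
qed

end

section \<open>Marginals and the limit\<close>

lemma sum_configs_words:
  "(\<Sum>\<zeta>\<in>configs {a..b}. g (map \<zeta> [a..<Suc b])) = (\<Sum>xs\<in>words (Suc b - a). g xs :: real)"
proof (rule sum.reindex_bij_witness[where j = "\<lambda>\<zeta>. map \<zeta> [a..<Suc b]"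
      and i = "\<lambda>xs x. if x \<in> {a..b} then xs ! (x - a) else False"])
  fix \<zeta> assume "\<zeta> \<in> configs {a..b}"
  then show "(\<lambda>x. if x \<in> {a..b} then map \<zeta> [a..<Suc b] ! (x - a) else False) = \<zeta>"
    by (auto simp: configs_iff fun_eq_iff simp del: upt_Suc)
next
  fix xs assume "xs \<in> words (Suc b - a)"
  then show "map (\<lambda>x. if x \<in> {a..b} then xs ! (x - a) else False) [a..<Suc b] = xs"
    by (auto simp: words_def intro!: nth_equalityI simp del: upt_Suc)
  show "(\<lambda>x. if x \<in> {a..b} then xs ! (x - a) else False) \<in> configs {a..b}"
    by (auto simp: configs_iff)
qed (auto simp: words_def)

lemma sum_words_add:
  "(\<Sum>xs\<in>words (j + k). g xs) = (\<Sum>ys\<in>words j. \<Sum>zs\<in>words k. g (ys @ zs) :: real)"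
  by (induction j arbitrary: g) (simp_all add: words_0 sum_words_Suc)

context open_asep
begin

lemma sum_wt: "(\<Sum>\<eta>\<in>configs {1..N}. wt \<eta>) = total_weight N"
  unfolding wt_def total_weight_def by (subst sum_configs_words) simp

lemma pmf_marginal:
  assumes st: "open_asep_stationary N q ((1 - q) / (1 + u)) ((1 - q) / (1 + v)) \<mu>"
    and ab: "1 \<le> a" "a \<le> b" "b \<le> N" and \<zeta>: "\<zeta> \<in> configs {a..b}"
  shows "pmf (marginal {a..b} \<mu>) \<zeta> = block_weight (a - 1) (N - b) (map \<zeta> [a..<Suc b]) / total_weight N"
proof -
  define S where "S = configs {1..N}"
  define m where "m = Suc b - a"
  define R where "R = (\<lambda>(\<eta> :: nat \<Rightarrow> bool) x. if x \<in> {a..b} then \<eta> x else False)"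
  have fin: "finite S" by (simp add: S_def)
  have supp: "set_pmf \<mu> \<subseteq> S" using st by (simp add: open_asep_stationary_def S_def)
  have N': "N = (a - 1) + (m + (N - b))" using ab by (simp add: m_def)
  have split: "[1..<Suc N] = [1..<a] @ [a..<Suc b] @ [Suc b..<Suc N]"
    using upt_add_eq_append[of 1 a "Suc b - a"] upt_add_eq_append[of 1 "Suc b" "N - b"] ab
    by (simp del: upt_Suc)
  have R: "R \<eta> = \<zeta> \<longleftrightarrow> take m (drop (a - 1) (map \<eta> [1..<Suc N])) = map \<zeta> [a..<Suc b]" for \<eta>
  proof -
    have "take m (drop (a - 1) (map \<eta> [1..<Suc N])) = map \<eta> [a..<Suc b]"
      unfolding split map_append by (simp add: m_def del: upt_Suc)
    moreover have "R \<eta> = \<zeta> \<longleftrightarrow> map \<eta> [a..<Suc b] = map \<zeta> [a..<Suc b]"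
      using \<zeta> by (auto simp: R_def configs_iff fun_eq_iff simp del: upt_Suc)
    ultimately show ?thesis by simp
  qed
  have "pmf (marginal {a..b} \<mu>) \<zeta> = measure_pmf.prob \<mu> (R -` {\<zeta>})"
    by (simp add: marginal_def R_def pmf_map)
  also have "\<dots> = measure_pmf.prob \<mu> (R -` {\<zeta>} \<inter> S)"
  proof -
    have "R -` {\<zeta>} \<inter> S \<inter> set_pmf \<mu> = R -` {\<zeta>} \<inter> set_pmf \<mu>" using supp by auto
    then show ?thesis by (metis measure_Int_set_pmf)
  qed
  also have "\<dots> = (\<Sum>\<eta>\<in>R -` {\<zeta>} \<inter> S. pmf \<mu> \<eta>)" using fin by (intro measure_measure_pmf_finite) auto
  also have "\<dots> = (\<Sum>\<eta>\<in>S. of_bool (R \<eta> = \<zeta>) * pmf \<mu> \<eta>)"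
    using fin by (intro sum.mono_neutral_cong_left) auto
  also have "\<dots> = (\<Sum>\<eta>\<in>S. of_bool (R \<eta> = \<zeta>) * (wt \<eta> / total_weight N))"
    using stationary_eq_matrix_product[OF st, unfolded sum_wt] by (intro sum.cong) (auto simp: S_def)
  also have "\<dots> = (\<Sum>\<eta>\<in>S. of_bool (R \<eta> = \<zeta>) * wt \<eta>) / total_weight N"
    by (simp add: sum_divide_distrib)
  also have "(\<Sum>\<eta>\<in>S. of_bool (R \<eta> = \<zeta>) * wt \<eta>)
     = (\<Sum>xs\<in>words N. of_bool (take m (drop (a - 1) xs) = map \<zeta> [a..<Suc b]) * weight xs)"
    unfolding S_def wt_def R
    by (subst sum_configs_words[where g = "\<lambda>xs. of_bool (take m (drop (a - 1) xs) = map \<zeta> [a..<Suc b]) * weight xs"]) simp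
  also have "\<dots> = (\<Sum>pre\<in>words (a - 1). \<Sum>mid\<in>words m. \<Sum>suf\<in>words (N - b).
      of_bool (mid = map \<zeta> [a..<Suc b]) * weight (pre @ mid @ suf))"
    unfolding arg_cong[OF N', of words] sum_words_add by (intro sum.cong refl) (auto simp: words_def)
  also have "\<dots> = (\<Sum>pre\<in>words (a - 1). \<Sum>mid\<in>words m. if mid = map \<zeta> [a..<Suc b]
      then (\<Sum>suf\<in>words (N - b). weight (pre @ mid @ suf)) else 0)"
    by (intro sum.cong refl) (simp add: if_distrib cong: if_cong)
  also have "\<dots> = block_weight (a - 1) (N - b) (map \<zeta> [a..<Suc b])"
  proof -
    have "map \<zeta> [a..<Suc b] \<in> words m" by (simp add: words_def m_def del: upt_Suc)
    then show ?thesis by (simp add: block_weight_def sum.delta del: upt_Suc)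
  qed
  finally show ?thesis .
qed

lemma pmf_Ber_half: "\<zeta> \<in> configs {a..b} \<Longrightarrow> pmf (Ber {a..b} (1 / 2)) \<zeta> = 1 / 2 ^ (Suc b - a)"
proof -
  assume "\<zeta> \<in> configs {a..b}"
  then have "pmf (Ber {a..b} (1 / 2)) \<zeta> = (\<Prod>x\<in>{a..b}. pmf (bernoulli_pmf (1 / 2)) (\<zeta> x))"
    unfolding Ber_def by (intro pmf_Pi') (auto simp: configs_iff)
  also have "\<dots> = (\<Prod>x\<in>{a..b}. 1 / 2)"
  proof (intro prod.cong refl)
    fix x show "pmf (bernoulli_pmf (1 / 2)) (\<zeta> x) = 1 / 2" by (cases "\<zeta> x") auto
  qed
  finally show ?thesis by (simp add: power_one_over)
qed

theorem marginal_near_product: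
  assumes st: "open_asep_stationary N q ((1 - q) / (1 + u)) ((1 - q) / (1 + v)) \<mu>"
    and ab: "1 \<le> a" "a \<le> b" "b \<le> N"
    and L: "1 / (1 - q) \<le> real L" "q ^ L \<le> (1 - q)\<^sup>2 / 96"
    and k: "k = min (a - 1) (N - b)" "64 * killed_walk.C\<^sub>1 \<rho> C\<^sub>0 * (real L)\<^sup>2 \<le> real k" "Suc b - a \<le> k"
  shows "tv_dist (configs {a..b}) (marginal {a..b} \<mu>) (Ber {a..b} (1 / 2))
    \<le> word_walk.K\<^sub>2 \<rho> C\<^sub>0 (24 / \<theta>) * (root 4 (real (Suc b - a) / real k) + real L / sqrt (real k))"
proof -
  define m where "m = Suc b - a"
  have N': "N = (a - 1) + m + (N - b)" using ab by (simp add: m_def)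
  have "(\<Sum>\<zeta>\<in>configs {a..b}. \<bar>pmf (marginal {a..b} \<mu>) \<zeta> - pmf (Ber {a..b} (1 / 2)) \<zeta>\<bar>)
      = (\<Sum>\<zeta>\<in>configs {a..b}. \<bar>block_weight (a - 1) (N - b) (map \<zeta> [a..<Suc b]) / total_weight N - 1 / 2 ^ m\<bar>)"
    by (intro sum.cong refl) (simp add: pmf_marginal[OF st ab] pmf_Ber_half m_def del: upt_Suc)
  also have "\<dots> = (\<Sum>xs\<in>words m. \<bar>block_weight (a - 1) (N - b) xs / total_weight N - 1 / 2 ^ m\<bar>)"
    unfolding m_def
    by (rule sum_configs_words[where g = "\<lambda>xs. \<bar>block_weight (a - 1) (N - b) xs / total_weight N - 1 / 2 ^ (Suc b - a)\<bar>"])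
  also have "\<dots> \<le> 2 * word_walk.K\<^sub>2 \<rho> C\<^sub>0 (24 / \<theta>) * (root 4 (real m / real k) + real L / sqrt (real k))"
    unfolding arg_cong[OF N', of total_weight]
    using ab k by (intro block_near_uniform[OF L]) (auto simp: m_def)
  finally have "(\<Sum>\<zeta>\<in>configs {a..b}. \<bar>pmf (marginal {a..b} \<mu>) \<zeta> - pmf (Ber {a..b} (1 / 2)) \<zeta>\<bar>)
      \<le> 2 * (word_walk.K\<^sub>2 \<rho> C\<^sub>0 (24 / \<theta>) * (root 4 (real m / real k) + real L / sqrt (real k)))"
    by (simp only: mult.assoc)
  then show ?thesis unfolding tv_dist_def m_def by linarith
qed

end

lemma one_minus_exp_lower: "y / 2 \<le> 1 - exp (- y)" if "0 \<le> y" "y \<le> 1" for y :: real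
proof -
  have "1 + y \<le> exp y" by (rule exp_ge_add_one_self)
  then have "exp (- y) \<le> 1 / (1 + y)" using that by (simp add: exp_minus field_simps)
  also have "\<dots> \<le> 1 - y / 2"
  proof -
    have "y * y \<le> y * 1" using that by (intro mult_left_mono) auto
    then show ?thesis using that by (simp add: field_simps)
  qed
  finally show ?thesis by simp
qed

text \<open>
  Since \<open>1 - q\<close> is of order \<open>N^(-\<epsilon>)\<close>, a width of \<open>A * N^\<epsilon> * ln N\<close> makes \<open>q^L = N^(-c A)\<close>; the
  exponent \<open>2 \<epsilon> + 1\<close> beats \<open>(1 - q)^2\<close>.
\<close>

lemma wall_width_eventually:
  fixes c \<epsilon> :: real and q :: "nat \<Rightarrow> real"
  assumes c: "0 < c" and \<epsilon>: "0 < \<epsilon>"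
    and q: "\<And>N. N \<ge> 1 \<Longrightarrow> q N = exp (- c * real N powr (- \<epsilon>))"
  shows "\<forall>\<^sub>F N in sequentially. \<exists>L. 1 / (1 - q N) \<le> real L \<and> q N ^ L \<le> (1 - q N)\<^sup>2 / 96
      \<and> real L \<le> ((2 * \<epsilon> + 1) / c + 1) * (real N powr \<epsilon> * ln (real N))"
proof -
  define A where "A = (2 * \<epsilon> + 1) / c"
  have A: "0 < A" using c \<epsilon> by (simp add: A_def)
  have "\<forall>\<^sub>F N in sequentially. c * real N powr (- \<epsilon>) \<le> 1"
    using c \<epsilon> by real_asymp
  moreover have "\<forall>\<^sub>F N in sequentially. 2 / c * real N powr \<epsilon> \<le> A * (real N powr \<epsilon> * ln (real N))"
    using c \<epsilon> A by real_asymp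
  moreover have "\<forall>\<^sub>F N in sequentially. 1 \<le> real N powr \<epsilon> * ln (real N)"
    using \<epsilon> by real_asymp
  moreover have "\<forall>\<^sub>F N in sequentially. real N powr (- (2 * \<epsilon> + 1)) \<le> (c * real N powr (- \<epsilon>) / 2)\<^sup>2 / 96"
    using c \<epsilon> by real_asymp
  moreover have "\<forall>\<^sub>F N in sequentially. 1 \<le> N" by (rule eventually_ge_at_top)
  ultimately show ?thesis
  proof eventually_elim
    case (elim N)
    define y where "y = c * real N powr (- \<epsilon>)"
    have y: "0 < y" "y \<le> 1" using c elim by (simp_all add: y_def)
    have qN: "q N = exp (- y)" using q[of N] elim by (simp add: y_def)
    have 1: "y / 2 \<le> 1 - q N" unfolding qN using y by (intro one_minus_exp_lower) auto
    define x where "x = real N powr \<epsilon> * ln (real N)"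
    define L where "L = nat \<lceil>A * x\<rceil>"
    have x: "1 \<le> x" using elim by (simp add: x_def)
    have Ax: "0 < A * x" using A x by simp
    have L1: "A * x \<le> real L" unfolding L_def by linarith
    have L2: "real L \<le> A * x + 1" unfolding L_def using Ax by linarith
    have "1 / (1 - q N) \<le> 1 / (y / 2)" using 1 y by (intro divide_left_mono) auto
    also have "\<dots> = 2 / c * real N powr \<epsilon>" using c elim by (simp add: y_def powr_minus field_simps)
    also have "\<dots> \<le> real L" using elim(2) L1 by (simp add: x_def)
    finally have A1: "1 / (1 - q N) \<le> real L" .
    have "q N ^ L = exp (- (y * real L))" unfolding qN by (simp add: exp_of_nat_mult[symmetric] mult.commute)
    also have "\<dots> \<le> exp (- (y * (A * x)))" using L1 y by simp
    also have "y * (A * x) = (2 * \<epsilon> + 1) * ln (real N)"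
      using c elim by (simp add: y_def x_def A_def powr_minus field_simps)
    also have "exp (- ((2 * \<epsilon> + 1) * ln (real N))) = real N powr (- (2 * \<epsilon> + 1))"
      using elim by (simp add: powr_def algebra_simps)
    also have "\<dots> \<le> (y / 2)\<^sup>2 / 96" using elim(4) by (simp add: y_def)
    also have "\<dots> \<le> (1 - q N)\<^sup>2 / 96" using 1 y by (intro divide_right_mono power_mono) auto
    finally have A2: "q N ^ L \<le> (1 - q N)\<^sup>2 / 96" .
    have "real L \<le> (A + 1) * x" using L2 x by (simp add: algebra_simps)
    then show ?case using A1 A2 unfolding A_def x_def by blast
  qed
qed

lemma much_greater_imp_at_top:
  assumes "much_greater f g"
  shows "filterlim (\<lambda>N. f N / g N) at_top sequentially"
  unfolding filterlim_at_top
proof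
  fix Z :: real
  have "ereal Z < liminf (\<lambda>N. ereal (f N / g N))" using assms by (simp add: much_greater_def)
  from less_LiminfD[OF this] show "\<forall>\<^sub>F N in sequentially. Z \<le> f N / g N"
    by (rule eventually_mono) simp
qed

text \<open>
  Both alternatives imply that \<open>\<psi>\<close>, the distance of the interval to the ends divided by
  \<open>max (N^(2\<epsilon>) ln^2 N) |I|\<close>, tends to infinity. The total variation distance is eventually at most
  a constant times \<open>\<psi>^(-1/4) + \<psi>^(-1/2)\<close>.
\<close>

theorem theorem1p5:
  fixes \<epsilon> c\<^sub>q u v :: real
    and q \<alpha> \<beta> :: "nat \<Rightarrow> real"
    and a b :: "nat \<Rightarrow> nat"
    and \<mu> :: "nat \<Rightarrow> (nat \<Rightarrow> bool) pmf"
  assumes "\<epsilon> > 0" and "c\<^sub>q > 0"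
    and "u > -1" and "v > -1" and "max u v < 1"
    and "\<And>N. N \<ge> 1 \<Longrightarrow> q N = exp (- c\<^sub>q * real N powr (- \<epsilon>))"
    and "\<And>N. N \<ge> 1 \<Longrightarrow> \<alpha> N = (1 - q N) / (1 + u)"
    and "\<And>N. N \<ge> 1 \<Longrightarrow> \<beta> N = (1 - q N) / (1 + v)"
    and "\<And>N. N \<ge> 1 \<Longrightarrow> open_asep_stationary N (q N) (\<alpha> N) (\<beta> N) (\<mu> N)"
    and "\<And>N. N \<ge> 1 \<Longrightarrow> 1 \<le> a N \<and> a N \<le> b N \<and> b N \<le> N"
    and "(u + v \<le> 0 \<and> \<epsilon> < 1 / 2 \<and>
            much_greater (\<lambda>N. min (real (a N)) (real N - real (b N)))
              (\<lambda>N. max (real N powr (2 * \<epsilon>) * (ln (real N))\<^sup>2) (real (card {a N..b N}))))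
         \<or> (u + v > 0 \<and> \<epsilon> < 1 / 3 \<and>
            much_greater (\<lambda>N. min (real (a N)) (real N - real (b N)))
              (\<lambda>N. max (real N powr (3 * \<epsilon>) * ln (real N)) (real (card {a N..b N}))))"
  shows "(\<lambda>N. tv_dist (configs {a N..b N}) (marginal {a N..b N} (\<mu> N)) (Ber {a N..b N} (1 / 2)))
           \<longlonglongrightarrow> 0"
proof -
  note \<epsilon> = assms(1) and c = assms(2) and u = assms(3) and v = assms(4) and uv = assms(5)
  note q = assms(6) and \<alpha> = assms(7) and \<beta> = assms(8) and st = assms(9) and ab = assms(10)
  define f where "f N = min (real (a N)) (real N - real (b N))" for N
  define m where "m N = Suc (b N) - a N" for N
  define g where "g N = max (real N powr (2 * \<epsilon>) * (ln (real N))\<^sup>2) (real (m N))" for N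
  define \<psi> where "\<psi> N = f N / g N" for N
  have card: "card {a N..b N} = m N" for N by (simp add: m_def)
  have \<psi>: "filterlim \<psi> at_top sequentially"
    using assms(11)
  proof
    assume "u + v \<le> 0 \<and> \<epsilon> < 1 / 2 \<and>
            much_greater (\<lambda>N. min (real (a N)) (real N - real (b N)))
              (\<lambda>N. max (real N powr (2 * \<epsilon>) * (ln (real N))\<^sup>2) (real (card {a N..b N})))"
    then have "much_greater f g" unfolding f_def[abs_def] g_def[abs_def] card by blast
    then show ?thesis unfolding \<psi>_def[abs_def] by (rule much_greater_imp_at_top)
  next
    define g' where "g' N = max (real N powr (3 * \<epsilon>) * ln (real N)) (real (m N))" for N
    assume "u + v > 0 \<and> \<epsilon> < 1 / 3 \<and>
            much_greater (\<lambda>N. min (real (a N)) (real N - real (b N)))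
              (\<lambda>N. max (real N powr (3 * \<epsilon>) * ln (real N)) (real (card {a N..b N})))"
    then have "much_greater f g'" unfolding f_def[abs_def] g'_def[abs_def] card by blast
    then have "filterlim (\<lambda>N. f N / g' N) at_top sequentially" by (rule much_greater_imp_at_top)
    moreover have "\<forall>\<^sub>F N in sequentially. real N powr (2 * \<epsilon>) * (ln (real N))\<^sup>2 \<le> real N powr (3 * \<epsilon>) * ln (real N)"
      using \<epsilon> by real_asymp
    then have "\<forall>\<^sub>F N in sequentially. f N / g' N \<le> \<psi> N"
      using eventually_ge_at_top[of 1]
    proof eventually_elim
      case (elim N)
      have f0: "0 \<le> f N" using ab[of N] elim by (simp add: f_def)
      have "1 \<le> real (m N)" using ab[of N] elim by (simp add: m_def)
      then have "0 < g N" by (simp add: g_def)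
      moreover have "g N \<le> g' N" using elim by (auto simp: g_def g'_def)
      ultimately show ?case unfolding \<psi>_def using f0 by (intro divide_left_mono) auto
    qed
    ultimately show ?thesis by (rule filterlim_at_top_mono)
  qed
  define \<theta> where "\<theta> = (1 - u) * (1 - v)"
  have \<theta>: "0 < \<theta>" using uv by (simp add: \<theta>_def)
  have uv1: "\<bar>u * v\<bar> < 1"
  proof -
    have "\<bar>u\<bar> * \<bar>v\<bar> < 1 * 1" using u v uv by (intro mult_strict_mono) auto
    then show ?thesis by (simp add: abs_mult)
  qed
  define A where "A = (2 * \<epsilon> + 1) / c\<^sub>q + 1"
  have A: "0 < A" using \<epsilon> c by (simp add: A_def add_pos_pos)
  define C where "C = killed_walk.C\<^sub>1 (asep_params.\<rho> u v) (asep_params.C\<^sub>0 u v)"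
  define K where "K = word_walk.K\<^sub>2 (asep_params.\<rho> u v) (asep_params.C\<^sub>0 u v) (24 / asep_params.\<theta> u v)"
  define tv where "tv N = tv_dist (configs {a N..b N}) (marginal {a N..b N} (\<mu> N)) (Ber {a N..b N} (1 / 2))" for N
  have q1: "q \<longlonglongrightarrow> 1"
  proof (rule Lim_transform_eventually)
    show "(\<lambda>N. exp (- c\<^sub>q * real N powr (- \<epsilon>))) \<longlonglongrightarrow> 1" using c \<epsilon> by real_asymp
    show "\<forall>\<^sub>F N in sequentially. exp (- c\<^sub>q * real N powr (- \<epsilon>)) = q N"
      using eventually_ge_at_top[of 1] by eventually_elim (simp add: q)
  qed
  have width: "\<forall>\<^sub>F N in sequentially. \<exists>L. 1 / (1 - q N) \<le> real L \<and> q N ^ L \<le> (1 - q N)\<^sup>2 / 96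
      \<and> real L \<le> A * (real N powr \<epsilon> * ln (real N))"
    unfolding A_def by (rule wall_width_eventually[OF c \<epsilon>]) (rule q)
  have "\<forall>\<^sub>F N in sequentially. 1 / 2 < q N" "\<forall>\<^sub>F N in sequentially. \<bar>u * v\<bar> < q N"
    "\<forall>\<^sub>F N in sequentially. 1 - \<theta> / 2 < q N"
    using order_tendstoD(1)[OF q1, of "1 / 2"] order_tendstoD(1)[OF q1, of "\<bar>u * v\<bar>"]
      order_tendstoD(1)[OF q1, of "1 - \<theta> / 2"] uv1 \<theta> by simp_all
  moreover have "\<forall>\<^sub>F N in sequentially. max (128 * C * A\<^sup>2) 2 \<le> \<psi> N"
    using \<psi> unfolding filterlim_at_top by blast
  ultimately have bound: "\<forall>\<^sub>F N in sequentially. tv N \<le> \<bar>K\<bar> * (root 4 (2 / \<psi> N) + sqrt (2 * A\<^sup>2 / \<psi> N))"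
    using width eventually_ge_at_top[of 2]
  proof eventually_elim
    case (elim N)
    have N1: "1 \<le> N" using elim by simp
    interpret W: open_asep u v "q N" N
    proof
      show "q N < 1" using q[OF N1] c N1 by simp
    qed (use elim u v uv in \<open>auto simp: \<theta>_def\<close>)
    obtain L where L: "1 / (1 - q N) \<le> real L" "q N ^ L \<le> (1 - q N)\<^sup>2 / 96"
      and LA: "real L \<le> A * (real N powr \<epsilon> * ln (real N))"
      using elim by blast
    have abN: "1 \<le> a N" "a N \<le> b N" "b N \<le> N" using ab[OF N1] by auto
    have m1: "1 \<le> real (m N)" using abN by (simp add: m_def)
    have g: "1 \<le> g N" "real (m N) \<le> g N" "real N powr (2 * \<epsilon>) * (ln (real N))\<^sup>2 \<le> g N"
      using m1 by (auto simp: g_def)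
    have psi: "2 \<le> \<psi> N" "128 * C * A\<^sup>2 \<le> \<psi> N" using elim by auto
    have f: "f N = \<psi> N * g N" using g by (simp add: \<psi>_def)
    have f2: "2 \<le> f N" unfolding f using mult_mono[of 2 "\<psi> N" 1 "g N"] psi g by simp
    define k where "k = min (a N - 1) (N - b N)"
    have "f N - 1 \<le> real k" using abN by (auto simp: f_def k_def of_nat_diff min_def)
    then have k: "f N / 2 \<le> real k" using f2 by linarith
    then have k0: "0 < real k" using f2 by linarith
    have mk: "real (m N) / real k \<le> 2 / \<psi> N"
    proof -
      have "\<psi> N * real (m N) \<le> f N" unfolding f using g psi by (intro mult_left_mono) auto
      then have "\<psi> N * real (m N) \<le> 2 * real k" using k by linarith
      then show ?thesis using k0 psi by (simp add: field_simps)
    qed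
    have Lk: "(real L)\<^sup>2 / real k \<le> 2 * A\<^sup>2 / \<psi> N"
    proof -
      have "(real L)\<^sup>2 \<le> (A * (real N powr \<epsilon> * ln (real N)))\<^sup>2" using LA by (intro power_mono) auto
      also have "\<dots> = A\<^sup>2 * (real N powr (2 * \<epsilon>) * (ln (real N))\<^sup>2)"
        using N1 by (simp add: power_mult_distrib powr_power mult.commute)
      also have "\<dots> \<le> A\<^sup>2 * g N" using g by (intro mult_left_mono) auto
      finally have "\<psi> N * (real L)\<^sup>2 \<le> \<psi> N * (A\<^sup>2 * g N)" using psi by (intro mult_left_mono) auto
      also have "\<dots> = A\<^sup>2 * f N" by (simp add: f)
      also have "\<dots> \<le> A\<^sup>2 * (2 * real k)" using k by (intro mult_left_mono) auto
      finally show ?thesis using k0 psi by (simp add: field_simps)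
    qed
    have C1: "64 * C * (real L)\<^sup>2 \<le> real k"
    proof (cases "0 \<le> C")
      case True
      have "64 * C * ((real L)\<^sup>2 / real k) \<le> 64 * C * (2 * A\<^sup>2 / \<psi> N)" using Lk True by (intro mult_left_mono) auto
      also have "\<dots> \<le> 1" using psi by (simp add: field_simps)
      finally show ?thesis using k0 by (simp add: field_simps)
    next
      case False
      then have "64 * C * (real L)\<^sup>2 \<le> 0"
        using mult_nonpos_nonneg[of "64 * C" "(real L)\<^sup>2"] by simp
      then show ?thesis using k0 by linarith
    qed
    have "2 / \<psi> N \<le> 1" using psi by simp
    then have "real (m N) / real k \<le> 1" using mk by linarith
    then have mk': "m N \<le> k" using k0 by (simp add: field_simps)
    have "tv N \<le> K * (root 4 (real (m N) / real k) + real L / sqrt (real k))"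
      unfolding tv_def K_def m_def using st[OF N1] abN L C1 mk'
      by (intro W.marginal_near_product) (auto simp: k_def m_def C_def \<alpha>[OF N1] \<beta>[OF N1])
    also have "\<dots> \<le> \<bar>K\<bar> * (root 4 (real (m N) / real k) + real L / sqrt (real k))"
      by (intro mult_right_mono) auto
    also have "\<dots> \<le> \<bar>K\<bar> * (root 4 (2 / \<psi> N) + sqrt (2 * A\<^sup>2 / \<psi> N))"
    proof (intro mult_left_mono add_mono)
      show "root 4 (real (m N) / real k) \<le> root 4 (2 / \<psi> N)" using mk by simp
      have "real L / sqrt (real k) = sqrt ((real L)\<^sup>2 / real k)" by (simp add: real_sqrt_divide)
      also have "\<dots> \<le> sqrt (2 * A\<^sup>2 / \<psi> N)" using Lk by simp
      finally show "real L / sqrt (real k) \<le> sqrt (2 * A\<^sup>2 / \<psi> N)" .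
    qed simp
    finally show ?case .
  qed
  have lim: "(\<lambda>N. \<bar>K\<bar> * (root 4 (2 / \<psi> N) + sqrt (2 * A\<^sup>2 / \<psi> N))) \<longlonglongrightarrow> 0"
  proof -
    have "(\<lambda>N. x / \<psi> N) \<longlonglongrightarrow> 0" for x
      by (intro real_tendsto_divide_at_top[OF tendsto_const] \<psi>)
    then have "(\<lambda>N. \<bar>K\<bar> * (root 4 (2 / \<psi> N) + sqrt (2 * A\<^sup>2 / \<psi> N))) \<longlonglongrightarrow> \<bar>K\<bar> * (root 4 0 + sqrt 0)"
      by (intro tendsto_intros)
    then show ?thesis by simp
  qed
  have "tv \<longlonglongrightarrow> 0"
  proof (rule tendsto_sandwich[OF _ bound tendsto_const lim])
    show "\<forall>\<^sub>F N in sequentially. 0 \<le> tv N" by (simp add: tv_def tv_dist_def sum_nonneg)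
  qed
  then show ?thesis by (simp add: tv_def[abs_def])
qed

end
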